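(* The parameterized factorization problem for transformation monoids, $\mathsf{pF}[\mathsf{T}_*]$, belongs to the class $\mathsf{W}^{\mathsf{func}}[2]$.
   Context: $\mathbb{N}$ includes $0$. A parameterized problem is a subset $L\subseteq\Sigma^*\times\mathbb{N}$ for a finite alphabet $\Sigma$; in $(u,k)$ the number $k$ is the parameter. An fpt-reduction from $L_1\subseteq\Sigma_1^*\times\mathbb{N}$ to $L_2\subseteq\Sigma_2^*\times\mathbb{N}$ is a computable function $r:\Sigma_1^*\times\mathbb{N}\to\Sigma_2^*\times\mathbb{N}$ such that: $r(u,k)=(g(u,k),h(k))$ for some functions $g,h$; $r(u,k)$ can be computed in time $\mathrm{poly}(|u|)\cdot f(k)$ for some computable $f:\mathbb{N}\to\mathbb{N}$; and $(u,k)\in L_1$ iff $r(u,k)\in L_2$. Write $L_1\leq^{\mathsf{fpt}}L_2$ if such a reduction exists. $[L]^{\mathsf{fpt}}$ is the class of all parameterized problems $K$ with $K\leq^{\mathsf{fpt}}L$. $T_n$ is the monoid of all mappings $[1,n]\to[1,n]$ under composition, where products are evaluated from left to right: $(fg)(a)=g(f(a))$. For a subset $A$ of a monoid, $A^k$ is the set of all products of exactly $k$ elements of $A$ (repetitions allowed). $\mathsf{pF}[\mathsf{T}_*]$: Input: $n\geq 1$ in unary, elements $a,a_1,\dots,a_m\in T_n$ (each $f\in T_n$ given by the list $f(1),\dots,f(n)$), and $k\in\mathbb{N}$ (the parameter). Question: is $a\in\{a_1,\dots,a_m\}^k$? A signature is a finite set of relation symbols (arities $\geq1$) and function symbols (arities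 $\geq0$; arity $0$ are constants). Structures over a signature, terms and first-order formulas (with equality, $\neg,\wedge,\vee,\exists,\forall$) are defined as usual; the structures given as inputs are finite. The size of a term is the number of occurrences of symbols in it: $|x|=|c|=1$ for variables $x$ and constants $c$, $|f(t_1,\dots,t_n)|=1+\sum_i|t_i|$. The length of a formula is defined by $|t_1=t_2|=1+|t_1|+|t_2|$, $|r(t_1,\dots,t_n)|=1+\sum_i|t_i|$, $|F\wedge G|=|F\vee G|=|F|+|G|+1$, $|\neg F|=|\exists xF|=|\forall xF|=|F|+1$. For a class $\mathsf{D}$ of first-order sentences, $\mathsf{pMC}(\mathsf{D})$ is the parameterized problem: Input: a sentence $F\in\mathsf{D}$ and a structure $\mathcal{A}$; Parameter: $|F|$; Question: does $\mathcal{A}\models F$ hold? $\Sigma^{\mathsf{func}}_{l,u}$ is the class of first-order sentences (arbitrary terms, including function symbols, allowed) of the form $\exists\overline{x}_1\forall\overline{x}_2\cdots Q_l\overline{x}_l\,\psi$, where $\psi$ is quantifier-free, $Q_l=\exists$ if $l$ is odd and $Q_l=\forall$ if $l$ is even, $\overline{x}_1$ is a tuple of variables of arbitrary length and every $\overline{x}_i$ with $2\leq i\leq l$ has at most $u$ variables. $\mathsf{W}^{\mathsf{func}}[l]=[\mathsf{pMC}(\Sigma^{\mathsf{func}}_{l,1})]^{\mathsf{fpt}}$. *)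

theory Defs
  imports
    "HOL-Computational_Algebra.Polynomial"
    "HOL-Algebra.Group"
begin

section \<open>Multitape Turing machines\<close>

text \<open>
  Symbols are natural numbers; a cell holds \<open>None\<close> (blank) or \<open>Some s\<close>. A tape is two-way infinite
  and consists of the head position and the cell contents.
\<close>

datatype move = MoveL | Stay | MoveR

fun shift :: "move \<Rightarrow> int" where
  "shift MoveL = -1"
| "shift Stay = 0"
| "shift MoveR = 1"

type_synonym tape = "int \<times> (int \<Rightarrow> nat option)"
type_synonym config = "nat \<times> tape list"

record tm =
  tm_tapes :: nat
  tm_states :: "nat set"
  tm_symbols :: "nat set"
  tm_start :: nat
  tm_halt :: nat
  tm_delta :: "nat \<Rightarrow> nat option list \<Rightarrow> nat \<times> (nat option \<times> move) list"

definition tm_cells :: "tm \<Rightarrow> nat option set" where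
  "tm_cells M = insert None (Some ` tm_symbols M)"

text \<open>The transition function only matters, and is only constrained, on the finitely many
  arguments that can occur.\<close>

definition turing_machine :: "tm \<Rightarrow> bool" where
  "turing_machine M \<longleftrightarrow>
     finite (tm_states M) \<and> finite (tm_symbols M) \<and>
     tm_start M \<in> tm_states M \<and> tm_halt M \<in> tm_states M \<and>
     (\<forall>q \<in> tm_states M. \<forall>cs. length cs = tm_tapes M \<and> set cs \<subseteq> tm_cells M \<longrightarrow>
        fst (tm_delta M q cs) \<in> tm_states M \<and>
        length (snd (tm_delta M q cs)) = tm_tapes M \<and>
        fst ` set (snd (tm_delta M q cs)) \<subseteq> tm_cells M)"

definition read_tape :: "tape \<Rightarrow> nat option" where
  "read_tape t = snd t (fst t)"

definition act_tape :: "nat option \<times> move \<Rightarrow> tape \<Rightarrow> tape" where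
  "act_tape a t = (fst t + shift (snd a), (snd t)(fst t := fst a))"

definition tm_step :: "tm \<Rightarrow> config \<Rightarrow> config" where
  "tm_step M c =
     (if fst c = tm_halt M then c
      else let (q, as) = tm_delta M (fst c) (map read_tape (snd c))
           in (q, map2 act_tape as (snd c)))"

definition input_tape :: "nat list \<Rightarrow> tape" where
  "input_tape w = (0, \<lambda>i. if 0 \<le> i \<and> i < int (length w) then Some (w ! nat i) else None)"

definition tm_init :: "tm \<Rightarrow> nat list list \<Rightarrow> config" where
  "tm_init M ws =
     (tm_start M,
      map (\<lambda>i. input_tape (if i < length ws then ws ! i else [])) [0..<tm_tapes M])"

text \<open>The output on a tape is the word from the head position up to the first blank.\<close>

definition output_tape :: "tape \<Rightarrow> nat list \<Rightarrow> bool" where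
  "output_tape t w \<longleftrightarrow>
     (\<forall>i < length w. snd t (fst t + int i) = Some (w ! i)) \<and>
     snd t (fst t + int (length w)) = None"

text \<open>Since \<open>tm_step\<close> is the identity on halted configurations, \<open>t\<close> is an upper bound on the running time.\<close>

definition tm_computes :: "tm \<Rightarrow> nat list list \<Rightarrow> nat list list \<Rightarrow> nat \<Rightarrow> bool" where
  "tm_computes M ins outs t \<longleftrightarrow>
     length ins \<le> tm_tapes M \<and> length outs \<le> tm_tapes M \<and>
     (\<forall>w \<in> set ins. set w \<subseteq> tm_symbols M) \<and>
     (let c = (tm_step M ^^ t) (tm_init M ins)
      in fst c = tm_halt M \<and> (\<forall>i < length outs. output_tape (snd c ! i) (outs ! i)))"

definition unary :: "nat \<Rightarrow> nat list" where
  "unary n = replicate n 1"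

definition computable :: "(nat \<Rightarrow> nat) \<Rightarrow> bool" where
  "computable f \<longleftrightarrow>
     (\<exists>M. turing_machine M \<and> (\<forall>k. \<exists>t. tm_computes M [unary k] [unary (f k)] t))"


section \<open>Parameterized problems and fpt-reductions\<close>

record param_problem =
  alphabet :: "nat set"
  instances :: "(nat list \<times> nat) set"

definition is_param_problem :: "param_problem \<Rightarrow> bool" where
  "is_param_problem P \<longleftrightarrow>
     finite (alphabet P) \<and> instances P \<subseteq> lists (alphabet P) \<times> UNIV"

text \<open>
  The machine receives the word and the parameter, the latter in unary, on two separate tapes, and
  leaves its results there likewise. Since the factor \<open>f\<close> is an arbitrary computable function, the
  choice between unary and binary parameters is immaterial.
\<close>

definition computable_in_fpt_time ::
    "nat set \<Rightarrow> (nat list \<times> nat \<Rightarrow> nat list \<times> nat) \<Rightarrow> bool" where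
  "computable_in_fpt_time \<Sigma> r \<longleftrightarrow>
     (\<exists>M (p :: nat poly) f. turing_machine M \<and> computable f \<and>
        (\<forall>u \<in> lists \<Sigma>. \<forall>k.
           tm_computes M [u, unary k] [fst (r (u, k)), unary (snd (r (u, k)))]
             (poly p (length u) * f k)))"

definition fpt_reduction ::
    "(nat list \<times> nat \<Rightarrow> nat list \<times> nat) \<Rightarrow> param_problem \<Rightarrow> param_problem \<Rightarrow> bool" where
  "fpt_reduction r P Q \<longleftrightarrow>
     r \<in> lists (alphabet P) \<times> UNIV \<rightarrow> lists (alphabet Q) \<times> UNIV \<and>
     (\<exists>g h. \<forall>u \<in> lists (alphabet P). \<forall>k. r (u, k) = (g (u, k), h k)) \<and>
     computable_in_fpt_time (alphabet P) r \<and>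
     (\<forall>u \<in> lists (alphabet P). \<forall>k. (u, k) \<in> instances P \<longleftrightarrow> r (u, k) \<in> instances Q)"

definition fpt_le :: "param_problem \<Rightarrow> param_problem \<Rightarrow> bool" (infix "\<le>fpt" 50) where
  "P \<le>fpt Q \<longleftrightarrow> is_param_problem P \<and> is_param_problem Q \<and> (\<exists>r. fpt_reduction r P Q)"

definition fpt_class :: "param_problem \<Rightarrow> param_problem set" where
  "fpt_class Q = {P. P \<le>fpt Q}"


section \<open>Encoding of inputs as words\<close>

text \<open>
  Inputs are first turned into trees of numbers, and these are written as words over a
  four-letter alphabet: \<open>0\<close> ends a unary number, \<open>2\<close> and \<open>3\<close> are brackets.
\<close>

datatype data = Num nat | Seq "data list"

fun encode :: "data \<Rightarrow> nat list" where
  "encode (Num n) = unary n @ [0]"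
| "encode (Seq ds) = [2] @ concat (map encode ds) @ [3]"

definition code_alphabet :: "nat set" where
  "code_alphabet = {0, 1, 2, 3}"

lemma encode_append_eqD:
  "encode d @ v = encode d' @ v' \<Longrightarrow> d = d' \<and> v = v'"
proof (induction d arbitrary: d' v v')
  case (Num n)
  show ?case
  proof (cases d')
    case (Num m)
    have "replicate n (1::nat) @ 0 # v = replicate m 1 @ 0 # v' \<Longrightarrow> n = m \<and> v = v'"
    proof (induction n arbitrary: m)
      case 0 then show ?case by (cases m) auto
    next
      case (Suc n) then show ?case by (cases m) auto
    qed
    with Num Num.prems show ?thesis by (simp add: unary_def)
  next
    case (Seq ds)
    with Num.prems show ?thesis by (cases n) (auto simp: unary_def)
  qed
next
  case (Seq ds)
  have hd: "\<exists>x xs. encode d = x # xs \<and> x \<noteq> 3" for d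
  proof (cases d)
    case (Num n) then show ?thesis by (cases n) (auto simp: unary_def)
  qed auto
  show ?case
  proof (cases d')
    case (Num m)
    with Seq.prems show ?thesis by (cases m) (auto simp: unary_def)
  next
    case (Seq es)
    have "concat (map encode ds) @ 3 # v = concat (map encode es) @ 3 # v' \<Longrightarrow> ds = es \<and> v = v'"
      using Seq.IH
    proof (induction ds arbitrary: es)
      case Nil
      then show ?case using hd by (cases es) (auto, metis list.inject append_Cons)
    next
      case (Cons d ds)
      show ?case
      proof (cases es)
        case Nil
        with Cons.prems hd[of d] show ?thesis by auto
      next
        case (Cons e es')
        with Cons.prems(1) have eq: "encode d @ concat (map encode ds) @ 3 # v
            = encode e @ concat (map encode es') @ 3 # v'" by simp
        have de: "d = e \<and> concat (map encode ds) @ 3 # v = concat (map encode es') @ 3 # v'"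
          using Cons.prems(2)[OF _ eq] by simp
        moreover have "ds = es' \<and> v = v'"
          using Cons.IH de Cons.prems(2) by (meson list.set_intros(2))
        ultimately show ?thesis using Cons by simp
      qed
    qed
    with Seq Seq.prems show ?thesis by simp
  qed
qed

lemma inj_encode: "inj encode"
  using encode_append_eqD[where v = "[]" and v' = "[]"] by (auto intro: injI)


section \<open>The factorization problem for transformation monoids\<close>

text \<open>Mappings on \<open>{1..n}\<close> are extensional functions; the product is evaluated from left to right.\<close>

definition trans_monoid :: "nat \<Rightarrow> (nat \<Rightarrow> nat) monoid" where
  "trans_monoid n =
     \<lparr>carrier = {1..n} \<rightarrow>\<^sub>E {1..n},
      mult = (\<lambda>f g. compose {1..n} g f),
      one = (\<lambda>x \<in> {1..n}. x)\<rparr>"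

definition set_power :: "('a, 'b) monoid_scheme \<Rightarrow> 'a set \<Rightarrow> nat \<Rightarrow> 'a set" where
  "set_power G A k =
     {foldr (\<lambda>x y. x \<otimes>\<^bsub>G\<^esub> y) xs \<one>\<^bsub>G\<^esub> | xs. length xs = k \<and> set xs \<subseteq> A}"

definition map_data :: "nat \<Rightarrow> (nat \<Rightarrow> nat) \<Rightarrow> data" where
  "map_data n f = Seq (map (\<lambda>i. Num (f i)) [1..<n+1])"

definition pF_T :: param_problem where
  "pF_T =
     \<lparr>alphabet = code_alphabet,
      instances =
        {(encode (Seq [Num n, map_data n a, Seq (map (map_data n) as)]), k) | n a as k.
           n \<ge> 1 \<and> a \<in> carrier (trans_monoid n) \<and> set as \<subseteq> carrier (trans_monoid n) \<and>
           a \<in> set_power (trans_monoid n) (set as) k}\<rparr>"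


section \<open>First-order logic\<close>

datatype fo_term = Var nat | Fun nat "fo_term list"

datatype form =
    Eq fo_term fo_term
  | Rel nat "fo_term list"
  | Neg form
  | Conj form form
  | Disj form form
  | Exi nat form
  | All nat form

text \<open>Function symbols and relation symbols are named by numbers, in separate name spaces.\<close>

record fo_sig =
  fun_syms :: "nat set"
  rel_syms :: "nat set"
  fun_ar :: "nat \<Rightarrow> nat"
  rel_ar :: "nat \<Rightarrow> nat"

record 'u fo_struct =
  universe :: "'u set"
  fun_int :: "nat \<Rightarrow> 'u list \<Rightarrow> 'u"
  rel_int :: "nat \<Rightarrow> 'u list set"

definition signature :: "fo_sig \<Rightarrow> bool" where
  "signature S \<longleftrightarrow>
     finite (fun_syms S) \<and> finite (rel_syms S) \<and> (\<forall>r \<in> rel_syms S. rel_ar S r \<ge> 1)"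

definition structure_over :: "fo_sig \<Rightarrow> 'u fo_struct \<Rightarrow> bool" where
  "structure_over S A \<longleftrightarrow>
     universe A \<noteq> {} \<and>
     (\<forall>f \<in> fun_syms S. \<forall>xs. length xs = fun_ar S f \<and> set xs \<subseteq> universe A \<longrightarrow>
        fun_int A f xs \<in> universe A) \<and>
     (\<forall>r \<in> rel_syms S. \<forall>xs \<in> rel_int A r. length xs = rel_ar S r \<and> set xs \<subseteq> universe A)"

fun term_over :: "fo_sig \<Rightarrow> fo_term \<Rightarrow> bool" where
  "term_over S (Var x) \<longleftrightarrow> True"
| "term_over S (Fun f ts) \<longleftrightarrow>
     f \<in> fun_syms S \<and> length ts = fun_ar S f \<and> (\<forall>t \<in> set ts. term_over S t)"

fun form_over :: "fo_sig \<Rightarrow> form \<Rightarrow> bool" where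
  "form_over S (Eq s t) \<longleftrightarrow> term_over S s \<and> term_over S t"
| "form_over S (Rel r ts) \<longleftrightarrow>
     r \<in> rel_syms S \<and> length ts = rel_ar S r \<and> (\<forall>t \<in> set ts. term_over S t)"
| "form_over S (Neg F) \<longleftrightarrow> form_over S F"
| "form_over S (Conj F G) \<longleftrightarrow> form_over S F \<and> form_over S G"
| "form_over S (Disj F G) \<longleftrightarrow> form_over S F \<and> form_over S G"
| "form_over S (Exi x F) \<longleftrightarrow> form_over S F"
| "form_over S (All x F) \<longleftrightarrow> form_over S F"

fun eval_term :: "'u fo_struct \<Rightarrow> (nat \<Rightarrow> 'u) \<Rightarrow> fo_term \<Rightarrow> 'u" where
  "eval_term A e (Var x) = e x"
| "eval_term A e (Fun f ts) = fun_int A f (map (eval_term A e) ts)"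

fun sat :: "'u fo_struct \<Rightarrow> (nat \<Rightarrow> 'u) \<Rightarrow> form \<Rightarrow> bool" where
  "sat A e (Eq s t) \<longleftrightarrow> eval_term A e s = eval_term A e t"
| "sat A e (Rel r ts) \<longleftrightarrow> map (eval_term A e) ts \<in> rel_int A r"
| "sat A e (Neg F) \<longleftrightarrow> \<not> sat A e F"
| "sat A e (Conj F G) \<longleftrightarrow> sat A e F \<and> sat A e G"
| "sat A e (Disj F G) \<longleftrightarrow> sat A e F \<or> sat A e G"
| "sat A e (Exi x F) \<longleftrightarrow> (\<exists>d \<in> universe A. sat A (e(x := d)) F)"
| "sat A e (All x F) \<longleftrightarrow> (\<forall>d \<in> universe A. sat A (e(x := d)) F)"

definition models :: "'u fo_struct \<Rightarrow> form \<Rightarrow> bool" where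
  "models A F \<longleftrightarrow> (\<forall>e. range e \<subseteq> universe A \<longrightarrow> sat A e F)"

fun term_vars :: "fo_term \<Rightarrow> nat set" where
  "term_vars (Var x) = {x}"
| "term_vars (Fun f ts) = (\<Union>t \<in> set ts. term_vars t)"

fun free_vars :: "form \<Rightarrow> nat set" where
  "free_vars (Eq s t) = term_vars s \<union> term_vars t"
| "free_vars (Rel r ts) = (\<Union>t \<in> set ts. term_vars t)"
| "free_vars (Neg F) = free_vars F"
| "free_vars (Conj F G) = free_vars F \<union> free_vars G"
| "free_vars (Disj F G) = free_vars F \<union> free_vars G"
| "free_vars (Exi x F) = free_vars F - {x}"
| "free_vars (All x F) = free_vars F - {x}"

definition sentence :: "form \<Rightarrow> bool" where
  "sentence F \<longleftrightarrow> free_vars F = {}"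

fun term_size :: "fo_term \<Rightarrow> nat" where
  "term_size (Var x) = 1"
| "term_size (Fun f ts) = 1 + sum_list (map term_size ts)"

fun form_length :: "form \<Rightarrow> nat" where
  "form_length (Eq s t) = 1 + term_size s + term_size t"
| "form_length (Rel r ts) = 1 + sum_list (map term_size ts)"
| "form_length (Neg F) = form_length F + 1"
| "form_length (Conj F G) = form_length F + form_length G + 1"
| "form_length (Disj F G) = form_length F + form_length G + 1"
| "form_length (Exi x F) = form_length F + 1"
| "form_length (All x F) = form_length F + 1"

fun quantifier_free :: "form \<Rightarrow> bool" where
  "quantifier_free (Eq s t) \<longleftrightarrow> True"
| "quantifier_free (Rel r ts) \<longleftrightarrow> True"
| "quantifier_free (Neg F) \<longleftrightarrow> quantifier_free F"
| "quantifier_free (Conj F G) \<longleftrightarrow> quantifier_free F \<and> quantifier_free G"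
| "quantifier_free (Disj F G) \<longleftrightarrow> quantifier_free F \<and> quantifier_free G"
| "quantifier_free (Exi x F) \<longleftrightarrow> False"
| "quantifier_free (All x F) \<longleftrightarrow> False"

text \<open>Alternating quantifier blocks; the flag says whether the first block is existential.\<close>

fun quantify :: "bool \<Rightarrow> nat list list \<Rightarrow> form \<Rightarrow> form" where
  "quantify ex [] F = F"
| "quantify ex (xs # xss) F = foldr (if ex then Exi else All) xs (quantify (\<not> ex) xss F)"

text \<open>Lists are indexed from \<open>0\<close>, so block \<open>0\<close> is the one of unbounded length.\<close>

definition Sigma_func :: "nat \<Rightarrow> nat \<Rightarrow> form set" where
  "Sigma_func l u =
     {F. sentence F \<and>
         (\<exists>xss \<psi>. length xss = l \<and> (\<forall>i. 1 \<le> i \<and> i < l \<longrightarrow> length (xss ! i) \<le> u) \<and>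
            quantifier_free \<psi> \<and> F = quantify True xss \<psi>)}"


section \<open>Parameterized model checking\<close>

fun term_data :: "fo_term \<Rightarrow> data" where
  "term_data (Var x) = Seq [Num 0, Num x]"
| "term_data (Fun f ts) = Seq (Num 1 # Num f # map term_data ts)"

fun form_data :: "form \<Rightarrow> data" where
  "form_data (Eq s t) = Seq [Num 0, term_data s, term_data t]"
| "form_data (Rel r ts) = Seq (Num 1 # Num r # map term_data ts)"
| "form_data (Neg F) = Seq [Num 2, form_data F]"
| "form_data (Conj F G) = Seq [Num 3, form_data F, form_data G]"
| "form_data (Disj F G) = Seq [Num 4, form_data F, form_data G]"
| "form_data (Exi x F) = Seq [Num 5, Num x, form_data F]"
| "form_data (All x F) = Seq [Num 6, Num x, form_data F]"

text \<open>
  A finite structure is presented with universe \<open>{..<n}\<close>. Functions are given by their value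
  tables and relations by the list of their tuples, both in the order of \<^const>\<open>List.n_lists\<close>.
\<close>

definition struct_data :: "fo_sig \<Rightarrow> nat \<Rightarrow> nat fo_struct \<Rightarrow> data" where
  "struct_data S n A =
     Seq [Num n,
          Seq (map (\<lambda>f. Seq [Num f, Num (fun_ar S f),
                 Seq (map (\<lambda>xs. Num (fun_int A f xs)) (List.n_lists (fun_ar S f) [0..<n]))])
               (sorted_list_of_set (fun_syms S))),
          Seq (map (\<lambda>r. Seq [Num r, Num (rel_ar S r),
                 Seq (map (\<lambda>xs. Seq (map Num xs))
                   (filter (\<lambda>xs. xs \<in> rel_int A r) (List.n_lists (rel_ar S r) [0..<n])))])
               (sorted_list_of_set (rel_syms S)))]"

definition pMC :: "form set \<Rightarrow> param_problem" where
  "pMC D =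
     \<lparr>alphabet = code_alphabet,
      instances =
        {(encode (Seq [form_data F, struct_data S n A]), form_length F) | F S n A.
           F \<in> D \<and> sentence F \<and> signature S \<and> form_over S F \<and>
           structure_over S A \<and> universe A = {..<n} \<and> models A F}\<rparr>"

definition W_func :: "nat \<Rightarrow> param_problem set" where
  "W_func l = fpt_class (pMC (Sigma_func l 1))"

end

theory Submission
  imports Defs
begin

text \<open>
  An input word \<open>u\<close> with maps \<open>a, a\<^sub>0, \<dots>, a\<^sub>m\<^sub>-\<^sub>1\<close> is sent to the sentence
  \<open>\<exists>x\<^sub>1\<dots>x\<^sub>k \<forall>x\<^sub>0 (a(x\<^sub>0) = c \<or> a(x\<^sub>0) = f(\<dots>f(x\<^sub>0,x\<^sub>1)\<dots>,x\<^sub>k))\<close> of length \<open>3k + 10\<close> and the structure on the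
  numbers below the length of \<open>u\<close>, which has room for both points and indices, with \<open>c = 0\<close> and
  \<open>f(x,i) = a\<^sub>i(x)\<close>. Outside of their domains the maps and \<open>f\<close> take the value \<open>0\<close>. As \<open>f(0,i) = 0\<close> and \<open>a(1) \<noteq> 0\<close>,
  the witnesses \<open>x\<^sub>j\<close> are indices of maps, so that they describe a factorization. Malformed inputs
  are sent to the empty word, which encodes nothing.

  The tables have quadratically many entries in the length of \<open>u\<close>, and the variables of the formula, written in
  unary, take quadratic space in \<open>k\<close>; hence the factor \<open>k\<^sup>2 + k + 1\<close> in the running time.
\<close>

section \<open>Structured programs for multitape machines\<close>

text \<open>The order of the arguments of \<open>f\<close> is chosen for the machine:
  \<open>List.n_lists\<close> varies the first argument fastest, so the value table of
  \<open>f\<close> is a list of rows, one for each index, and such a row is the list of values of a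
  map as it stands in \<open>u\<close>, with one zero in front and zeros behind. Hence the tables
  are written by copying while \<open>u\<close> is parsed. With the length of \<open>u\<close> as
  the size of the universe, every table dimension is the end of a copy of \<open>u\<close>, and no
  maximum of the degree and the number of maps has to be computed. The weight of the proof lies in
  the machine, which must exist explicitly and behave correctly on every word. Output starts before
  \<open>u\<close> is known to be well-formed, so programs may abort anywhere, and a rule for a
  parsing program has two duties: to continue from every successful parse, and to refute
  well-formedness if there is none. In the converse direction an instance of model checking is known
  only through its word. This determines the sentence, but the structure only on its tables, so the
  sentence is evaluated in every structure with these tables.\<close>

type_synonym action = "(nat \<times> nat option option \<times> move) list"

datatype prog =
    Do action
  | Abort
  | Then prog prog (infixr ";;" 60)
  | Cond nat "nat option \<Rightarrow> bool" prog prog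
  | While nat "nat option \<Rightarrow> bool" prog

text \<open>A tape that is missing from the list stays as it is. In a listed entry the outer
  \<open>None\<close> keeps the scanned cell, while \<open>Some None\<close> erases it.\<close>

definition acts :: "action \<Rightarrow> nat option list \<Rightarrow> (nat option \<times> move) list" where
  "acts a cs = map (\<lambda>i. case map_of a i of None \<Rightarrow> (cs ! i, Stay)
      | Some (w, m) \<Rightarrow> (case w of None \<Rightarrow> cs ! i | Some c \<Rightarrow> c, m)) [0..<length cs]"

definition do_acts :: "action \<Rightarrow> tape list \<Rightarrow> tape list" where
  "do_acts a \<sigma> = map2 act_tape (acts a (map read_tape \<sigma>)) \<sigma>"

text \<open>\<open>exec p \<sigma> t b \<sigma>'\<close>: the program \<open>p\<close>, started on the tapes \<open>\<sigma>\<close>, stops after \<open>t\<close> steps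
  with the tapes \<open>\<sigma>'\<close>; the flag \<open>b\<close> says whether it was aborted.\<close>

inductive exec :: "prog \<Rightarrow> tape list \<Rightarrow> nat \<Rightarrow> bool \<Rightarrow> tape list \<Rightarrow> bool" where
  exec_Do: "exec (Do a) \<sigma> 1 False (do_acts a \<sigma>)"
| exec_Abort: "exec Abort \<sigma> 1 True \<sigma>"
| exec_Then_abort: "exec p \<sigma> t True \<sigma>' \<Longrightarrow> exec (p ;; q) \<sigma> t True \<sigma>'"
| exec_Then: "exec p \<sigma> t False \<sigma>1 \<Longrightarrow> exec q \<sigma>1 t' b \<sigma>' \<Longrightarrow> exec (p ;; q) \<sigma> (t + t') b \<sigma>'"
| exec_Cond: "exec (if P (read_tape (\<sigma> ! i)) then p else q) \<sigma> t b \<sigma>' \<Longrightarrow>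
    exec (Cond i P p q) \<sigma> (Suc t) b \<sigma>'"
| exec_While_end: "\<not> P (read_tape (\<sigma> ! i)) \<Longrightarrow> exec (While i P p) \<sigma> 1 False \<sigma>"
| exec_While_abort: "P (read_tape (\<sigma> ! i)) \<Longrightarrow> exec p \<sigma> t True \<sigma>' \<Longrightarrow>
    exec (While i P p) \<sigma> (Suc t) True \<sigma>'"
| exec_While: "P (read_tape (\<sigma> ! i)) \<Longrightarrow> exec p \<sigma> t False \<sigma>1 \<Longrightarrow>
    exec (While i P p) \<sigma>1 t' b \<sigma>' \<Longrightarrow> exec (While i P p) \<sigma> (Suc t + t') b \<sigma>'"

lemma length_do_acts [simp]: "length (do_acts a \<sigma>) = length \<sigma>"
  by (simp add: do_acts_def acts_def)

lemma do_acts_nth: "i < length \<sigma> \<Longrightarrow> do_acts a \<sigma> ! i = (case map_of a i of None \<Rightarrow> \<sigma> ! i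
      | Some (w, m) \<Rightarrow>
          (fst (\<sigma> ! i) + shift m,
           case w of None \<Rightarrow> snd (\<sigma> ! i) | Some c \<Rightarrow> (snd (\<sigma> ! i))(fst (\<sigma> ! i) := c)))"
  by (auto simp: do_acts_def acts_def act_tape_def read_tape_def split: option.splits)

lemma do_acts_Nil: "do_acts [] \<sigma> = \<sigma>"
  by (rule nth_equalityI) (auto simp: do_acts_nth)

lemma abs_shift: "\<bar>shift m\<bar> \<le> 1"
  by (cases m) auto

lemma exec_length: "exec p \<sigma> t b \<sigma>' \<Longrightarrow> length \<sigma>' = length \<sigma>"
  by (induction rule: exec.induct) simp_all

text \<open>A step moves a head by at most one cell. Applied to tape 0, this will bound the length
  of the output, and with it the cost of the final rewinding, by the running time.\<close>

lemma exec_head: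
  "exec p \<sigma> t b \<sigma>' \<Longrightarrow> i < length \<sigma> \<Longrightarrow> \<bar>fst (\<sigma>' ! i) - fst (\<sigma> ! i)\<bar> \<le> int t"
proof (induction rule: exec.induct)
  case (exec_Do a \<sigma>)
  then show ?case by (simp add: do_acts_nth abs_shift split: option.splits)
next
  case (exec_Then p \<sigma> t \<sigma>1 q t' b \<sigma>')
  then show ?case using exec_length[OF exec_Then.hyps(1)] by simp
next
  case (exec_While P \<sigma> i' p t \<sigma>1 t' b \<sigma>')
  then show ?case using exec_length[OF exec_While.hyps(2)] by simp
qed simp_all

subsection \<open>Compilation\<close>

fun len :: "prog \<Rightarrow> nat" where
  "len (Do a) = 1"
| "len Abort = 1"
| "len (p ;; q) = len p + len q"
| "len (Cond i P p q) = 1 + len p + len q"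
| "len (While i P p) = 1 + len p"

text \<open>\<open>code p s e\<close> occupies the states from \<open>s\<close> on, is entered at \<open>s\<close> and left to \<open>e\<close>; aborting
  leads to the halting state \<open>0\<close>.\<close>

fun code :: "prog \<Rightarrow> nat \<Rightarrow> nat \<Rightarrow> nat \<Rightarrow> nat option list \<Rightarrow> nat \<times> (nat option \<times> move) list" where
  "code (Do a) s e q cs = (e, acts a cs)"
| "code Abort s e q cs = (0, acts [] cs)"
| "code (p ;; r) s e q cs =
     (if q < s + len p then code p s (s + len p) q cs else code r (s + len p) e q cs)"
| "code (Cond i P p r) s e q cs =
     (if q = s then (if P (cs ! i) then s + 1 else s + 1 + len p, acts [] cs)
      else if q < s + 1 + len p then code p (s + 1) e q cs else code r (s + 1 + len p) e q cs)"
| "code (While i P p) s e q cs =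
     (if q = s then (if P (cs ! i) then s + 1 else e, acts [] cs) else code p (s + 1) s q cs)"

fun wf_prog :: "nat \<Rightarrow> nat set \<Rightarrow> prog \<Rightarrow> bool" where
  "wf_prog K S (Do a) \<longleftrightarrow> (\<forall>(i, w, m) \<in> set a. case w of Some (Some c) \<Rightarrow> c \<in> S | _ \<Rightarrow> True)"
| "wf_prog K S Abort \<longleftrightarrow> True"
| "wf_prog K S (p ;; q) \<longleftrightarrow> wf_prog K S p \<and> wf_prog K S q"
| "wf_prog K S (Cond i P p q) \<longleftrightarrow> i < K \<and> wf_prog K S p \<and> wf_prog K S q"
| "wf_prog K S (While i P p) \<longleftrightarrow> i < K \<and> wf_prog K S p"

text \<open>State \<open>0\<close> is the regular exit as well as the target of an abort, so the
  flag of \<open>exec\<close> is lost on halting and only the tapes tell the two outcomes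
  apart.\<close>

definition prog_tm :: "nat \<Rightarrow> nat set \<Rightarrow> prog \<Rightarrow> tm" where
  "prog_tm K S p = \<lparr>tm_tapes = K, tm_states = {..len p}, tm_symbols = S, tm_start = 1, tm_halt = 0,
     tm_delta = (\<lambda>q. if q = 0 then (\<lambda>cs. (0, acts [] cs)) else code p 1 0 q)\<rparr>"

lemma len_pos: "0 < len p"
  by (induction p) auto

text \<open>In a sequence the exit of the first half is the entry of the second, which by
  \<open>len_pos\<close> is a nonempty block and so still a state of the whole.\<close>

lemma code_state:
  "q < s + len p \<Longrightarrow> s \<le> q \<Longrightarrow> fst (code p s e q cs) \<in> insert 0 (insert e {s..<s + len p})"
proof (induction p arbitrary: s e)
  case (Then p1 p2)
  show ?case
  proof (cases "q < s + len p1")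
    case True
    then show ?thesis using Then.IH(1)[of s "s + len p1"] Then.prems len_pos[of p2] by force
  next
    case False
    then show ?thesis using Then.IH(2)[of "s + len p1" e] Then.prems by force
  qed
next
  case (Cond i P p1 p2)
  consider "q = s" | "q \<noteq> s" "q < s + 1 + len p1" | "q \<noteq> s" "\<not> q < s + 1 + len p1" by blast
  then show ?case
  proof cases
    case 1 then show ?thesis using len_pos[of p1] len_pos[of p2] by auto
  next
    case 2
    then show ?thesis using Cond.IH(1)[of "s + 1" e] Cond.prems by force
  next
    case 3
    then show ?thesis using Cond.IH(2)[of "s + 1 + len p1" e] Cond.prems by force
  qed
next
  case (While i P p)
  show ?case
  proof (cases "q = s")
    case True then show ?thesis using len_pos[of p] by auto
  next
    case False
    then show ?thesis using While.IH[of "s + 1" s] While.prems by force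
  qed
qed auto

lemma acts_cells:
  assumes "wf_prog K S (Do a)" "set cs \<subseteq> insert None (Some ` S)"
  shows "fst ` set (acts a cs) \<subseteq> insert None (Some ` S)"
proof -
  have "(case map_of a i of None \<Rightarrow> cs ! i
      | Some (w, m) \<Rightarrow> (case w of None \<Rightarrow> cs ! i | Some c \<Rightarrow> c)) \<in> insert None (Some ` S)"
    if "i < length cs" for i
  proof (cases "map_of a i")
    case None then show ?thesis using that assms(2) nth_mem by fastforce
  next
    case (Some wm)
    then obtain w m where wm: "wm = (w, m)" "(i, w, m) \<in> set a"
      by (metis map_of_SomeD prod.exhaust)
    then have "case w of Some (Some c) \<Rightarrow> c \<in> S | _ \<Rightarrow> True" using assms(1) by fastforce
    moreover have "cs ! i \<in> insert None (Some ` S)" using that assms(2) nth_mem by blast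
    ultimately show ?thesis using Some wm by (auto split: option.splits)
  qed
  then show ?thesis
    unfolding acts_def by (force split: option.splits)
qed

lemma code_cells:
  assumes "wf_prog K S p" "set cs \<subseteq> insert None (Some ` S)"
  shows "length (snd (code p s e q cs)) = length cs \<and>
    fst ` set (snd (code p s e q cs)) \<subseteq> insert None (Some ` S)"
proof -
  have nil: "fst ` set (acts [] cs) \<subseteq> insert None (Some ` S)"
    using acts_cells[of K S "[]" cs] assms(2) by simp
  have l: "length (acts a cs) = length cs" for a by (simp add: acts_def)
  show ?thesis using assms(1)
  proof (induction p arbitrary: s e)
    case (Do a)
    then show ?case using acts_cells[of K S a cs] assms(2) l by auto
  qed (use nil l in auto)
qed

lemma turing_machine_prog_tm:
  assumes "finite S" "wf_prog K S p"
  shows "turing_machine (prog_tm K S p)"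
proof -
  have "fst (code p 1 0 q cs) \<le> len p" if "q \<le> len p" "q \<noteq> 0" for q cs
    using code_state[of q 1 p 0 cs] that by auto
  then show ?thesis
    using assms(1) code_cells[OF assms(2)] code_cells[of K S Abort, simplified] len_pos[of p]
    by (simp add: turing_machine_def prog_tm_def tm_cells_def Suc_le_eq)
qed

lemma tm_step_code:
  assumes "\<And>q. s \<le> q \<Longrightarrow> q < s + len p \<Longrightarrow> tm_delta M q = code p s e q" "tm_halt M = 0" "0 < s"
  shows "tm_step M (s, \<sigma>) = (fst (code p s e s (map read_tape \<sigma>)),
    map2 act_tape (snd (code p s e s (map read_tape \<sigma>))) \<sigma>)"
  using assms(2,3) assms(1)[of s] len_pos[of p] by (simp add: tm_step_def split: prod.splits)

lemma map2_acts: "map2 act_tape (acts a (map read_tape \<sigma>)) \<sigma> = do_acts a \<sigma>"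
  by (simp add: do_acts_def)

text \<open>The machine is compared with \<open>code\<close> on the states of the block only, so the
  hypothesis passes on to subprograms. The body of a loop has the loop head \<open>s\<close> as its
  exit, where the second induction hypothesis resumes.\<close>

lemma exec_code:
  assumes "exec p \<sigma> t b \<sigma>'" "wf_prog (length \<sigma>) S p" "tm_halt M = 0" "0 < s"
    "\<And>q. s \<le> q \<Longrightarrow> q < s + len p \<Longrightarrow> tm_delta M q = code p s e q"
  shows "(tm_step M ^^ t) (s, \<sigma>) = (if b then 0 else e, \<sigma>')"
  using assms
proof (induction arbitrary: s e rule: exec.induct)
  case (exec_Do a \<sigma>)
  show ?case using tm_step_code[OF exec_Do.prems(4,2,3)] by (simp add: map2_acts)
next
  case (exec_Abort \<sigma>)
  show ?case using tm_step_code[OF exec_Abort.prems(4,2,3)] by (simp add: map2_acts do_acts_Nil)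
next
  case (exec_Then_abort p \<sigma> t \<sigma>' q)
  then show ?case using exec_Then_abort.IH[of s "s + len p"] by simp
next
  case (exec_Then p \<sigma> t \<sigma>1 q t' b \<sigma>')
  have l: "length \<sigma>1 = length \<sigma>" using exec_length[OF exec_Then.hyps(1)] by simp
  have "(tm_step M ^^ (t' + t)) (s, \<sigma>) = (tm_step M ^^ t') ((tm_step M ^^ t) (s, \<sigma>))"
    by (simp add: funpow_add)
  also have "(tm_step M ^^ t) (s, \<sigma>) = (s + len p, \<sigma>1)"
    using exec_Then.IH(1)[of s "s + len p"] exec_Then.prems by simp
  also have "(tm_step M ^^ t') (s + len p, \<sigma>1) = (if b then 0 else e, \<sigma>')"
    using exec_Then.IH(2)[of "s + len p" e] exec_Then.prems l by simp
  finally show ?case by (simp add: add.commute)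
next
  case (exec_Cond P \<sigma> i p q t b \<sigma>')
  have "(tm_step M ^^ Suc t) (s, \<sigma>) = (tm_step M ^^ t) (tm_step M (s, \<sigma>))"
    by (simp add: funpow_swap1)
  also have "tm_step M (s, \<sigma>) = (if P (read_tape (\<sigma> ! i)) then s + 1 else s + 1 + len p, \<sigma>)"
    using tm_step_code[OF exec_Cond.prems(4,2,3)] exec_Cond.prems(1)
    by (simp add: map2_acts do_acts_Nil)
  also have "(tm_step M ^^ t) \<dots> = (if b then 0 else e, \<sigma>')"
    using exec_Cond.IH[of "if P (read_tape (\<sigma> ! i)) then s + 1 else s + 1 + len p" e] exec_Cond.prems
    by (auto split: if_splits)
  finally show ?case .
next
  case (exec_While_end P \<sigma> i p)
  show ?case using tm_step_code[OF exec_While_end.prems(4,2,3)] exec_While_end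
    by (simp add: map2_acts do_acts_Nil)
next
  case (exec_While_abort P \<sigma> i p t \<sigma>')
  have "(tm_step M ^^ Suc t) (s, \<sigma>) = (tm_step M ^^ t) (tm_step M (s, \<sigma>))"
    by (simp add: funpow_swap1)
  also have "tm_step M (s, \<sigma>) = (s + 1, \<sigma>)"
    using tm_step_code[OF exec_While_abort.prems(4,2,3)] exec_While_abort.hyps exec_While_abort.prems(1)
    by (simp add: map2_acts do_acts_Nil)
  also have "(tm_step M ^^ t) \<dots> = (0, \<sigma>')"
    using exec_While_abort.IH[of "s + 1" s] exec_While_abort.prems by simp
  finally show ?case by simp
next
  case (exec_While P \<sigma> i p t \<sigma>1 t' b \<sigma>')
  have l: "length \<sigma>1 = length \<sigma>" using exec_length[OF exec_While.hyps(2)] by simp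
  have "(tm_step M ^^ (t' + (t + 1))) (s, \<sigma>) = (tm_step M ^^ t') ((tm_step M ^^ t) ((tm_step M ^^ 1) (s, \<sigma>)))"
    by (simp only: funpow_add o_apply)
  also have "(tm_step M ^^ 1) (s, \<sigma>) = (s + 1, \<sigma>)"
    using tm_step_code[OF exec_While.prems(4,2,3)] exec_While.hyps exec_While.prems(1)
    by (simp add: map2_acts do_acts_Nil)
  also have "(tm_step M ^^ t) \<dots> = (s, \<sigma>1)"
    using exec_While.IH(1)[of "s + 1" s] exec_While.prems by simp
  also have "(tm_step M ^^ t') \<dots> = (if b then 0 else e, \<sigma>')"
    using exec_While.IH(2)[of s e] exec_While.prems l by simp
  finally show ?case by (simp add: add.commute)
qed

lemma tm_step_halted: "fst c = tm_halt M \<Longrightarrow> (tm_step M ^^ t) c = c"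
  by (induction t) (auto simp: tm_step_def)

lemma tm_steps_halted:
  assumes "(tm_step M ^^ t) c = c'" "fst c' = tm_halt M" "t \<le> T"
  shows "(tm_step M ^^ T) c = c'"
proof -
  have "(tm_step M ^^ ((T - t) + t)) c = (tm_step M ^^ (T - t)) ((tm_step M ^^ t) c)"
    by (simp only: funpow_add o_apply)
  then show ?thesis using assms tm_step_halted by simp
qed

lemma tm_computes_exec:
  assumes "exec p (map (\<lambda>i. input_tape (if i < length ins then ins ! i else [])) [0..<K]) t b \<sigma>"
    and "t \<le> T" "wf_prog K S p" "length ins \<le> K" "length outs \<le> K" "\<forall>w \<in> set ins. set w \<subseteq> S"
    and "\<And>i. i < length outs \<Longrightarrow> output_tape (\<sigma> ! i) (outs ! i)"
  shows "tm_computes (prog_tm K S p) ins outs T"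
proof -
  let ?M = "prog_tm K S p" and ?\<sigma> = "map (\<lambda>i. input_tape (if i < length ins then ins ! i else [])) [0..<K]"
  have "(tm_step ?M ^^ t) (1, ?\<sigma>) = (0, \<sigma>)"
    using exec_code[OF assms(1), of S ?M 1 0] assms(3) by (simp add: prog_tm_def)
  then have "(tm_step ?M ^^ T) (1, ?\<sigma>) = (0, \<sigma>)"
    by (rule tm_steps_halted) (simp_all add: prog_tm_def assms(2))
  then show ?thesis
    using assms(4-) by (simp add: tm_computes_def tm_init_def prog_tm_def)
qed

subsection \<open>Weakest preconditions with running time\<close>

text \<open>The number passed to the postconditions is only an upper bound on the elapsed time, so \<open>wp\<close> is
  antitone in its time argument whatever the postconditions are.\<close>

definition wp :: "prog \<Rightarrow> (nat \<Rightarrow> tape list \<Rightarrow> bool) \<Rightarrow> (nat \<Rightarrow> tape list \<Rightarrow> bool) \<Rightarrow> nat \<Rightarrow> tape list \<Rightarrow> bool"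
  where "wp p Q A t \<sigma> \<longleftrightarrow>
    (\<exists>s b \<sigma>'. exec p \<sigma> s b \<sigma>' \<and> (\<exists>t' \<ge> t + s. if b then A t' \<sigma>' else Q t' \<sigma>'))"

lemma wpI: "exec p \<sigma> s b \<sigma>' \<Longrightarrow> t + s \<le> t' \<Longrightarrow> (if b then A t' \<sigma>' else Q t' \<sigma>') \<Longrightarrow> wp p Q A t \<sigma>"
  unfolding wp_def by blast

lemma wpE:
  assumes "wp p Q A t \<sigma>"
  obtains s b \<sigma>' t' where "exec p \<sigma> s b \<sigma>'" "t + s \<le> t'" "if b then A t' \<sigma>' else Q t' \<sigma>'"
  using assms unfolding wp_def by blast

lemma wp_time: "wp p Q A t' \<sigma> \<Longrightarrow> t \<le> t' \<Longrightarrow> wp p Q A t \<sigma>"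
  by (erule wpE, rule wpI) auto

lemma wp_Do: "Q (t + 1) (do_acts a \<sigma>) \<Longrightarrow> wp (Do a) Q A t \<sigma>"
  by (rule wpI[OF exec_Do order.refl]) simp

lemma wp_Abort: "A (t + 1) \<sigma> \<Longrightarrow> wp Abort Q A t \<sigma>"
  by (rule wpI[OF exec_Abort order.refl]) simp

lemma wp_Then:
  assumes "wp p (wp q Q A) A t \<sigma>"
  shows "wp (p ;; q) Q A t \<sigma>"
proof -
  obtain s b \<sigma>1 t1 where 1: "exec p \<sigma> s b \<sigma>1" "t + s \<le> t1" "if b then A t1 \<sigma>1 else wp q Q A t1 \<sigma>1"
    using assms by (rule wpE)
  show ?thesis
  proof (cases b)
    case True
    then show ?thesis using 1 wpI[OF exec_Then_abort] by simp
  next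
    case False
    then obtain s' b' \<sigma>' t' where 2: "exec q \<sigma>1 s' b' \<sigma>'" "t1 + s' \<le> t'"
      "if b' then A t' \<sigma>' else Q t' \<sigma>'"
      using 1 by (auto elim: wpE)
    have "exec (p ;; q) \<sigma> (s + s') b' \<sigma>'" using 1(1) 2(1) False exec_Then by simp
    then show ?thesis using 1(2) 2(2,3) wpI by (metis add.assoc add_le_mono1 order.trans)
  qed
qed

lemma wp_Cond:
  assumes "P (read_tape (\<sigma> ! i)) \<Longrightarrow> wp p Q A (t + 1) \<sigma>"
    and "\<not> P (read_tape (\<sigma> ! i)) \<Longrightarrow> wp q Q A (t + 1) \<sigma>"
  shows "wp (Cond i P p q) Q A t \<sigma>"
proof -
  have "wp (if P (read_tape (\<sigma> ! i)) then p else q) Q A (t + 1) \<sigma>" using assms by simp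
  then show ?thesis by (rule wpE) (rule wpI[OF exec_Cond], auto)
qed

lemma wp_While_end: "\<not> P (read_tape (\<sigma> ! i)) \<Longrightarrow> Q (t + 1) \<sigma> \<Longrightarrow> wp (While i P p) Q A t \<sigma>"
  by (rule wpI[OF exec_While_end order.refl]) simp_all

lemma wp_While:
  assumes "P (read_tape (\<sigma> ! i))" "wp p (wp (While i P p) Q A) A (t + 1) \<sigma>"
  shows "wp (While i P p) Q A t \<sigma>"
proof -
  obtain s b \<sigma>1 t1 where 1: "exec p \<sigma> s b \<sigma>1" "t + 1 + s \<le> t1"
    "if b then A t1 \<sigma>1 else wp (While i P p) Q A t1 \<sigma>1"
    using assms(2) by (rule wpE)
  show ?thesis
  proof (cases b)
    case True
    then show ?thesis using 1 wpI[OF exec_While_abort[of P, OF assms(1)]] by simp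
  next
    case False
    then obtain s' b' \<sigma>' t' where 2: "exec (While i P p) \<sigma>1 s' b' \<sigma>'" "t1 + s' \<le> t'"
      "if b' then A t' \<sigma>' else Q t' \<sigma>'"
      using 1 by (auto elim: wpE)
    have "exec (While i P p) \<sigma> (Suc s + s') b' \<sigma>'" using 1(1) 2(1) False exec_While[of P, OF assms(1)] by simp
    moreover have "t + (Suc s + s') \<le> t'" using 1(2) 2(2) by simp
    ultimately show ?thesis using 2(3) wpI by blast
  qed
qed

lemma wp_mono:
  assumes "wp p Q A t \<sigma>" "\<And>t \<sigma>. Q t \<sigma> \<Longrightarrow> Q' t \<sigma>" "\<And>t \<sigma>. A t \<sigma> \<Longrightarrow> A' t \<sigma>"
  shows "wp p Q' A' t \<sigma>"
  using assms(1) by (rule wpE) (rule wpI, auto simp: assms(2,3))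

text \<open>One test and one action: a round of a loop with an atomic body costs two steps.\<close>

lemma wp_While_Do:
  assumes "P (read_tape (\<sigma> ! i))" "wp (While i P (Do a)) Q A (t + 2) (do_acts a \<sigma>)"
  shows "wp (While i P (Do a)) Q A t \<sigma>"
proof (rule wp_While[of P, OF assms(1)])
  show "wp (Do a) (wp (While i P (Do a)) Q A) A (t + 1) \<sigma>"
    by (rule wp_Do) (use assms(2) in simp)
qed

subsection \<open>Tape contents\<close>

definition cells :: "int \<Rightarrow> nat list \<Rightarrow> int \<Rightarrow> nat option" where
  "cells a w j = (if a \<le> j \<and> j < a + int (length w) then Some (w ! nat (j - a)) else None)"

lemma input_tape_cells: "input_tape w = (0, cells 0 w)"
  by (auto simp: input_tape_def cells_def)

lemma cells_Nil [simp]: "cells a [] = (\<lambda>_. None)"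
  by (auto simp: cells_def)

text \<open>The writing programs below change a tape in three ways, for which this and the next two
  lemmas are made: appending on the right, prepending on the left, erasing the first symbol.\<close>

lemma cells_append:
  "(cells a w)(a + int (length w) := Some s) = cells a (w @ [s])"
  by (auto simp: cells_def nth_append fun_eq_iff nat_less_iff)

lemma cells_Cons_left: "(cells a w)(a - 1 := Some s) = cells (a - 1) (s # w)"
  by (auto simp: cells_def nth_Cons' fun_eq_iff nat_diff_distrib intro!: arg_cong[where f="(!) w"])

lemma cells_erase: "(cells a (s # w))(a := None) = cells (a + 1) w"
  by (auto simp: cells_def nth_Cons' fun_eq_iff nat_diff_distrib intro!: arg_cong[where f="(!) w"])

lemma cells_read: "cells 0 (v @ s # w) (int (length v)) = Some s"
  by (auto simp: cells_def nth_append)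

lemma cells_read_end: "cells 0 w (int (length w)) = None"
  by (auto simp: cells_def)

lemma length_unary [simp]: "length (unary n) = n"
  by (simp add: unary_def)

lemma unary_0 [simp]: "unary 0 = []"
  by (simp add: unary_def)

lemma cells_unary: "cells a (unary n) j = (if a \<le> j \<and> j < a + int n then Some 1 else None)"
  by (auto simp: cells_def unary_def nat_less_iff)

lemma unary_Suc: "unary (Suc n) = 1 # unary n" "unary (Suc n) = unary n @ [1]"
  by (simp_all add: unary_def replicate_append_same)

lemma output_tape_cells: "output_tape (a, cells a w) w"
  by (auto simp: output_tape_def cells_def)

text \<open>A structural recursion over the tapes, by which \<open>simp\<close> evaluates an action
  on an explicit list of tapes.\<close>

fun do_acts_from :: "action \<Rightarrow> nat \<Rightarrow> tape list \<Rightarrow> tape list" where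
  "do_acts_from a i [] = []"
| "do_acts_from a i (\<tau> # \<sigma>) = (case map_of a i of None \<Rightarrow> \<tau>
      | Some (w, m) \<Rightarrow> (fst \<tau> + shift m, case w of None \<Rightarrow> snd \<tau> | Some c \<Rightarrow> (snd \<tau>)(fst \<tau> := c)))
     # do_acts_from a (i + 1) \<sigma>"

lemma do_acts_from: "do_acts a \<sigma> = do_acts_from a 0 \<sigma>"
proof (rule nth_equalityI)
  have l: "length (do_acts_from a i \<sigma>) = length \<sigma>" for i by (induction \<sigma> arbitrary: i) auto
  then show "length (do_acts a \<sigma>) = length (do_acts_from a 0 \<sigma>)" by simp
  fix j assume "j < length (do_acts a \<sigma>)"
  have "do_acts_from a i \<sigma> ! j = (case map_of a (i + j) of None \<Rightarrow> \<sigma> ! j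
      | Some (w, m) \<Rightarrow> (fst (\<sigma> ! j) + shift m,
           case w of None \<Rightarrow> snd (\<sigma> ! j) | Some c \<Rightarrow> (snd (\<sigma> ! j))(fst (\<sigma> ! j) := c)))"
    if "j < length \<sigma>" for i
    using that
  proof (induction \<sigma> arbitrary: i j)
    case (Cons \<tau> \<sigma>)
    then show ?case by (cases j) (auto split: option.splits)
  qed simp
  then show "do_acts a \<sigma> ! j = do_acts_from a 0 \<sigma> ! j"
    using \<open>j < _\<close> by (simp add: do_acts_nth)
qed

lemma do_acts_mv: "i < length \<sigma> \<Longrightarrow> do_acts [(i, None, m)] \<sigma> = \<sigma>[i := (fst (\<sigma> ! i) + shift m, snd (\<sigma> ! i))]"
  by (rule nth_equalityI) (auto simp: do_acts_nth nth_list_update)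

abbreviation mv :: "nat \<Rightarrow> move \<Rightarrow> prog" where
  "mv i m \<equiv> Do [(i, None, m)]"

definition nonblank :: "nat option \<Rightarrow> bool" where
  "nonblank c \<longleftrightarrow> c \<noteq> None"

lemma nonblank_simps [simp]: "nonblank (Some s)" "\<not> nonblank None"
  by (simp_all add: nonblank_def)

lemma nonblank_cells [simp]: "nonblank (cells a w j) \<longleftrightarrow> a \<le> j \<and> j < a + int (length w)"
  by (simp add: cells_def)

text \<open>The first step left admits a head on the blank behind the word; the last step returns
  from the blank in front of it. With two steps per cell passed and one failing test this makes
  \<open>2 * q + 3\<close> steps from offset \<open>q\<close>.\<close>

definition rewind :: "nat \<Rightarrow> prog" where
  "rewind i = mv i MoveL ;; While i nonblank (mv i MoveL) ;; mv i MoveR"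

lemma wp_rewind:
  assumes "i < length \<sigma>" "\<sigma> ! i = (a + int q, cells a w)" "q \<le> length w"
    and "Q (t + 2 * q + 3) (\<sigma>[i := (a, cells a w)])"
  shows "wp (rewind i) Q A t \<sigma>"
proof -
  have loop: "wp (While i nonblank (mv i MoveL)) (wp (mv i MoveR) Q A) A t
      (\<sigma>[i := (a + int q - 1, cells a w)])"
    if "q \<le> length w" "Q (t + 2 * q + 2) (\<sigma>[i := (a, cells a w)])" for t q
    using that
  proof (induction q arbitrary: t)
    case 0
    then show ?case using assms(1)
      by (intro wp_While_end wp_Do) (simp_all add: do_acts_mv read_tape_def)
  next
    case (Suc q)
    have "wp (While i nonblank (mv i MoveL)) (wp (mv i MoveR) Q A) A (t + 2)
      (\<sigma>[i := (a + int q - 1, cells a w)])"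
      using Suc by simp
    then show ?case using assms(1) Suc.prems(1)
      by - (rule wp_While_Do[where a="[(i, None, MoveL)]"], simp_all add: do_acts_mv read_tape_def)
  qed
  have "wp (While i nonblank (mv i MoveL)) (wp (mv i MoveR) Q A) A (t + 1)
      (\<sigma>[i := (a + int q - 1, cells a w)])"
    using loop[of q "t + 1"] assms(3,4) by (simp add: numeral_3_eq_3)
  then show ?thesis unfolding rewind_def
    using assms(1,2) by (intro wp_Then wp_Do) (simp add: do_acts_mv)
qed

subsection \<open>A machine computing a quadratic function\<close>

definition quad :: "nat \<Rightarrow> nat" where
  "quad k = k * k + k + 1"

text \<open>The count is \<open>1 + k * (k + 1)\<close>: one mark, and for each mark of tape 1 a
  pass over tape 2 and one more mark. Tape 0 is filled leftwards, so that the head ends next to the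
  first symbol of the output.\<close>

definition quad_prog :: prog where
  "quad_prog =
     While 0 nonblank (Do [(0, Some None, MoveR), (1, Some (Some 1), MoveR), (2, Some (Some 1), MoveR)]) ;;
     Do [(0, Some (Some 1), MoveL), (1, None, MoveL)] ;;
     While 1 nonblank
       (mv 2 MoveL ;; While 2 nonblank (Do [(0, Some (Some 1), MoveL), (2, None, MoveL)]) ;;
        mv 2 MoveR ;; While 2 nonblank (mv 2 MoveR) ;;
        Do [(0, Some (Some 1), MoveL), (1, None, MoveL)]) ;;
     mv 0 MoveR"

text \<open>The \<open>n\<close> marks on tape 0 end in cell \<open>k\<close>, where the copying
  loop has left the head.\<close>

definition quad_st :: "nat \<Rightarrow> nat \<Rightarrow> int \<Rightarrow> int \<Rightarrow> tape list" where
  "quad_st k n p q = [(int k - int n, cells (int k - int n + 1) (unary n)),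
     (p, cells 0 (unary k)), (q, cells 0 (unary k))]"

lemma quad_st_nth: "quad_st k n p q ! Suc 0 = (p, cells 0 (unary k))" "quad_st k n p q ! 2 = (q, cells 0 (unary k))"
  by (simp_all add: quad_st_def)

lemma quad_st_acts:
  "do_acts [(0, Some (Some (Suc 0)), MoveL), (Suc 0, None, MoveL)] (quad_st k n p q) = quad_st k (n + 1) (p - 1) q"
  "do_acts [(0, Some (Some (Suc 0)), MoveL), (2, None, MoveL)] (quad_st k n p q) = quad_st k (n + 1) p (q - 1)"
  "do_acts [(2, None, m)] (quad_st k n p q) = quad_st k n p (q + shift m)"
  using cells_Cons_left[of "int k - int n + 1" "unary n" "Suc 0"]
  by (simp_all add: quad_st_def do_acts_from unary_Suc algebra_simps)

text \<open>\<open>computable\<close> asks for termination only. Assuming the postcondition at every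
  time \<open>t\<close> switches off the time accounting.\<close>

lemma wp_quad_copy:
  assumes "\<And>t. Q t (quad_st (i + j) 0 (int (i + j)) (int (i + j)))"
  shows "wp (While 0 nonblank (Do [(0, Some None, MoveR), (1, Some (Some 1), MoveR), (2, Some (Some 1), MoveR)]))
    Q A t [(int i, cells (int i) (unary j)), (int i, cells 0 (unary i)), (int i, cells 0 (unary i))]"
  using assms
proof (induction j arbitrary: i t)
  case 0
  then show ?case
    by (intro wp_While_end) (auto simp: quad_st_def read_tape_def)
next
  case (Suc j)
  have 3: "(cells 0 (unary i))(int i := Some (Suc 0)) = cells 0 (unary (Suc i))"
    using cells_append[of 0 "unary i" 1] by (simp add: unary_Suc(2))
  have 4: "(cells (int i) (unary (Suc j)))(int i := None) = cells (int (Suc i)) (unary j)"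
    using cells_erase[of "int i" 1 "unary j"] by (simp add: unary_Suc(1) add.commute)
  show ?case
  proof (rule wp_While_Do)
    have "do_acts [(0, Some None, MoveR), (1, Some (Some 1), MoveR), (2, Some (Some 1), MoveR)]
       [(int i, cells (int i) (unary (Suc j))), (int i, cells 0 (unary i)), (int i, cells 0 (unary i))]
      = [(int (Suc i), cells (int (Suc i)) (unary j)), (int (Suc i), cells 0 (unary (Suc i))), (int (Suc i), cells 0 (unary (Suc i)))]"
      by (simp add: do_acts_from 3 4[simplified])
    then show "wp (While 0 nonblank (Do [(0, Some None, MoveR), (1, Some (Some 1), MoveR), (2, Some (Some 1), MoveR)])) Q A (t + 2)
     (do_acts [(0, Some None, MoveR), (1, Some (Some 1), MoveR), (2, Some (Some 1), MoveR)]
       [(int i, cells (int i) (unary (Suc j))), (int i, cells 0 (unary i)), (int i, cells 0 (unary i))])"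
      using Suc.IH[of "Suc i" "t + 2"] Suc.prems by simp
  qed (simp add: read_tape_def cells_unary)
qed

lemma wp_quad_left:
  assumes "j \<le> k" "\<And>t. Q t (quad_st k (n + j) p (-1))"
  shows "wp (While 2 nonblank (Do [(0, Some (Some 1), MoveL), (2, None, MoveL)])) Q A t
    (quad_st k n p (int j - 1))"
  using assms
proof (induction j arbitrary: n t)
  case 0
  then show ?case by (intro wp_While_end) (auto simp: quad_st_nth read_tape_def cells_unary)
next
  case (Suc j)
  have "wp (While 2 nonblank (Do [(0, Some (Some 1), MoveL), (2, None, MoveL)])) Q A (t + 2)
    (quad_st k (n + 1) p (int j - 1))"
    using Suc.IH[of "n + 1"] Suc.prems by simp
  then show ?case using Suc.prems(1)
    by - (rule wp_While_Do, simp_all add: quad_st_nth read_tape_def cells_unary quad_st_acts)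
qed

lemma wp_quad_right:
  assumes "j \<le> k" "\<And>t. Q t (quad_st k n p (int k))"
  shows "wp (While 2 nonblank (mv 2 MoveR)) Q A t (quad_st k n p (int (k - j)))"
  using assms
proof (induction j arbitrary: t)
  case 0
  then show ?case by (intro wp_While_end) (auto simp: quad_st_nth read_tape_def cells_unary)
next
  case (Suc j)
  have "wp (While 2 nonblank (mv 2 MoveR)) Q A (t + 2) (quad_st k n p (int (k - Suc j) + 1))"
    using Suc.IH Suc.prems by (simp add: of_nat_diff)
  then show ?case using Suc.prems(1)
    by - (rule wp_While_Do, simp_all add: quad_st_nth read_tape_def cells_unary quad_st_acts)
qed

lemma wp_quad_outer:
  assumes "j \<le> k" "\<And>t. Q t (quad_st k (n + j * (k + 1)) (-1) (int k))"
  shows "wp (While 1 nonblank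
       (mv 2 MoveL ;; While 2 nonblank (Do [(0, Some (Some 1), MoveL), (2, None, MoveL)]) ;;
        mv 2 MoveR ;; While 2 nonblank (mv 2 MoveR) ;;
        Do [(0, Some (Some 1), MoveL), (1, None, MoveL)])) Q A t (quad_st k n (int j - 1) (int k))"
  using assms
proof (induction j arbitrary: n t)
  case 0
  then show ?case by (intro wp_While_end) (auto simp: quad_st_nth read_tape_def cells_unary)
next
  case (Suc j)
  let ?W = "While 1 nonblank
       (mv 2 MoveL ;; While 2 nonblank (Do [(0, Some (Some 1), MoveL), (2, None, MoveL)]) ;;
        mv 2 MoveR ;; While 2 nonblank (mv 2 MoveR) ;;
        Do [(0, Some (Some 1), MoveL), (1, None, MoveL)])"
  have "wp ?W Q A t (quad_st k (n + k + 1) (int j - 1) (int k))" for t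
    using Suc.IH[of "n + k + 1"] Suc.prems by (simp add: algebra_simps)
  then have "wp (Do [(0, Some (Some 1), MoveL), (1, None, MoveL)]) (wp ?W Q A) A t (quad_st k (n + k) (int j) (int k))" for t
    by (intro wp_Do) (simp add: quad_st_acts)
  then have "wp (mv 2 MoveR ;; While 2 nonblank (mv 2 MoveR) ;;
        Do [(0, Some (Some 1), MoveL), (1, None, MoveL)]) (wp ?W Q A) A t (quad_st k (n + k) (int j) (-1))" for t
    using wp_quad_right[of k k "wp (Do [(0, Some (Some 1), MoveL), (1, None, MoveL)]) (wp ?W Q A) A" "n + k"]
    by - (rule wp_Then, rule wp_Do, rule wp_Then, simp add: quad_st_acts)
  then have "wp (While 2 nonblank (Do [(0, Some (Some 1), MoveL), (2, None, MoveL)]) ;; mv 2 MoveR ;; While 2 nonblank (mv 2 MoveR) ;;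
        Do [(0, Some (Some 1), MoveL), (1, None, MoveL)]) (wp ?W Q A) A t (quad_st k n (int j) (int k - 1))" for t
    by - (rule wp_Then, rule wp_quad_left, simp_all)
  then show ?case using Suc.prems(1)
    by - (rule wp_While, simp add: quad_st_nth read_tape_def cells_unary,
      rule wp_Then, rule wp_Do, simp add: quad_st_acts)
qed

lemma computable_quad: "computable quad"
proof -
  let ?M = "prog_tm 3 {1} quad_prog"
  have "turing_machine ?M"
    by (rule turing_machine_prog_tm) (simp_all add: quad_prog_def)
  moreover have "\<exists>t. tm_computes ?M [unary k] [unary (quad k)] t" for k
  proof -
    define Q where "Q = (\<lambda>(t::nat) \<sigma>. output_tape (\<sigma> ! 0) (unary (quad k)))"
    have "k + (k * k + 1) = quad k" by (simp add: quad_def)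
    then have "wp (mv 0 MoveR) Q (\<lambda>_ _. False) t (quad_st k (1 + k * (k + 1)) (-1) (int k))" for t
      using output_tape_cells[of "int k - int (quad k) + 1" "unary (quad k)"]
      by (intro wp_Do) (simp add: Q_def do_acts_from quad_st_def quad_def algebra_simps)
    moreover have "do_acts [(0, Some (Some 1), MoveL), (1, None, MoveL)] (quad_st k 0 (int k) (int k)) = quad_st k 1 (int k - 1) (int k)"
      by (simp add: quad_st_acts)
    ultimately have "wp quad_prog Q (\<lambda>_ _. False) 0 [(int 0, cells (int 0) (unary k)), (int 0, cells 0 (unary 0)), (int 0, cells 0 (unary 0))]"
      unfolding quad_prog_def
      by - (rule wp_Then, rule wp_quad_copy, rule wp_Then, rule wp_Do, rule wp_Then,
        simp only: add_0_left, rule wp_quad_outer[OF order.refl], simp)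
    then obtain s b \<sigma>' where "exec quad_prog [input_tape (unary k), input_tape [], input_tape []] s b \<sigma>'"
        "output_tape (\<sigma>' ! 0) (unary (quad k))"
      by (auto elim!: wpE simp: Q_def input_tape_cells split: if_splits)
    then have "tm_computes ?M [unary k] [unary (quad k)] s"
      by (intro tm_computes_exec[where t=s and b=b and \<sigma>=\<sigma>'])
        (auto simp: upt_rec numeral_eq_Suc quad_prog_def unary_def)
    then show ?thesis by blast
  qed
  ultimately show ?thesis unfolding computable_def by blast
qed

section \<open>The reduction machine\<close>

text \<open>Tape 0 holds the output \<open>x\<close> behind the erased input \<open>u\<close>, with the head on the first blank, so
  that aborting means to output the empty word. Tape 1 holds the new parameter. Tapes 2 to 5 hold
  copies of \<open>u\<close>, of which tape 2 is parsed; since \<open>u\<close> starts with \<open>2\<close> followed by \<open>n\<close> in unary, its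
  copies also serve to count columns, values and rows. Tapes 6 and 7 hold the parameter.\<close>

abbreviation put :: "nat \<Rightarrow> prog" where
  "put s \<equiv> Do [(0, Some (Some s), MoveR)]"

definition expect :: "nat \<Rightarrow> prog" where
  "expect s = Cond 2 (\<lambda>c. c = Some s) (mv 2 MoveR) Abort"

fun write_prog :: "nat list \<Rightarrow> prog" where
  "write_prog [] = Do []"
| "write_prog (s # w) = put s ;; write_prog w"

text \<open>Tape 4 advances in step with the marks of the value and counts up to \<open>n\<close> on
  its copy of \<open>u\<close>. A mark read when it has reached the \<open>0\<close> there means a
  value above \<open>n\<close>.\<close>

definition value_prog :: prog where
  "value_prog = While 2 (\<lambda>c. c = Some 1) (Cond 4 (\<lambda>c. c = Some 1)
     (Do [(0, Some (Some 1), MoveR), (2, None, MoveR), (4, None, MoveR)]) Abort)"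

text \<open>The initial test rejects the value \<open>0\<close>. The last move puts tape 4 back on
  cell 1, the first mark behind the leading \<open>2\<close>.\<close>

definition entry_prog :: prog where
  "entry_prog = Cond 2 (\<lambda>c. c = Some 1) value_prog Abort ;;
     expect 0 ;; put 0 ;; mv 3 MoveR ;; rewind 4 ;; mv 4 MoveR"

text \<open>The end of tape 3 is the width of a table. With \<open>s = 0\<close> this completes a
  row; with \<open>s = 1\<close>, started in cell 0, it writes the size of the universe in
  unary.\<close>

definition pad_prog :: "nat \<Rightarrow> prog" where
  "pad_prog s = While 3 nonblank (Do [(0, Some (Some s), MoveR), (3, None, MoveR)]) ;; rewind 3"

text \<open>Tape 3 counts columns. The zero written first is the value at the argument
  \<open>0\<close>; after it the head stands on the first of the \<open>n\<close> marks, so the loop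
  reads exactly \<open>n\<close> entries.\<close>

definition row_prog :: prog where
  "row_prog = expect 2 ;; put 0 ;; mv 3 MoveR ;; While 3 (\<lambda>c. c = Some 1) entry_prog ;;
     expect 3 ;; pad_prog 0"

definition rows_prog :: prog where
  "rows_prog = While 2 (\<lambda>c. c = Some 2) (row_prog ;; mv 5 MoveR)"

text \<open>Tape 5 has counted the maps; each of its remaining cells is an index without a map and
  gets a row of zeros.\<close>

definition fill_prog :: prog where
  "fill_prog = While 5 nonblank (pad_prog 0 ;; mv 5 MoveR)"

text \<open>If the head of tape 6 is at position \<open>j\<close>, this writes \<open>1\<^sup>j\<^sup>+\<^sup>1\<close> and advances that head by one.\<close>

definition index_prog :: prog where
  "index_prog =
     While 6 nonblank (Do [(0, Some (Some 1), MoveR), (6, None, MoveL), (7, None, MoveR)]) ;;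
     Do [(6, None, MoveR), (7, None, MoveL)] ;;
     While 7 nonblank (Do [(6, None, MoveR), (7, None, MoveL)]) ;;
     mv 7 MoveR"

definition each_prog :: "nat list \<Rightarrow> nat list \<Rightarrow> prog" where
  "each_prog w1 w2 = While 6 nonblank (write_prog w1 ;; index_prog ;; write_prog w2)"

text \<open>\<open>each_prog\<close> takes the head of tape 6 from cell 0 to the end and
  \<open>rep_prog\<close> takes it back; the two are used alternately, which saves
  rewinding.\<close>

definition rep_prog :: "nat list \<Rightarrow> prog" where
  "rep_prog w = mv 6 MoveL ;; While 6 nonblank (write_prog w ;; mv 6 MoveL) ;; mv 6 MoveR"

section \<open>The words that are read and written, and their unique decomposition\<close>

definition row_word :: "nat list \<Rightarrow> nat list" where
  "row_word vs = concat (map (\<lambda>v. unary v @ [0]) vs)"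

lemma row_word_simps [simp]: "row_word [] = []" "row_word (v # vs) = unary v @ 0 # row_word vs"
  by (simp_all add: row_word_def)

abbreviation map_word :: "nat list \<Rightarrow> nat list" where
  "map_word vs \<equiv> 2 # row_word vs @ [3]"

definition is_row :: "nat \<Rightarrow> nat list \<Rightarrow> bool" where
  "is_row n vs \<longleftrightarrow> length vs = n \<and> set vs \<subseteq> {1..n}"

text \<open>The letter \<open>0\<close> is the encoding of the number \<open>0\<close>: one for the
  argument \<open>0\<close>, the others for the arguments above the degree.\<close>

definition table :: "nat \<Rightarrow> nat list \<Rightarrow> nat list" where
  "table N vs = 0 # row_word vs @ replicate (N - length vs - 1) 0"

definition each_word :: "nat \<Rightarrow> nat list \<Rightarrow> nat list \<Rightarrow> nat \<Rightarrow> nat list" where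
  "each_word k w1 w2 j = concat (map (\<lambda>i. w1 @ unary (i + 1) @ w2) [j..<k])"

definition ones :: "nat list \<Rightarrow> nat" where
  "ones w = length (takeWhile (\<lambda>s. s = 1) w)"

lemma ones_simps [simp]: "ones [] = 0" "ones (s # w) = (if s = 1 then Suc (ones w) else 0)"
  by (simp_all add: ones_def)

lemma ones_split: "unary (ones w) @ drop (ones w) w = w"
  by (induction w) (auto simp: unary_Suc(1))

lemma ones_unary: "ones (unary v @ 0 # w) = v"
  by (induction v) (auto simp: unary_Suc(1))

lemma unary_append_eqD: "unary v @ 0 # w = unary v' @ 0 # w' \<Longrightarrow> v = v' \<and> w = w'"
  by (metis append_eq_append_conv list.inject ones_unary)

lemma row_word_append_eqD:
  "row_word vs @ w = row_word vs' @ w' \<Longrightarrow> length vs = length vs' \<Longrightarrow> vs = vs' \<and> w = w'"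
proof (induction vs arbitrary: vs')
  case (Cons v vs)
  then obtain v' vs'' where vs': "vs' = v' # vs''" by (cases vs') auto
  with Cons.prems have "v = v' \<and> row_word vs @ w = row_word vs'' @ w'"
    using unary_append_eqD[of v "row_word vs @ w" v' "row_word vs'' @ w'"] by simp
  then show ?case using Cons vs' by simp
qed simp

section \<open>Correctness and running time of the components\<close>

lemma post_cong: "Q t \<sigma> \<Longrightarrow> t = t' \<Longrightarrow> \<sigma> = \<sigma>' \<Longrightarrow> Q t' \<sigma>'"
  by simp

text \<open>\<open>y\<close> is the finished tape 1 and \<open>B\<close> bounds the time of an
  abort. \<open>V\<close> stands for the claim that \<open>u\<close> is malformed, which has to be
  established at every abort.\<close>

locale run =
  fixes u :: "nat list" and k :: nat and y :: tape and B :: nat and V :: bool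
begin

abbreviation N :: nat where "N \<equiv> length u"

text \<open>\<open>x\<close> is the output so far. The parsed prefix \<open>pre\<close> of
  \<open>u\<close> enters only through its length, the position of the parsing head.\<close>

definition st :: "nat list \<Rightarrow> nat list \<Rightarrow> int \<Rightarrow> int \<Rightarrow> int \<Rightarrow> int \<Rightarrow> int \<Rightarrow> tape list" where
  "st x pre p3 p4 p5 p6 p7 = [(int N + int (length x), cells (int N) x), y,
     (int (length pre), cells 0 u), (p3, cells 0 u), (p4, cells 0 u), (p5, cells 0 u),
     (p6, cells 0 (unary k)), (p7, cells 0 (unary k))]"

definition A :: "nat \<Rightarrow> tape list \<Rightarrow> bool" where
  "A t \<sigma> \<longleftrightarrow> t \<le> B \<and> V \<and> (\<exists>x pre p3 p4 p5 p6 p7. \<sigma> = st x pre p3 p4 p5 p6 p7)"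

lemma A_st: "t \<le> B \<Longrightarrow> V \<Longrightarrow> A t (st x pre p3 p4 p5 p6 p7)"
  unfolding A_def by blast

lemma st_length [simp]: "length (st x pre p3 p4 p5 p6 p7) = 8"
  by (simp add: st_def)

lemma st_nth [simp]:
  "st x pre p3 p4 p5 p6 p7 ! 2 = (int (length pre), cells 0 u)"
  "st x pre p3 p4 p5 p6 p7 ! 3 = (p3, cells 0 u)"
  "st x pre p3 p4 p5 p6 p7 ! 4 = (p4, cells 0 u)"
  "st x pre p3 p4 p5 p6 p7 ! 5 = (p5, cells 0 u)"
  "st x pre p3 p4 p5 p6 p7 ! 6 = (p6, cells 0 (unary k))"
  "st x pre p3 p4 p5 p6 p7 ! 7 = (p7, cells 0 (unary k))"
  by (simp_all add: st_def)

lemma st_update [simp]: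
  "(st x pre p3 p4 p5 p6 p7)[3 := (p, cells 0 u)] = st x pre p p4 p5 p6 p7"
  "(st x pre p3 p4 p5 p6 p7)[4 := (p, cells 0 u)] = st x pre p3 p p5 p6 p7"
  "(st x pre p3 p4 p5 p6 p7)[5 := (p, cells 0 u)] = st x pre p3 p4 p p6 p7"
  "(st x pre p3 p4 p5 p6 p7)[6 := (p, cells 0 (unary k))] = st x pre p3 p4 p5 p p7"
  "(st x pre p3 p4 p5 p6 p7)[7 := (p, cells 0 (unary k))] = st x pre p3 p4 p5 p6 p"
  by (simp_all add: st_def)

lemma st_acts:
  "do_acts [(0, Some (Some s), MoveR)] (st x pre p3 p4 p5 p6 p7) = st (x @ [s]) pre p3 p4 p5 p6 p7"
  "do_acts [(2, None, MoveR)] (st x pre p3 p4 p5 p6 p7) = st x (pre @ [s]) p3 p4 p5 p6 p7"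
  "do_acts [(3, None, m)] (st x pre p3 p4 p5 p6 p7) = st x pre (p3 + shift m) p4 p5 p6 p7"
  "do_acts [(4, None, m)] (st x pre p3 p4 p5 p6 p7) = st x pre p3 (p4 + shift m) p5 p6 p7"
  "do_acts [(5, None, m)] (st x pre p3 p4 p5 p6 p7) = st x pre p3 p4 (p5 + shift m) p6 p7"
  "do_acts [(6, None, m)] (st x pre p3 p4 p5 p6 p7) = st x pre p3 p4 p5 (p6 + shift m) p7"
  "do_acts [(7, None, m)] (st x pre p3 p4 p5 p6 p7) = st x pre p3 p4 p5 p6 (p7 + shift m)"
  "do_acts [(0, Some (Some s), MoveR), (2, None, MoveR), (4, None, MoveR)] (st x pre p3 p4 p5 p6 p7)
    = st (x @ [s]) (pre @ [s]) p3 (p4 + 1) p5 p6 p7"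
  "do_acts [(0, Some (Some s), MoveR), (3, None, MoveR)] (st x pre p3 p4 p5 p6 p7)
    = st (x @ [s]) pre (p3 + 1) p4 p5 p6 p7"
  "do_acts [(0, Some (Some s), MoveR), (6, None, MoveL), (7, None, MoveR)] (st x pre p3 p4 p5 p6 p7)
    = st (x @ [s]) pre p3 p4 p5 (p6 - 1) (p7 + 1)"
  "do_acts [(6, None, MoveR), (7, None, MoveL)] (st x pre p3 p4 p5 p6 p7)
    = st x pre p3 p4 p5 (p6 + 1) (p7 - 1)"
  using cells_append[of "int N" x s] by (simp_all add: st_def do_acts_from)

lemma wp_put: "Q (t + 1) (st (x @ [s]) pre p3 p4 p5 p6 p7) \<Longrightarrow> wp (put s) Q A t (st x pre p3 p4 p5 p6 p7)"
  by (rule wp_Do) (simp add: st_acts)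

lemma wp_mv2: "Q (t + 1) (st x (pre @ [s]) p3 p4 p5 p6 p7) \<Longrightarrow> wp (mv 2 MoveR) Q A t (st x pre p3 p4 p5 p6 p7)"
  by (rule wp_Do) (simp add: st_acts(2)[of _ _ _ _ _ _ _ s])

lemma wp_mv:
  "Q (t + 1) (st x pre (p3 + shift m) p4 p5 p6 p7) \<Longrightarrow> wp (mv 3 m) Q A t (st x pre p3 p4 p5 p6 p7)"
  "Q (t + 1) (st x pre p3 (p4 + shift m) p5 p6 p7) \<Longrightarrow> wp (mv 4 m) Q A t (st x pre p3 p4 p5 p6 p7)"
  "Q (t + 1) (st x pre p3 p4 (p5 + shift m) p6 p7) \<Longrightarrow> wp (mv 5 m) Q A t (st x pre p3 p4 p5 p6 p7)"
  "Q (t + 1) (st x pre p3 p4 p5 (p6 + shift m) p7) \<Longrightarrow> wp (mv 6 m) Q A t (st x pre p3 p4 p5 p6 p7)"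
  "Q (t + 1) (st x pre p3 p4 p5 p6 (p7 + shift m)) \<Longrightarrow> wp (mv 7 m) Q A t (st x pre p3 p4 p5 p6 p7)"
  by (rule wp_Do; simp add: st_acts)+

lemma wp_rewind34:
  "q \<le> N \<Longrightarrow> Q (t + 2 * q + 3) (st x pre 0 p4 p5 p6 p7) \<Longrightarrow> wp (rewind 3) Q A t (st x pre (int q) p4 p5 p6 p7)"
  "q \<le> N \<Longrightarrow> Q (t + 2 * q + 3) (st x pre p3 0 p5 p6 p7) \<Longrightarrow> wp (rewind 4) Q A t (st x pre p3 (int q) p5 p6 p7)"
  by (rule wp_rewind[where a=0 and q=q and w=u]; simp)+

lemma wp_write:
  "Q (t + length w + 1) (st (x @ w) pre p3 p4 p5 p6 p7) \<Longrightarrow> wp (write_prog w) Q A t (st x pre p3 p4 p5 p6 p7)"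
proof (induction w arbitrary: t x)
  case Nil
  then show ?case by (auto intro!: wp_Do simp: do_acts_Nil)
next
  case (Cons s w)
  then show ?case using Cons.IH[of "t + 1" "x @ [s]"]
    by (auto intro!: wp_Then wp_put)
qed

lemma read2: "u = pre @ w \<Longrightarrow> cells 0 u (int (length pre)) = (case w of [] \<Rightarrow> None | s # _ \<Rightarrow> Some s)"
  by (cases w) (auto simp: cells_read cells_read_end)

text \<open>The pattern of all parsing rules: \<open>w\<close> is the unread part of
  \<open>u\<close>; the postcondition is owed for each way to split off the expected piece, and
  \<open>V\<close> is owed if there is none.\<close>

lemma wp_expect:
  assumes "u = pre @ w" "\<And>w'. w = s # w' \<Longrightarrow> Q (t + 2) (st x (pre @ [s]) p3 p4 p5 p6 p7)"
    "\<nexists>w'. w = s # w' \<Longrightarrow> V" "t + 2 \<le> B"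
  shows "wp (expect s) Q A t (st x pre p3 p4 p5 p6 p7)"
  unfolding expect_def
proof (rule wp_Cond)
  assume "read_tape (st x pre p3 p4 p5 p6 p7 ! 2) = Some s"
  then obtain w' where "w = s # w'"
    by (auto simp: read_tape_def read2[OF assms(1)] split: list.splits)
  then show "wp (mv 2 MoveR) Q A (t + 1) (st x pre p3 p4 p5 p6 p7)"
    using assms(2) by (intro wp_mv2[where s=s]) simp
next
  assume "read_tape (st x pre p3 p4 p5 p6 p7 ! 2) \<noteq> Some s"
  then have "\<nexists>w'. w = s # w'"
    by (auto simp: read_tape_def read2[OF assms(1)] split: list.splits)
  then show "wp Abort Q A (t + 1) (st x pre p3 p4 p5 p6 p7)"
    using assms(3,4) by (intro wp_Abort A_st) simp_all
qed

lemma read_count: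
  assumes "u = 2 # unary n @ 0 # w" "1 \<le> j" "j \<le> n + 1"
  shows "cells 0 u (int j) = Some 1 \<longleftrightarrow> j \<le> n"
  using assms by (auto simp: cells_def nth_append unary_def nth_Cons')

text \<open>A mark costs three steps: the tests on tapes 2 and 4 and the action. The head
  \<open>j\<close> of tape 4 may come to rest in cell \<open>n + 1\<close>, the \<open>0\<close>
  behind the marks.\<close>

lemma wp_value:
  assumes "u = pre @ w" "u = 2 # unary n @ 0 # rest" "1 \<le> j" "j \<le> n + 1"
    "j + ones w \<le> n + 1 \<Longrightarrow>
      Q (t + 3 * ones w + 1) (st (x @ unary (ones w)) (pre @ unary (ones w)) p3 (int (j + ones w)) p5 p6 p7)"
    "\<not> j + ones w \<le> n + 1 \<Longrightarrow> V" "t + 3 * ones w + 1 \<le> B"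
  shows "wp value_prog Q A t (st x pre p3 (int j) p5 p6 p7)"
  using assms
proof (induction w arbitrary: t x pre j)
  case Nil
  have "read_tape (st x pre p3 (int j) p5 p6 p7 ! 2) = None"
    by (simp add: read_tape_def read2[OF Nil.prems(1)])
  then show ?case unfolding value_prog_def using Nil.prems(4,5)
    by (intro wp_While_end) (simp_all del: One_nat_def)
next
  case (Cons s w)
  show ?case
  proof (cases "s = 1")
    case False
    then show ?thesis unfolding value_prog_def using Cons.prems(3-)
      by (intro wp_While_end) (auto simp: read_tape_def read2[OF Cons.prems(1)])
  next
    case True
    show ?thesis unfolding value_prog_def
    proof (rule wp_While)
      show "read_tape (st x pre p3 (int j) p5 p6 p7 ! 2) = Some 1"
        using True by (simp add: read_tape_def read2[OF Cons.prems(1)])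
      show "wp (Cond 4 (\<lambda>c. c = Some 1) (Do [(0, Some (Some 1), MoveR), (2, None, MoveR), (4, None, MoveR)]) Abort)
        (wp (While 2 (\<lambda>c. c = Some 1) (Cond 4 (\<lambda>c. c = Some 1)
          (Do [(0, Some (Some 1), MoveR), (2, None, MoveR), (4, None, MoveR)]) Abort)) Q A) A (t + 1)
        (st x pre p3 (int j) p5 p6 p7)"
        unfolding value_prog_def[symmetric]
      proof (rule wp_Cond)
        assume "read_tape (st x pre p3 (int j) p5 p6 p7 ! 4) = Some 1"
        then have "j \<le> n" using read_count[OF Cons.prems(2-4)] by (simp add: read_tape_def)
        then have "wp value_prog Q A (t + 3) (st (x @ [1]) (pre @ [1]) p3 (int (j + 1)) p5 p6 p7)"
          using Cons.IH[of "pre @ [1]" "j + 1" "t + 3" "x @ [1]"] Cons.prems True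
          by (simp add: unary_Suc(1) algebra_simps)
        then show "wp (Do [(0, Some (Some 1), MoveR), (2, None, MoveR), (4, None, MoveR)])
          (wp value_prog Q A) A (t + 1 + 1) (st x pre p3 (int j) p5 p6 p7)"
          by (intro wp_Do) (simp add: st_acts(8) add.commute numeral_3_eq_3)
      next
        assume "read_tape (st x pre p3 (int j) p5 p6 p7 ! 4) \<noteq> Some 1"
        then have "\<not> j + ones (s # w) \<le> n + 1"
          using True read_count[OF Cons.prems(2-4)] by (simp add: read_tape_def)
        then show "wp Abort (wp value_prog Q A) A (t + 1 + 1) (st x pre p3 (int j) p5 p6 p7)"
          using Cons.prems True by (intro wp_Abort A_st) simp_all
      qed
    qed
  qed
qed

definition entry_time :: nat where "entry_time = 5 * N + 12"

lemma wp_entry: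
  assumes u: "u = pre @ w" "u = 2 # unary n @ 0 # rest"
    and Q: "\<And>v w'. 1 \<le> v \<Longrightarrow> v \<le> n \<Longrightarrow> w = unary v @ 0 # w' \<Longrightarrow>
      Q (t + entry_time) (st (x @ unary v @ [0]) (pre @ unary v @ [0]) (p3 + 1) 1 p5 p6 p7)"
    and V: "\<nexists>v w'. 1 \<le> v \<and> v \<le> n \<and> w = unary v @ 0 # w' \<Longrightarrow> V"
    and B: "t + entry_time \<le> B"
  shows "wp entry_prog Q A t (st x pre p3 1 p5 p6 p7)"
proof (cases "1 \<le> ones w \<and> ones w \<le> n")
  case True
  \<comment> \<open>An entry \<open>v\<close> takes \<open>5 * v + 12\<close> steps. As
    \<open>wp\<close> is antitone in the time, the clock may start late by the slack, so that it
    ends at \<open>t + entry_time\<close> whatever \<open>v\<close> is; \<open>wp_time\<close>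
    removes the delay at the end.\<close>
  let ?v = "ones w" and ?t = "t + 5 * (N - ones w)"
  have vN: "?v + 1 \<le> N" using True arg_cong[OF u(2), of length] by simp
  have w: "w = unary ?v @ drop ?v w" by (simp add: ones_split)
  have post: "Q (?t + 1 + 3 * ?v + 1 + 2 + 1 + 1 + 2 * (?v + 1) + 3 + 1)
      (st ((x @ unary ?v) @ [0]) ((pre @ unary ?v) @ [0]) (p3 + 1) (0 + 1) p5 p6 p7)"
    if "drop ?v w = 0 # w'" for w'
    using True w that vN by (intro post_cong[of Q, OF Q[of ?v w']]) (simp_all add: entry_time_def)
  have "wp entry_prog Q A ?t (st x pre p3 (int 1) p5 p6 p7)"
    unfolding entry_prog_def
  proof (rule wp_Then, rule wp_Cond)
    show "wp value_prog (wp (expect 0 ;; put 0 ;; mv 3 MoveR ;; rewind 4 ;; mv 4 MoveR) Q A) A (?t + 1)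
        (st x pre p3 (int 1) p5 p6 p7)"
    proof (rule wp_value[OF u])
      show "wp (expect 0 ;; put 0 ;; mv 3 MoveR ;; rewind 4 ;; mv 4 MoveR) Q A (?t + 1 + 3 * ones w + 1)
        (st (x @ unary ?v) (pre @ unary ?v) p3 (int (1 + ?v)) p5 p6 p7)"
      proof (rule wp_Then, rule wp_expect[where w = "drop ?v w"])
        fix w' assume w': "drop ?v w = 0 # w'"
        show "wp (put 0 ;; mv 3 MoveR ;; rewind 4 ;; mv 4 MoveR) Q A (?t + 1 + 3 * ones w + 1 + 2)
         (st (x @ unary ?v) ((pre @ unary ?v) @ [0]) p3 (int (1 + ?v)) p5 p6 p7)"
          using post[OF w'] vN
          by (intro wp_Then wp_put wp_mv wp_rewind34) (simp_all add: add.commute)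
      next
        assume no: "\<nexists>w'. drop ?v w = 0 # w'"
        show V
        proof (rule V, rule notI, elim exE conjE)
          fix v w' assume "w = unary v @ 0 # w'"
          then show False using no by (metis append_same_eq append_eq_append_conv ones_split ones_unary)
        qed
      qed (use u w B[unfolded entry_time_def] vN in simp_all)
    qed (use True B[unfolded entry_time_def] vN in simp_all)
  next
    assume "read_tape (st x pre p3 (int 1) p5 p6 p7 ! 2) \<noteq> Some 1"
    then show "wp Abort (wp (expect 0 ;; put 0 ;; mv 3 MoveR ;; rewind 4 ;; mv 4 MoveR) Q A) A (?t + 1)
      (st x pre p3 (int 1) p5 p6 p7)"
      using True by (cases w) (auto simp: read_tape_def read2[OF u(1)] split: if_splits)
  qed
  then show ?thesis using wp_time by (metis le_add1 of_nat_1)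
next
  case False
  have V: V
  proof (rule V, rule notI, elim exE conjE)
    fix v w' assume "1 \<le> v" "v \<le> n" "w = unary v @ 0 # w'"
    then show False using False ones_unary by simp
  qed
  have on: "ones w \<le> length w" by (simp add: ones_def length_takeWhile_le)
  have "wp entry_prog Q A t (st x pre p3 (int 1) p5 p6 p7)"
    unfolding entry_prog_def
  proof (rule wp_Then, rule wp_Cond)
    assume "read_tape (st x pre p3 (int 1) p5 p6 p7 ! 2) = Some 1"
    then have "\<not> 1 + ones w \<le> n + 1"
      using False by (cases w) (auto simp: read_tape_def read2[OF u(1)])
    then show "wp value_prog (wp (expect 0 ;; put 0 ;; mv 3 MoveR ;; rewind 4 ;; mv 4 MoveR) Q A) A (t + 1)
        (st x pre p3 (int 1) p5 p6 p7)"
      using V B[unfolded entry_time_def] on arg_cong[OF u(1), of length] by (intro wp_value[OF u]) simp_all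
  qed (intro wp_Abort A_st, use V B[unfolded entry_time_def] in simp_all)
  then show ?thesis by simp
qed

text \<open>The first entry is determined by \<open>w\<close>, so if what follows it does not split
  into \<open>r\<close> further entries, then \<open>w\<close> does not split at all and
  \<open>V\<close> is due.\<close>

lemma wp_entries:
  assumes "u = pre @ w" "u = 2 # unary n @ 0 # rest" "1 \<le> c" "c + r = n + 1"
    "\<And>vs w'. set vs \<subseteq> {1..n} \<Longrightarrow> length vs = r \<Longrightarrow> w = row_word vs @ w' \<Longrightarrow>
      Q (t + r * (entry_time + 1) + 1) (st (x @ row_word vs) (pre @ row_word vs) (int (n + 1)) 1 p5 p6 p7)"
    "\<nexists>vs w'. set vs \<subseteq> {1..n} \<and> length vs = r \<and> w = row_word vs @ w' \<Longrightarrow> V"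
    "t + r * (entry_time + 1) + 1 \<le> B"
  shows "wp (While 3 (\<lambda>c. c = Some 1) entry_prog) Q A t (st x pre (int c) 1 p5 p6 p7)"
  using assms
proof (induction r arbitrary: t x pre w c)
  case 0
  have c: "c = n + 1" using "0.prems"(4) by simp
  have "read_tape (st x pre (int c) 1 p5 p6 p7 ! 3) \<noteq> Some 1"
    using read_count[OF "0.prems"(2,3)] c by (simp add: read_tape_def)
  then show ?case using "0.prems"(5)[of "[]" w] c by (intro wp_While_end) simp_all
next
  case (Suc r)
  show ?case
  proof (rule wp_While)
    show "read_tape (st x pre (int c) 1 p5 p6 p7 ! 3) = Some 1"
      using read_count[OF Suc.prems(2,3)] Suc.prems(4) by (simp add: read_tape_def)
    show "wp entry_prog (wp (While 3 (\<lambda>c. c = Some 1) entry_prog) Q A) A (t + 1) (st x pre (int c) 1 p5 p6 p7)"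
    proof (rule wp_entry[OF Suc.prems(1,2)])
      fix v w' assume v: "1 \<le> v" "v \<le> n" and w: "w = unary v @ 0 # w'"
      have "wp (While 3 (\<lambda>c. c = Some 1) entry_prog) Q A (t + 1 + entry_time)
         (st (x @ unary v @ [0]) (pre @ unary v @ [0]) (int (c + 1)) 1 p5 p6 p7)"
      proof (rule Suc.IH)
        fix vs w'' assume vs: "set vs \<subseteq> {1..n}" "length vs = r" "w' = row_word vs @ w''"
        show "Q (t + 1 + entry_time + r * (entry_time + 1) + 1)
            (st ((x @ unary v @ [0]) @ row_word vs) ((pre @ unary v @ [0]) @ row_word vs) (int (n + 1)) 1 p5 p6 p7)"
          using vs v w by (intro post_cong[of Q, OF Suc.prems(5)[of "v # vs" w'']]) simp_all
      next
        assume no: "\<nexists>vs w''. set vs \<subseteq> {1..n} \<and> length vs = r \<and> w' = row_word vs @ w''"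
        show V
        proof (rule Suc.prems(6), rule notI, elim exE conjE)
          fix vs w'' assume vs: "set vs \<subseteq> {1..n}" "length vs = Suc r" "w = row_word vs @ w''"
          then obtain v' vs' where "vs = v' # vs'" by (cases vs) auto
          then show False using vs no w unary_append_eqD[of v w' v' "row_word vs' @ w''"] by auto
        qed
      qed (use Suc.prems(1-4,7) w in simp_all)
      then show "wp (While 3 (\<lambda>c. c = Some 1) entry_prog) Q A (t + 1 + entry_time)
         (st (x @ unary v @ [0]) (pre @ unary v @ [0]) (int c + 1) 1 p5 p6 p7)"
        by (simp add: add.commute)
    next
      assume no: "\<nexists>v w'. 1 \<le> v \<and> v \<le> n \<and> w = unary v @ 0 # w'"
      show V
      proof (rule Suc.prems(6), rule notI, elim exE conjE)
        fix vs w'' assume vs: "set vs \<subseteq> {1..n}" "length vs = Suc r" "w = row_word vs @ w''"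
        then obtain v' vs' where "vs = v' # vs'" by (cases vs) auto
        then show False using vs no by auto
      qed
    qed (use Suc.prems(7) in simp_all)
  qed
qed

lemma wp_pad:
  assumes "c + r = N" "Q (t + 2 * r + 2 * N + 4) (st (x @ replicate r s) pre 0 p4 p5 p6 p7)"
  shows "wp (pad_prog s) Q A t (st x pre (int c) p4 p5 p6 p7)"
proof -
  have "wp (While 3 nonblank (Do [(0, Some (Some s), MoveR), (3, None, MoveR)])) (wp (rewind 3) Q A) A t
      (st x pre (int c) p4 p5 p6 p7)"
    using assms
  proof (induction r arbitrary: c t x)
    case 0
    then have "wp (rewind 3) Q A (t + 1) (st x pre (int N) p4 p5 p6 p7)"
      by (intro wp_rewind34(1) post_cong[of Q, OF "0.prems"(2)]) simp_all
    then show ?case using 0 by (intro wp_While_end) (simp_all add: read_tape_def)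
  next
    case (Suc r)
    have "wp (While 3 nonblank (Do [(0, Some (Some s), MoveR), (3, None, MoveR)])) (wp (rewind 3) Q A) A (t + 2)
      (st (x @ [s]) pre (int (c + 1)) p4 p5 p6 p7)"
      using Suc.prems by (intro Suc.IH) simp_all
    then show ?case using Suc.prems(1)
      by - (rule wp_While_Do, simp add: read_tape_def, simp add: st_acts add.commute)
  qed
  then show ?thesis unfolding pad_prog_def by (rule wp_Then)
qed

definition row_time :: nat where "row_time = N * (entry_time + 1) + 4 * N + 11"

lemma wp_row:
  assumes u: "u = pre @ w" "u = 2 # unary n @ 0 # rest"
    and Q: "\<And>vs w'. is_row n vs \<Longrightarrow> w = map_word vs @ w' \<Longrightarrow>
      Q (t + row_time) (st (x @ table N vs) (pre @ map_word vs) 0 1 p5 p6 p7)"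
    and V: "\<nexists>vs w'. is_row n vs \<and> w = map_word vs @ w' \<Longrightarrow> V"
    and B: "t + row_time \<le> B"
  shows "wp row_prog Q A t (st x pre 0 1 p5 p6 p7)"
proof -
  have N: "N = n + 2 + length rest" using arg_cong[OF u(2), of length] by simp
  have le: "n * (entry_time + 1) \<le> N * (entry_time + 1)" by (rule mult_right_mono) (simp_all add: N)
  \<comment> \<open>The slack of a row: \<open>N\<close> instead of \<open>n\<close> entries are
    charged, and two steps for each of the \<open>n + 1\<close> columns that need no padding. The
    cost becomes \<open>row_time\<close> for every \<open>n\<close>.\<close>
  define \<delta> where "\<delta> = N * (entry_time + 1) - n * (entry_time + 1) + 2 * (n + 1)"
  have time: "\<delta> + n * (entry_time + 1) + 2 * (N - n - 1) + 2 * N + 11 = row_time"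
    unfolding \<delta>_def row_time_def using le N by simp
  have "wp row_prog Q A (t + \<delta>) (st x pre 0 1 p5 p6 p7)"
    unfolding row_prog_def
  proof (rule wp_Then, rule wp_expect[OF u(1)])
    fix w1 assume w: "w = 2 # w1"
    have "wp (While 3 (\<lambda>c. c = Some 1) entry_prog) (wp (expect 3 ;; pad_prog 0) Q A) A (t + \<delta> + 2 + 1 + 1)
       (st (x @ [0]) (pre @ [2]) (int 1) 1 p5 p6 p7)"
    proof (rule wp_entries[OF _ u(2)])
      fix vs w' assume vs: "set vs \<subseteq> {1..n}" "length vs = n" "w1 = row_word vs @ w'"
      show "wp (expect 3 ;; pad_prog 0) Q A (t + \<delta> + 2 + 1 + 1 + n * (entry_time + 1) + 1)
         (st ((x @ [0]) @ row_word vs) ((pre @ [2]) @ row_word vs) (int (n + 1)) 1 p5 p6 p7)"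
      proof (rule wp_Then, rule wp_expect)
        fix w'' assume w': "w' = 3 # w''"
        show "wp (pad_prog 0) Q A (t + \<delta> + 2 + 1 + 1 + n * (entry_time + 1) + 1 + 2)
            (st ((x @ [0]) @ row_word vs) (((pre @ [2]) @ row_word vs) @ [3]) (int (n + 1)) 1 p5 p6 p7)"
          using N vs w' w time by (intro wp_pad[where r = "N - n - 1"] post_cong[of Q, OF Q[of vs w'']])
            (simp_all add: is_row_def table_def)
      next
        assume no: "\<nexists>w''. w' = 3 # w''"
        show V
        proof (rule V, rule notI, elim exE conjE)
          fix vs' w'' assume "is_row n vs'" "w = map_word vs' @ w''"
          then show False using no w vs row_word_append_eqD[of vs w' vs' "3 # w''"]
            by (auto simp: is_row_def)
        qed
      qed (use u(1) w vs B time in simp_all)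
    next
      assume no: "\<nexists>vs w'. set vs \<subseteq> {1..n} \<and> length vs = n \<and> w1 = row_word vs @ w'"
      show V
      proof (rule V, rule notI, elim exE conjE)
        fix vs' w'' assume "is_row n vs'" "w = map_word vs' @ w''"
        then show False using no w by (auto simp: is_row_def)
      qed
    qed (use u(1) w B time in simp_all)
    then show "wp (put 0 ;; mv 3 MoveR ;; While 3 (\<lambda>c. c = Some 1) entry_prog ;; expect 3 ;; pad_prog 0) Q A
        (t + \<delta> + 2) (st x (pre @ [2]) 0 1 p5 p6 p7)"
      by - (rule wp_Then, rule wp_put, rule wp_Then, rule wp_mv, rule wp_Then, simp)
  next
    assume "\<nexists>w'. w = 2 # w'"
    then show V by (intro V) auto
  qed (use B time in simp_all)
  then show ?thesis by (rule wp_time) simp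
qed

text \<open>Requiring that the rest does not start with \<open>2\<close> makes the list of rows
  maximal and hence unique. The time charges one row per letter of \<open>w\<close>;
  \<open>d\<close> in the proof counts the letters of a row beyond its first, whose charge is given
  up as a delay.\<close>

lemma wp_rows:
  assumes "u = pre @ w" "u = 2 # unary n @ 0 # rest"
    "\<And>vss w'. (\<forall>vs \<in> set vss. is_row n vs) \<Longrightarrow> w = concat (map map_word vss) @ w' \<Longrightarrow> \<nexists>w''. w' = 2 # w'' \<Longrightarrow>
      Q (t + length w * (row_time + 2) + 1)
        (st (x @ concat (map (table N) vss)) (pre @ concat (map map_word vss)) 0 1 (p5 + int (length vss)) p6 p7)"
    "\<nexists>vss w'. (\<forall>vs \<in> set vss. is_row n vs) \<and> w = concat (map map_word vss) @ w' \<and> (\<nexists>w''. w' = 2 # w'') \<Longrightarrow> V"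
    "t + length w * (row_time + 2) + 1 \<le> B"
  shows "wp rows_prog Q A t (st x pre 0 1 p5 p6 p7)"
  using assms
proof (induction "length w" arbitrary: w t x pre p5 rule: less_induct)
  case less
  have read: "read_tape (st x pre 0 1 p5 p6 p7 ! 2) = Some 2 \<longleftrightarrow> (\<exists>w''. w = 2 # w'')"
    by (auto simp: read_tape_def read2[OF less.prems(1)] split: list.splits)
  show ?case
  proof (cases "\<exists>w''. w = 2 # w''")
    case False
    then have "wp rows_prog Q A (t + length w * (row_time + 2)) (st x pre 0 1 p5 p6 p7)"
      unfolding rows_prog_def using read less.prems(3)[of "[]" w]
      by (intro wp_While_end) (simp_all add: add.commute)
    then show ?thesis by (rule wp_time) simp
  next
    case True
    show ?thesis unfolding rows_prog_def
    proof (rule wp_While)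
      show "wp (row_prog ;; mv 5 MoveR) (wp (While 2 (\<lambda>c. c = Some 2) (row_prog ;; mv 5 MoveR)) Q A) A (t + 1)
        (st x pre 0 1 p5 p6 p7)"
        unfolding rows_prog_def[symmetric]
      proof (rule wp_Then, rule wp_row[OF less.prems(1,2)])
        fix vs w' assume vs: "is_row n vs" and w: "w = map_word vs @ w'"
        have "length w' + 1 \<le> length w" using w by simp
        then obtain d where d: "length w = length w' + 1 + d" by (metis le_Suc_ex)
        let ?d = "d * (row_time + 2)"
        have time: "t + length w * (row_time + 2) + 1 = t + 1 + row_time + 1 + ?d + length w' * (row_time + 2) + 1"
          unfolding d by (simp add: algebra_simps)
        have "wp rows_prog Q A (t + 1 + row_time + 1 + ?d)
          (st (x @ table N vs) (pre @ map_word vs) 0 1 (p5 + 1) p6 p7)"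
        proof (rule less.hyps)
          fix vss w2 assume vss: "\<forall>vs \<in> set vss. is_row n vs" "w' = concat (map map_word vss) @ w2"
            "\<nexists>w3. w2 = 2 # w3"
          show "Q (t + 1 + row_time + 1 + ?d + length w' * (row_time + 2) + 1)
            (st ((x @ table N vs) @ concat (map (table N) vss)) ((pre @ map_word vs) @ concat (map map_word vss))
               0 1 (p5 + 1 + int (length vss)) p6 p7)"
            using vs vss w by (intro post_cong[of Q, OF less.prems(3)[of "vs # vss" w2] time]) (simp_all add: add.assoc)
        next
          assume no: "\<nexists>vss w2. (\<forall>vs \<in> set vss. is_row n vs) \<and> w' = concat (map map_word vss) @ w2 \<and> (\<nexists>w3. w2 = 2 # w3)"
          show V
          proof (rule less.prems(4), rule notI, elim exE conjE)
            fix vss w2 assume vss: "\<forall>vs \<in> set vss. is_row n vs" "w = concat (map map_word vss) @ w2"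
              "\<nexists>w3. w2 = 2 # w3"
            then obtain vs' vss' where v: "vss = vs' # vss'" using True by (cases vss) auto
            then have "w' = concat (map map_word vss') @ w2"
              using vss w vs row_word_append_eqD[of vs "3 # w'" vs' "3 # concat (map map_word vss') @ w2"]
              by (simp add: is_row_def)
            then show False using no vss v by auto
          qed
        qed (use less.prems(1,2,5) w time in simp_all)
        then have "wp rows_prog Q A (t + 1 + row_time + 1)
          (st (x @ table N vs) (pre @ map_word vs) 0 1 (p5 + 1) p6 p7)"
          by (rule wp_time) simp
        then show "wp (mv 5 MoveR) (wp rows_prog Q A) A (t + 1 + row_time)
          (st (x @ table N vs) (pre @ map_word vs) 0 1 p5 p6 p7)"
          by (intro wp_mv) simp
      next
        assume no: "\<nexists>vs w'. is_row n vs \<and> w = map_word vs @ w'"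
        show V
        proof (rule less.prems(4), rule notI, elim exE conjE)
          fix vss w2 assume vss: "\<forall>vs \<in> set vss. is_row n vs" "w = concat (map map_word vss) @ w2"
            "\<nexists>w3. w2 = 2 # w3"
          then obtain vs' vss' where "vss = vs' # vss'" using True by (cases vss) auto
          then show False using no vss by auto
        qed
      next
        have "1 * (row_time + 2) \<le> length w * (row_time + 2)"
          by (rule mult_right_mono) (use True in auto)
        then show "t + 1 + row_time \<le> B" using less.prems(5) by simp
      qed
    qed (use True read in simp)
  qed
qed

lemma wp_fill:
  assumes "c + r = N" "Q (t + r * (4 * N + 6) + 1) (st (x @ replicate (r * N) 0) pre 0 p4 (int N) p6 p7)"
  shows "wp fill_prog Q A t (st x pre 0 p4 (int c) p6 p7)"
  using assms
proof (induction r arbitrary: c t x)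
  case 0
  then show ?case unfolding fill_prog_def by (intro wp_While_end) (simp_all add: read_tape_def)
next
  case (Suc r)
  have "wp fill_prog Q A (t + 1 + 2 * N + 2 * N + 4 + 1)
      (st (x @ replicate N 0) pre 0 p4 (int (c + 1)) p6 p7)"
    using Suc.prems by (intro Suc.IH) (simp_all add: algebra_simps replicate_add)
  then have "wp (pad_prog 0 ;; mv 5 MoveR) (wp fill_prog Q A) A (t + 1) (st x pre (int 0) p4 (int c) p6 p7)"
    by (intro wp_Then wp_pad[where r=N] wp_mv) (simp_all add: add.commute)
  then show ?case using Suc.prems(1) unfolding fill_prog_def
    by - (rule wp_While, simp_all add: read_tape_def)
qed

text \<open>Tape 7 records how far tape 6 has gone left. The action between the loops already brings
  tape 6 back to cell 0, and the second loop still makes \<open>j + 1\<close> rounds, which is why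
  the head ends one cell beyond its start.\<close>

lemma wp_index:
  assumes "j < k" "Q (t + 4 * j + 8) (st (x @ unary (j + 1)) pre p3 p4 p5 (int (j + 1)) 0)"
  shows "wp index_prog Q A t (st x pre p3 p4 p5 (int j) 0)"
proof -
  define R where "R = wp (mv 7 MoveR) Q A"
  have 2: "wp (While 7 nonblank (Do [(6, None, MoveR), (7, None, MoveL)])) R A t
      (st x pre p3 p4 p5 (int a) (int b - 1))"
    if "b \<le> k" "Q (t + 2 * b + 2) (st x pre p3 p4 p5 (int (a + b)) 0)" for t a b x
    using that
  proof (induction b arbitrary: a t)
    case 0
    then show ?case unfolding R_def by (intro wp_While_end wp_mv) (simp_all add: read_tape_def)
  next
    case (Suc b)
    have "wp (While 7 nonblank (Do [(6, None, MoveR), (7, None, MoveL)])) R A (t + 2)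
      (st x pre p3 p4 p5 (int (a + 1)) (int b - 1))"
      using Suc.prems by (intro Suc.IH) simp_all
    then show ?case using Suc.prems(1)
      by - (rule wp_While_Do, simp add: read_tape_def, simp add: st_acts add.commute)
  qed
  define R' where "R' = wp (Do [(6, None, MoveR), (7, None, MoveL)] ;;
     While 7 nonblank (Do [(6, None, MoveR), (7, None, MoveL)]) ;; mv 7 MoveR) Q A"
  have 1: "wp (While 6 nonblank (Do [(0, Some (Some 1), MoveR), (6, None, MoveL), (7, None, MoveR)])) R' A t
      (st x pre p3 p4 p5 (int a - 1) (int b))"
    if "a \<le> k" "R' (t + 2 * a + 1) (st (x @ unary a) pre p3 p4 p5 (-1) (int (a + b)))" for t a b x
    using that
  proof (induction a arbitrary: b t x)
    case 0
    then show ?case by (intro wp_While_end) (simp_all add: read_tape_def)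
  next
    case (Suc a)
    have "wp (While 6 nonblank (Do [(0, Some (Some 1), MoveR), (6, None, MoveL), (7, None, MoveR)])) R' A (t + 2)
      (st (x @ [1]) pre p3 p4 p5 (int a - 1) (int (b + 1)))"
      using Suc.prems by (intro Suc.IH) (simp_all add: unary_Suc(1))
    then show ?case using Suc.prems(1)
      by - (rule wp_While_Do, simp add: read_tape_def, simp add: st_acts add.commute)
  qed
  have "Q (t + 2 * (j + 1) + 1 + 1 + 2 * (j + 1) + 2) (st (x @ unary (j + 1)) pre p3 p4 p5 (int (0 + (j + 1))) 0)"
    using assms(2) by (rule post_cong[of Q]) simp_all
  then have "wp (While 7 nonblank (Do [(6, None, MoveR), (7, None, MoveL)])) R A (t + 2 * (j + 1) + 1 + 1)
      (st (x @ unary (j + 1)) pre p3 p4 p5 (int 0) (int (j + 1) - 1))"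
    using assms(1) by (intro 2) simp_all
  then have "R' (t + 2 * (j + 1) + 1) (st (x @ unary (j + 1)) pre p3 p4 p5 (-1) (int ((j + 1) + 0)))"
    unfolding R'_def R_def by - (rule wp_Then, rule wp_Do, rule wp_Then, simp add: st_acts)
  then have "wp (While 6 nonblank (Do [(0, Some (Some 1), MoveR), (6, None, MoveL), (7, None, MoveR)])) R' A t
      (st x pre p3 p4 p5 (int (j + 1) - 1) (int 0))"
    using assms(1) by (intro 1) simp_all
  then show ?thesis unfolding index_prog_def R'_def by - (rule wp_Then, simp)
qed

lemma wp_each:
  assumes "j + r = k"
    "Q (t + r * (length w1 + length w2 + 4 * k + 7) + 1) (st (x @ each_word k w1 w2 j) pre p3 p4 p5 (int k) 0)"
  shows "wp (each_prog w1 w2) Q A t (st x pre p3 p4 p5 (int j) 0)"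
  using assms
proof (induction r arbitrary: j t x)
  case 0
  then show ?case unfolding each_prog_def
    by (intro wp_While_end) (simp_all add: read_tape_def each_word_def)
next
  case (Suc r)
  have jk: "j < k" using Suc.prems(1) by simp
  then have ew: "each_word k w1 w2 j = w1 @ unary (j + 1) @ w2 @ each_word k w1 w2 (j + 1)"
    by (simp add: each_word_def upt_conv_Cons)
  have "wp (each_prog w1 w2) Q A (t + (length w1 + length w2 + 4 * k + 7))
      (st (x @ w1 @ unary (j + 1) @ w2) pre p3 p4 p5 (int (j + 1)) 0)"
    using Suc.prems by (intro Suc.IH) (simp_all add: algebra_simps ew)
  \<comment> \<open>A round takes \<open>4 * j + 11\<close> steps besides the two words, and
    \<open>j < k\<close> bounds this by \<open>4 * k + 7\<close>.\<close>
  then have "wp (each_prog w1 w2) Q A (t + 1 + length w1 + 1 + 4 * j + 8 + length w2 + 1)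
      (st (x @ w1 @ unary (j + 1) @ w2) pre p3 p4 p5 (int (j + 1)) 0)"
    by (rule wp_time) (use jk in simp)
  then have "wp (each_prog w1 w2) Q A (t + 1 + length w1 + 1 + 4 * j + 8 + length w2 + 1)
      (st (((x @ w1) @ unary (j + 1)) @ w2) pre p3 p4 p5 (int (j + 1)) 0)"
    by simp
  then have "wp (write_prog w1 ;; index_prog ;; write_prog w2) (wp (each_prog w1 w2) Q A) A (t + 1)
      (st x pre p3 p4 p5 (int j) 0)"
    using jk by - (rule wp_Then, rule wp_write, rule wp_Then, rule wp_index, assumption, rule wp_write)
  then show ?case unfolding each_prog_def using jk
    by - (rule wp_While, simp_all add: read_tape_def)
qed

lemma wp_rep:
  assumes "Q (t + k * (length w + 3) + 3) (st (x @ concat (replicate k w)) pre p3 p4 p5 (int 0) p7)"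
  shows "wp (rep_prog w) Q A t (st x pre p3 p4 p5 (int k) p7)"
proof -
  have loop: "wp (While 6 nonblank (write_prog w ;; mv 6 MoveL)) (wp (mv 6 MoveR) Q A) A t
      (st x pre p3 p4 p5 (int j - 1) p7)"
    if "j \<le> k" "Q (t + j * (length w + 3) + 2) (st (x @ concat (replicate j w)) pre p3 p4 p5 0 p7)" for j t x
    using that
  proof (induction j arbitrary: t x)
    case 0
    then show ?case by (intro wp_While_end wp_mv) (simp_all add: read_tape_def)
  next
    case (Suc j)
    have "wp (While 6 nonblank (write_prog w ;; mv 6 MoveL)) (wp (mv 6 MoveR) Q A) A (t + 1 + length w + 1 + 1)
      (st (x @ w) pre p3 p4 p5 (int j - 1) p7)"
      using Suc.prems(1) by (intro Suc.IH post_cong[of Q, OF Suc.prems(2)]) simp_all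
    then have "wp (write_prog w ;; mv 6 MoveL) (wp (While 6 nonblank (write_prog w ;; mv 6 MoveL)) (wp (mv 6 MoveR) Q A) A) A
        (t + 1) (st x pre p3 p4 p5 (int (Suc j) - 1) p7)"
      by - (rule wp_Then, rule wp_write, rule wp_mv, simp)
    then show ?case using Suc.prems(1)
      by - (rule wp_While, simp_all add: read_tape_def)
  qed
  have "wp (While 6 nonblank (write_prog w ;; mv 6 MoveL)) (wp (mv 6 MoveR) Q A) A (t + 1)
      (st x pre p3 p4 p5 (int k - 1) p7)"
    using assms by (intro loop) (simp_all add: numeral_3_eq_3)
  then show ?thesis unfolding rep_prog_def by - (rule wp_Then, rule wp_mv, rule wp_Then, simp)
qed

end

subsection \<open>The whole program\<close>

text \<open>Lists of values replace extensional functions, so that the analysis of the machine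
  speaks of words only; \<open>is_instance_iff\<close> brings the functions back.\<close>

definition is_instance :: "nat list \<Rightarrow> nat \<Rightarrow> nat list \<Rightarrow> nat list list \<Rightarrow> bool" where
  "is_instance u n vs vss \<longleftrightarrow> 1 \<le> n \<and> is_row n vs \<and> (\<forall>vs \<in> set vss. is_row n vs) \<and>
     u = 2 # unary n @ 0 # map_word vs @ 2 # concat (map map_word vss) @ [3, 3]"

text \<open>The formula written by the program uses the function symbols \<open>c\<close>, \<open>a\<close>, \<open>f\<close> under the names 0, 1, 2.\<close>

definition text1 :: "nat list" where
  "text1 = 2 # encode (Num 6) @ encode (Num 0) @ 2 # encode (Num 4) @
     encode (form_data (Eq (Fun 1 [Var 0]) (Fun 0 []))) @ 2 # encode (Num 0) @ encode (term_data (Fun 1 [Var 0]))"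

text \<open>The terminator of the universe size, the complete entry of \<open>c\<close>, whose table
  is the single value \<open>0\<close>, and the head of the entry of \<open>a\<close>.\<close>

definition text2 :: "nat list" where
  "text2 = 0 # 2 # encode (Seq [Num 0, Num 0, Seq [Num 0]]) @ 2 # encode (Num 1) @ encode (Num 1) @ [2]"

definition text3 :: "nat list" where
  "text3 = 3 # 3 # 2 # encode (Num 2) @ encode (Num 2) @ [2]"

text \<open>This closes the table and the entry of \<open>f\<close> and the list of functions, adds
  the empty list of relations, and closes the structure and the pair.\<close>

definition text4 :: "nat list" where
  "text4 = [3, 3, 3, 2, 3, 3, 3]"

definition head_prog :: prog where
  "head_prog = expect 2 ;; Cond 2 (\<lambda>c. c = Some 1) (While 2 (\<lambda>c. c = Some 1) (mv 2 MoveR)) Abort ;;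
     expect 0 ;; mv 4 MoveR"

definition text_prog :: prog where
  "text_prog = write_prog [2] ;; each_prog [2, 1, 1, 1, 1, 1, 0] [0] ;; write_prog text1 ;;
     rep_prog [2, 1, 0, 1, 1, 0] ;; write_prog [2, 0, 0, 3] ;; each_prog [2, 0] [0, 3, 3] ;;
     write_prog [3, 3, 3] ;; rep_prog [3] ;; write_prog [2] ;; pad_prog 1 ;; write_prog text2"

definition body_prog :: prog where
  "body_prog = head_prog ;; text_prog ;; row_prog ;; write_prog text3 ;; expect 2 ;; rows_prog ;;
     expect 3 ;; expect 3 ;; Cond 2 (\<lambda>c. c = None) (Do []) Abort ;; fill_prog ;; write_prog text4"

text \<open>\<open>[2, 1, 1, 1, 1, 1, 0]\<close> opens an \<open>Exi\<close>,
  \<open>[2, 1, 0, 1, 1, 0]\<close> an application of the function 2; \<open>[2, 0, 0, 3]\<close> is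
  \<open>Var 0\<close>, and \<open>[0, 3, 3]\<close> ends a variable and the application around it.
  The term nests to the left, so its \<open>k\<close> openings precede all variables.\<close>

definition text_word :: "nat \<Rightarrow> nat \<Rightarrow> nat list" where
  "text_word k N = 2 # each_word k [2, 1, 1, 1, 1, 1, 0] [0] 0 @ text1 @
     concat (replicate k [2, 1, 0, 1, 1, 0]) @ [2, 0, 0, 3] @ each_word k [2, 0] [0, 3, 3] 0 @
     [3, 3, 3] @ concat (replicate k [3]) @ [2] @ replicate N 1 @ text2"

definition output_word :: "nat \<Rightarrow> nat \<Rightarrow> nat list \<Rightarrow> nat list list \<Rightarrow> nat list" where
  "output_word k N vs vss = text_word k N @ table N vs @ text3 @ concat (map (table N) vss) @
     replicate ((N - length vss) * N) 0 @ text4"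

definition left_prog :: "nat \<Rightarrow> prog" where
  "left_prog n = ((;;) (Do [(1, Some (Some 1), MoveL)]) ^^ n) (Do [])"

lemma left_prog_simps: "left_prog 0 = Do []" "left_prog (Suc n) = Do [(1, Some (Some 1), MoveL)] ;; left_prog n"
  by (simp_all add: left_prog_def)

abbreviation copy_act :: "nat \<Rightarrow> prog" where
  "copy_act s \<equiv> Do [(0, Some None, MoveR), (2, Some (Some s), MoveR), (3, Some (Some s), MoveR),
     (4, Some (Some s), MoveR), (5, Some (Some s), MoveR)]"

text \<open>An action writes fixed symbols, so copying needs one branch for each letter.\<close>

definition copy_prog :: prog where
  "copy_prog = While 0 nonblank (Cond 0 (\<lambda>c. c = Some 0) (copy_act 0)
     (Cond 0 (\<lambda>c. c = Some 1) (copy_act 1) (Cond 0 (\<lambda>c. c = Some 2) (copy_act 2) (copy_act 3))))"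

text \<open>Three marks for each unit of \<open>k\<close> and ten more give the length
  \<open>3 * k + 10\<close> of the sentence; they are written leftwards, so that the head ends on
  the first of them.\<close>

definition param_prog :: prog where
  "param_prog =
     While 1 nonblank (Do [(1, Some None, MoveR), (6, Some (Some 1), MoveR), (7, Some (Some 1), MoveR)]) ;;
     Do [(6, None, MoveL), (7, None, MoveL)] ;;
     While 7 nonblank (left_prog 3 ;; Do [(6, None, MoveL), (7, None, MoveL)]) ;;
     left_prog 10 ;;
     Do [(1, None, MoveR), (6, None, MoveR), (7, None, MoveR)]"

definition init_prog :: prog where
  "init_prog = copy_prog ;; rewind 2 ;; rewind 3 ;; rewind 4 ;; rewind 5 ;; param_prog"

text \<open>An abort skips the last \<open>rewind\<close> and leaves the head of tape 0 on the blank
  behind the partial output; only a complete run returns to its first letter.\<close>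

definition main_prog :: prog where
  "main_prog = (init_prog ;; body_prog) ;; rewind 0"

text \<open>Every \<open>map_word\<close> starts with \<open>2\<close> and the remainders do not, so
  both lists end at the same place.\<close>

lemma map_words_append_eqD:
  "concat (map map_word vss) @ w = concat (map map_word vss') @ w' \<Longrightarrow>
   \<forall>vs \<in> set vss \<union> set vss'. is_row n vs \<Longrightarrow> \<nexists>w1. w = 2 # w1 \<Longrightarrow> \<nexists>w1. w' = 2 # w1 \<Longrightarrow> vss = vss' \<and> w = w'"
proof (induction vss arbitrary: vss')
  case Nil
  then show ?case by (cases vss') auto
next
  case (Cons vs vss)
  then obtain vs' vss1 where v: "vss' = vs' # vss1" by (cases vss') auto
  then have "vs = vs' \<and> 3 # concat (map map_word vss) @ w = 3 # concat (map map_word vss1) @ w'"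
    using Cons.prems(1,2) by (intro row_word_append_eqD) (auto simp: is_row_def)
  then show ?case using Cons.IH[of vss1] Cons.prems v by auto
qed

section \<open>Parsing a whole input and printing its image\<close>

context run
begin

lemma wp_ones:
  assumes "u = pre @ w" "Q (t + 2 * ones w + 1) (st x (pre @ unary (ones w)) p3 p4 p5 p6 p7)"
  shows "wp (While 2 (\<lambda>c. c = Some 1) (mv 2 MoveR)) Q A t (st x pre p3 p4 p5 p6 p7)"
  using assms
proof (induction w arbitrary: pre t)
  case Nil
  have "read_tape (st x pre p3 p4 p5 p6 p7 ! 2) = None"
    by (simp add: read_tape_def read2[OF Nil.prems(1)])
  then show ?case using Nil.prems(2) by (intro wp_While_end) simp_all
next
  case (Cons s w)
  have r: "read_tape (st x pre p3 p4 p5 p6 p7 ! 2) = Some s"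
    by (simp add: read_tape_def read2[OF Cons.prems(1)])
  show ?case
  proof (cases "s = 1")
    case True
    have "wp (While 2 (\<lambda>c. c = Some 1) (mv 2 MoveR)) Q A (t + 2) (st x (pre @ [1]) p3 p4 p5 p6 p7)"
      using Cons.prems True by (intro Cons.IH) (simp_all add: unary_Suc(1))
    then show ?thesis using r True
      by - (rule wp_While_Do, simp, simp add: st_acts(2)[of _ _ _ _ _ _ _ 1])
  next
    case False
    then show ?thesis using r Cons.prems(2) by (intro wp_While_end) simp_all
  qed
qed

lemma wp_head:
  assumes Q: "\<And>n w. 1 \<le> n \<Longrightarrow> u = 2 # unary n @ 0 # w \<Longrightarrow>
      Q (t + 2 * N + 10) (st x (2 # unary n @ [0]) p3 (p4 + 1) p5 p6 p7)"
    and V: "\<nexists>n w. 1 \<le> n \<and> u = 2 # unary n @ 0 # w \<Longrightarrow> V" and B: "t + 2 * N + 10 \<le> B"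
  shows "wp head_prog Q A t (st x [] p3 p4 p5 p6 p7)"
  unfolding head_prog_def
proof (rule wp_Then, rule wp_expect)
  show "u = [] @ u" by simp
next
  fix w1 assume w1: "u = 2 # w1"
  then have u1: "u = ([] @ [2]) @ w1" by simp
  have le: "ones w1 \<le> N" using w1 length_takeWhile_le[of _ w1] by (simp add: ones_def le_SucI)
  have r: "read_tape (st x ([] @ [2]) p3 p4 p5 p6 p7 ! 2) = Some 1 \<longleftrightarrow> 1 \<le> ones w1"
    using read2[OF u1] by (auto simp: read_tape_def split: list.splits)
  show "wp (Cond 2 (\<lambda>c. c = Some 1) (While 2 (\<lambda>c. c = Some 1) (mv 2 MoveR)) Abort ;; expect 0 ;; mv 4 MoveR)
      Q A (t + 2) (st x ([] @ [2]) p3 p4 p5 p6 p7)"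
  proof (rule wp_Then, rule wp_Cond)
    assume "read_tape (st x ([] @ [2]) p3 p4 p5 p6 p7 ! 2) = Some 1"
    then have n: "1 \<le> ones w1" using r by simp
    show "wp (While 2 (\<lambda>c. c = Some 1) (mv 2 MoveR)) (wp (expect 0 ;; mv 4 MoveR) Q A) A (t + 2 + 1)
        (st x ([] @ [2]) p3 p4 p5 p6 p7)"
    proof (rule wp_ones[OF u1], rule wp_Then, rule wp_expect)
      show "u = (([] @ [2]) @ unary (ones w1)) @ drop (ones w1) w1" using w1 by (simp add: ones_split)
    next
      fix w2 assume "drop (ones w1) w1 = 0 # w2"
      then have "u = 2 # unary (ones w1) @ 0 # w2" using w1 ones_split[of w1] by simp
      then have "wp (mv 4 MoveR) Q A (t + 2 * N + 9) (st x (2 # unary (ones w1) @ [0]) p3 p4 p5 p6 p7)"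
        by (intro wp_mv post_cong[of Q, OF Q[OF n]]) simp_all
      then have "wp (mv 4 MoveR) Q A (t + 2 + 1 + 2 * ones w1 + 1 + 2) (st x (2 # unary (ones w1) @ [0]) p3 p4 p5 p6 p7)"
        by (rule wp_time) (use le in simp)
      then show "wp (mv 4 MoveR) Q A (t + 2 + 1 + 2 * ones w1 + 1 + 2) (st x ((([] @ [2]) @ unary (ones w1)) @ [0]) p3 p4 p5 p6 p7)"
        by simp
    next
      assume no: "\<nexists>w'. drop (ones w1) w1 = 0 # w'"
      show V
      proof (rule V, rule notI, elim exE conjE)
        fix n w assume "u = 2 # unary n @ 0 # w"
        then have e: "w1 = unary n @ 0 # w" using w1 by simp
        then have "ones w1 = n" by (simp add: ones_unary)
        then show False using e no by simp
      qed
    qed (use B le in simp)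
  next
    assume "read_tape (st x ([] @ [2]) p3 p4 p5 p6 p7 ! 2) \<noteq> Some 1"
    then have n: "\<not> 1 \<le> ones w1" using r by simp
    have "\<nexists>n w. 1 \<le> n \<and> u = 2 # unary n @ 0 # w" using n w1 ones_unary by force
    then show "wp Abort (wp (expect 0 ;; mv 4 MoveR) Q A) A (t + 2 + 1) (st x ([] @ [2]) p3 p4 p5 p6 p7)"
      using B by (intro wp_Abort A_st V) simp_all
  qed
next
  assume "\<nexists>w'. u = 2 # w'"
  then show V by (intro V) auto
qed (use B in simp)

definition text_time :: nat where
  "text_time = k * (8 + 4 * k + 7) + length text1 + k * 9 + k * (5 + 4 * k + 7) + k * 4 + 4 * N + length text2 + 27"

lemma wp_text:
  assumes "Q (t + text_time) (st (x @ text_word k N) pre 0 p4 p5 0 0)"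
  shows "wp text_prog Q A t (st x pre 0 p4 p5 0 0)"
proof -
  have "wp text_prog Q A t (st x pre (int 0) p4 p5 (int 0) 0)"
    unfolding text_prog_def
    by (rule wp_Then, rule wp_write, rule wp_Then, rule wp_each[OF add_0_left], rule wp_Then, rule wp_write,
        rule wp_Then, rule wp_rep, rule wp_Then, rule wp_write, rule wp_Then, rule wp_each[OF add_0_left],
        rule wp_Then, rule wp_write, rule wp_Then, rule wp_rep, rule wp_Then, rule wp_write,
        rule wp_Then, rule wp_pad[OF add_0_left], rule wp_write, rule post_cong[of Q, OF assms])
      (simp_all add: text_time_def text_word_def)
  then show ?thesis by simp
qed

definition body_time :: nat where
  "body_time = 2 * N + 10 + text_time + row_time + length text3 + 1 + 2 + (N * (row_time + 2) + 1) +
     2 + 2 + 2 + (N * (4 * N + 6) + 1) + length text4 + 1"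

text \<open>What has been parsed is the corresponding part of any instance that \<open>u\<close>
  could be: \<open>inst\<close>, \<open>inst2\<close> and \<open>inst3\<close> accumulate this
  knowledge. When a stage fails, the remaining part of such an instance would have let it succeed,
  so there is none and \<open>V\<close> follows.\<close>

lemma wp_body:
  assumes Q: "\<And>t' n vs vss pre. t' \<le> t + body_time \<Longrightarrow> is_instance u n vs vss \<Longrightarrow>
      Q t' (st (x @ output_word k N vs vss) pre 0 1 (int N) 0 0)"
    and V: "\<nexists>n vs vss. is_instance u n vs vss \<Longrightarrow> V"
    and B: "t + body_time \<le> B"
  shows "wp body_prog Q A t (st x [] 0 0 0 0 0)"
proof -
  note B = B[unfolded body_time_def]
  show ?thesis unfolding body_prog_def
  proof (rule wp_Then, rule wp_head)
    fix n w assume n: "1 \<le> n" and u: "u = 2 # unary n @ 0 # w"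
    have inst: "n' = n \<and> w = map_word vs @ 2 # concat (map map_word vss) @ [3, 3]"
      if "is_instance u n' vs vss" for n' vs vss
      using that u unary_append_eqD[of n' "map_word vs @ 2 # concat (map map_word vss) @ [3, 3]" n w]
      by (auto simp: is_instance_def)
    define t1 where "t1 = t + 2 * N + 10 + text_time"
    have u1: "u = (2 # unary n @ [0]) @ w" using u by simp
    have "wp (row_prog ;; write_prog text3 ;; expect 2 ;; rows_prog ;; expect 3 ;; expect 3 ;;
        Cond 2 (\<lambda>c. c = None) (Do []) Abort ;; fill_prog ;; write_prog text4) Q A t1
        (st (x @ text_word k N) (2 # unary n @ [0]) 0 1 0 0 0)"
    proof (rule wp_Then, rule wp_row[OF u1 u])
      fix vs w' assume vs: "is_row n vs" and w: "w = map_word vs @ w'"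
      define t2 where "t2 = t1 + row_time + length text3 + 1"
      have inst2: "vs' = vs \<and> w' = 2 # concat (map map_word vss) @ [3, 3]"
        if "is_instance u n' vs' vss" for n' vs' vss
        using inst[OF that] that vs w row_word_append_eqD[of vs' "3 # 2 # concat (map map_word vss) @ [3, 3]" vs "3 # w'"]
        by (auto simp: is_instance_def is_row_def)
      let ?x = "((x @ text_word k N) @ table N vs) @ text3" and ?pre = "(2 # unary n @ [0]) @ map_word vs"
      have "wp (expect 2 ;; rows_prog ;; expect 3 ;; expect 3 ;;
          Cond 2 (\<lambda>c. c = None) (Do []) Abort ;; fill_prog ;; write_prog text4) Q A t2
          (st ?x ?pre 0 1 0 0 0)"
      proof (rule wp_Then, rule wp_expect)
        show "u = ?pre @ w'" using u w by simp
      next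
        fix w2 assume w2: "w' = 2 # w2"
        have N: "length w2 \<le> N" using u w w2 by simp
        define t3 where "t3 = t2 + 2 + (length w2 * (row_time + 2) + 1)"
        have t3: "t3 \<le> t2 + 2 + (N * (row_time + 2) + 1)"
          unfolding t3_def using mult_right_mono[OF N, of "row_time + 2"] by simp
        have time: "t3 + 2 + 2 + 2 + (N * (4 * N + 6) + 1) + length text4 + 1 \<le> t + body_time"
          using t3 unfolding t2_def t1_def body_time_def by linarith
        have u3: "u = (?pre @ [2]) @ w2" using u w w2 by simp
        have inst3: "w2 = concat (map map_word vss) @ [3, 3]"
          if "is_instance u n' vs' vss" for n' vs' vss
          using inst2[OF that] w2 by simp
        show "wp (rows_prog ;; expect 3 ;; expect 3 ;; Cond 2 (\<lambda>c. c = None) (Do []) Abort ;;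
            fill_prog ;; write_prog text4) Q A (t2 + 2) (st ?x (?pre @ [2]) 0 1 0 0 0)"
        proof (rule wp_Then, rule wp_rows[OF u3 u])
          fix vss w3 assume vss: "\<forall>vs \<in> set vss. is_row n vs" and w3: "w2 = concat (map map_word vss) @ w3"
            "\<nexists>w4. w3 = 2 # w4"
          let ?x3 = "?x @ concat (map (table N) vss)" and ?pre3 = "(?pre @ [2]) @ concat (map map_word vss)"
          \<comment> \<open>In an instance exactly \<open>[3, 3]\<close> is left here; this one fact
            serves the aborts of both closing brackets and of the test for the end of
            \<open>u\<close>.\<close>
          have V3: V if "w3 \<noteq> [3, 3]"
          proof (rule V, rule notI, elim exE)
            fix n' vs' vss' assume i: "is_instance u n' vs' vss'"
            have "n' = n" using inst[OF i] by simp
            then have "w3 = [3, 3]"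
              using inst3[OF i] w3 vss i map_words_append_eqD[of vss w3 vss' "[3, 3]" n]
              by (auto simp: is_instance_def)
            then show False using that by simp
          qed
          show "wp (expect 3 ;; expect 3 ;; Cond 2 (\<lambda>c. c = None) (Do []) Abort ;;
              fill_prog ;; write_prog text4) Q A (t2 + 2 + length w2 * (row_time + 2) + 1)
              (st ?x3 ?pre3 0 1 (0 + int (length vss)) 0 0)"
          proof (rule wp_Then, rule wp_expect)
            show "u = ?pre3 @ w3" using u3 w3 by simp
          next
            fix w4 assume w4: "w3 = 3 # w4"
            show "wp (expect 3 ;; Cond 2 (\<lambda>c. c = None) (Do []) Abort ;; fill_prog ;; write_prog text4) Q A
              (t2 + 2 + length w2 * (row_time + 2) + 1 + 2) (st ?x3 (?pre3 @ [3]) 0 1 (0 + int (length vss)) 0 0)"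
            proof (rule wp_Then, rule wp_expect)
              show "u = (?pre3 @ [3]) @ w4" using u3 w3 w4 by simp
            next
              fix w5 assume w5: "w4 = 3 # w5"
              have u5: "u = ((?pre3 @ [3]) @ [3]) @ w5" using u3 w3 w4 w5 by simp
              have r: "read_tape (st ?x3 ((?pre3 @ [3]) @ [3]) 0 1 (0 + int (length vss)) 0 0 ! 2) = None \<longleftrightarrow> w5 = []"
                using read2[OF u5] by (simp add: read_tape_def split: list.splits)
              show "wp (Cond 2 (\<lambda>c. c = None) (Do []) Abort ;; fill_prog ;; write_prog text4) Q A
                (t2 + 2 + length w2 * (row_time + 2) + 1 + 2 + 2) (st ?x3 ((?pre3 @ [3]) @ [3]) 0 1 (0 + int (length vss)) 0 0)"
              proof (rule wp_Then, rule wp_Cond)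
                assume "read_tape (st ?x3 ((?pre3 @ [3]) @ [3]) 0 1 (0 + int (length vss)) 0 0 ! 2) = None"
                then have "w5 = []" using r by simp
                then have i: "is_instance u n vs vss"
                  using n vs vss u w w2 w3 w4 w5 by (simp add: is_instance_def)
                \<comment> \<open>Each map takes up letters of \<open>u\<close>, so there are at
                  most \<open>N\<close> of them and tape 5 has not passed its end.\<close>
                have len: "length vss \<le> length (concat (map map_word vss))"
                  by (induction vss) auto
                then have m: "length vss \<le> N" using N w3 by simp
                let ?r = "N - length vss"
                have "?r * (4 * N + 6) \<le> N * (4 * N + 6)" by (rule mult_right_mono) simp_all
                then have "Q (t3 + 2 + 2 + 1 + 1 + ?r * (4 * N + 6) + 1 + length text4 + 1)
                   (st (x @ output_word k N vs vss) ((?pre3 @ [3]) @ [3]) 0 1 (int N) 0 0)"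
                  using time by (intro Q[OF _ i]) linarith
                then have "wp fill_prog (wp (write_prog text4) Q A) A (t3 + 2 + 2 + 1 + 1)
                   (st ?x3 ((?pre3 @ [3]) @ [3]) 0 1 (int (length vss)) 0 0)"
                  using m by (intro wp_fill[where r = ?r] wp_write) (simp_all add: output_word_def)
                then show "wp (Do []) (wp (fill_prog ;; write_prog text4) Q A) A
                  (t2 + 2 + length w2 * (row_time + 2) + 1 + 2 + 2 + 1) (st ?x3 ((?pre3 @ [3]) @ [3]) 0 1 (0 + int (length vss)) 0 0)"
                  by - (rule wp_Do, rule wp_Then, simp add: do_acts_Nil t3_def)
              next
                assume "read_tape (st ?x3 ((?pre3 @ [3]) @ [3]) 0 1 (0 + int (length vss)) 0 0 ! 2) \<noteq> None"
                then have "w5 \<noteq> []" unfolding r .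
                then have V using w4 w5 by (intro V3) simp
                then show "wp Abort (wp (fill_prog ;; write_prog text4) Q A) A
                  (t2 + 2 + length w2 * (row_time + 2) + 1 + 2 + 2 + 1) (st ?x3 ((?pre3 @ [3]) @ [3]) 0 1 (0 + int (length vss)) 0 0)"
                  using time assms(3) unfolding t3_def by (intro wp_Abort A_st) linarith+
              qed
            next
              assume "\<nexists>w'. w4 = 3 # w'"
              then show V using w4 by (intro V3) simp
            qed (use time assms(3) in \<open>unfold t3_def, linarith\<close>)
          next
            assume "\<nexists>w'. w3 = 3 # w'"
            then show V by (intro V3) simp
          qed (use time assms(3) in \<open>unfold t3_def, linarith\<close>)
        next
          assume no: "\<nexists>vss w'. (\<forall>vs \<in> set vss. is_row n vs) \<and> w2 = concat (map map_word vss) @ w' \<and> (\<nexists>w''. w' = 2 # w'')"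
          show V
          proof (rule V, rule notI, elim exE)
            fix n' vs' vss' assume i: "is_instance u n' vs' vss'"
            have "\<forall>vs \<in> set vss'. is_row n vs" using i inst[OF i] by (simp add: is_instance_def)
            then have "\<exists>vss w'. (\<forall>vs \<in> set vss. is_row n vs) \<and> w2 = concat (map map_word vss) @ w' \<and> (\<nexists>w''. w' = 2 # w'')"
              by (intro exI[of _ vss'] exI[of _ "[3, 3]"]) (simp add: inst3[OF i])
            then show False using no by contradiction
          qed
        qed (use time assms(3) in \<open>unfold t3_def, linarith\<close>)
      next
        assume "\<nexists>w2. w' = 2 # w2"
        then show V using inst2 by (intro V) blast
      qed (use assms(3) in \<open>unfold t2_def t1_def body_time_def, linarith\<close>)
      then show "wp (write_prog text3 ;; expect 2 ;; rows_prog ;; expect 3 ;; expect 3 ;;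
        Cond 2 (\<lambda>c. c = None) (Do []) Abort ;; fill_prog ;; write_prog text4) Q A (t1 + row_time)
        (st ((x @ text_word k N) @ table N vs) ((2 # unary n @ [0]) @ map_word vs) 0 1 0 0 0)"
        unfolding t2_def by - (rule wp_Then, rule wp_write)
    next
      assume no: "\<nexists>vs w'. is_row n vs \<and> w = map_word vs @ w'"
      show V
      proof (rule V, rule notI, elim exE)
        fix n' vs' vss' assume i: "is_instance u n' vs' vss'"
        have "is_row n vs'" using i inst[OF i] by (simp add: is_instance_def)
        then have "\<exists>vs w'. is_row n vs \<and> w = map_word vs @ w'"
          by (intro exI[of _ vs'] exI[of _ "2 # concat (map map_word vss') @ [3, 3]"]) (simp add: inst[OF i])
        then show False using no by contradiction
      qed
    qed (use assms(3) in \<open>unfold t1_def body_time_def, linarith\<close>)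
    then show "wp (text_prog ;; row_prog ;; write_prog text3 ;; expect 2 ;; rows_prog ;; expect 3 ;; expect 3 ;;
        Cond 2 (\<lambda>c. c = None) (Do []) Abort ;; fill_prog ;; write_prog text4) Q A (t + 2 * N + 10)
        (st x (2 # unary n @ [0]) 0 (0 + 1) 0 0 0)"
      unfolding t1_def by - (rule wp_Then, simp, rule wp_text, simp)
  next
    assume "\<nexists>n w. 1 \<le> n \<and> u = 2 # unary n @ 0 # w"
    then show V by (intro V) (auto simp: is_instance_def)
  qed (use B in linarith)
qed

end

section \<open>Initialisation: copies of the input and the new parameter\<close>

lemma wp_copy:
  assumes "u = pre @ w" "set w \<subseteq> {0, 1, 2, 3}"
    "Q (t + 5 * length w + 1)
      [(int (length u), cells (int (length u)) []), y, (int (length u), cells 0 u), (int (length u), cells 0 u),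
       (int (length u), cells 0 u), (int (length u), cells 0 u), z, z']"
  shows "wp copy_prog Q A t
      [(int (length pre), cells (int (length pre)) w), y, (int (length pre), cells 0 pre), (int (length pre), cells 0 pre),
       (int (length pre), cells 0 pre), (int (length pre), cells 0 pre), z, z']"
  using assms
proof (induction w arbitrary: pre t)
  case Nil
  then show ?case unfolding copy_prog_def
    by (intro wp_While_end) (simp_all add: read_tape_def)
next
  case (Cons s w)
  let ?\<sigma> = "\<lambda>pre w. [(int (length pre), cells (int (length pre)) w), y, (int (length pre), cells 0 pre), (int (length pre), cells 0 pre),
       (int (length pre), cells 0 pre), (int (length pre), cells 0 pre), z, z']"
  have act: "do_acts [(0, Some None, MoveR), (2, Some (Some s), MoveR), (3, Some (Some s), MoveR),
     (4, Some (Some s), MoveR), (5, Some (Some s), MoveR)] (?\<sigma> pre (s # w)) = ?\<sigma> (pre @ [s]) w"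
    using cells_append[of 0 pre s] cells_erase[of "int (length pre)" s w]
    by (simp add: do_acts_from add.commute)
  have IH: "wp copy_prog Q A (t + 5) (?\<sigma> (pre @ [s]) w)"
    using Cons.prems by (intro Cons.IH) simp_all
  \<comment> \<open>A letter costs the loop test, at most three comparisons and the action, five
    steps in all; the shorter branches are delayed to the same time.\<close>
  have copy: "wp (copy_act s) (wp copy_prog Q A) A t' (?\<sigma> pre (s # w))" if "t' \<le> t + 4" for t'
    by (rule wp_Do) (use that in \<open>simp only: act, intro wp_time[OF IH], simp\<close>)
  have read: "read_tape (?\<sigma> pre (s # w) ! 0) = Some s"
    by (simp add: read_tape_def cells_def)
  show ?case unfolding copy_prog_def
  proof (rule wp_While)
    show "wp (Cond 0 (\<lambda>c. c = Some 0) (copy_act 0)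
     (Cond 0 (\<lambda>c. c = Some 1) (copy_act 1) (Cond 0 (\<lambda>c. c = Some 2) (copy_act 2) (copy_act 3))))
     (wp (While 0 nonblank (Cond 0 (\<lambda>c. c = Some 0) (copy_act 0)
     (Cond 0 (\<lambda>c. c = Some 1) (copy_act 1) (Cond 0 (\<lambda>c. c = Some 2) (copy_act 2) (copy_act 3))))) Q A) A (t + 1)
       (?\<sigma> pre (s # w))"
      unfolding copy_prog_def[symmetric]
    proof (rule wp_Cond, goal_cases)
      case 1
      then have "s = 0" using read by simp
      then show ?case using copy[of "t + 1 + 1"] by (simp del: One_nat_def)
    next
      case 2
      show ?case
      proof (rule wp_Cond, goal_cases)
        case 1
        then have s: "s = 1" using read by simp
        show ?case using copy[of "t + 1 + 1 + 1"] unfolding s by simp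
      next
        case (2)
        show ?case
        proof (rule wp_Cond, goal_cases)
          case 1
          then have s: "s = 2" using read by simp
          show ?case using copy[of "t + 1 + 1 + 1 + 1"] unfolding s by simp
        next
          case 2
          then have "s = 3"
            using Cons.prems(2) read \<open>read_tape (?\<sigma> pre (s # w) ! 0) \<noteq> Some 0\<close> \<open>read_tape (?\<sigma> pre (s # w) ! 0) \<noteq> Some 1\<close> by auto
          then show ?case using copy[of "t + 1 + 1 + 1 + 1"] by simp
        qed
      qed
    qed
  qed (simp add: read_tape_def)
qed

definition param_st :: "nat list \<Rightarrow> nat \<Rightarrow> tape \<Rightarrow> int \<Rightarrow> tape list" where
  "param_st u k y p = [(int (length u), \<lambda>_. None), y, (0, cells 0 u), (0, cells 0 u), (0, cells 0 u),
     (0, cells 0 u), (p, cells 0 (unary k)), (p, cells 0 (unary k))]"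

abbreviation left_tape :: "nat \<Rightarrow> nat \<Rightarrow> tape" where
  "left_tape k n \<equiv> (int k - int n, cells (int k - int n + 1) (unary n))"

lemma param_st_acts:
  "do_acts [(Suc 0, Some (Some (Suc 0)), MoveL)] (param_st u k (left_tape k n) p) = param_st u k (left_tape k (n + 1)) p"
  "do_acts [(6, None, m), (7, None, m)] (param_st u k y p) = param_st u k y (p + shift m)"
  "do_acts [(Suc 0, None, MoveR), (6, None, MoveR), (7, None, MoveR)] (param_st u k y p) = param_st u k (fst y + 1, snd y) (p + 1)"
  using cells_Cons_left[of "int k - int n + 1" "unary n" "Suc 0"]
  by (simp_all add: param_st_def do_acts_from unary_Suc algebra_simps)

lemma wp_left:
  assumes "Q (t + m + 1) (param_st u k (left_tape k (n + m)) p)"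
  shows "wp (left_prog m) Q A t (param_st u k (left_tape k n) p)"
  using assms
proof (induction m arbitrary: n t)
  case 0
  then show ?case by (auto intro!: wp_Do simp: left_prog_simps do_acts_Nil)
next
  case (Suc m)
  have "wp (left_prog m) Q A (t + 1) (param_st u k (left_tape k (n + 1)) p)"
    using Suc.prems by (intro Suc.IH) simp
  then show ?case unfolding left_prog_simps
    by - (rule wp_Then, rule wp_Do, simp add: param_st_acts)
qed

lemma wp_param_copy:
  assumes "Q (t + 2 * j + 1) (param_st u (i + j) (left_tape (i + j) 0) (int (i + j)))"
  shows "wp (While 1 nonblank (Do [(1, Some None, MoveR), (6, Some (Some 1), MoveR), (7, Some (Some 1), MoveR)]))
    Q A t [(int (length u), \<lambda>_. None), (int i, cells (int i) (unary j)), (0, cells 0 u), (0, cells 0 u), (0, cells 0 u),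
     (0, cells 0 u), (int i, cells 0 (unary i)), (int i, cells 0 (unary i))]"
  using assms
proof (induction j arbitrary: i t)
  case 0
  then show ?case
    by (intro wp_While_end) (auto simp: param_st_def read_tape_def)
next
  case (Suc j)
  let ?P = "[(1, Some None, MoveR), (6, Some (Some 1), MoveR), (7, Some (Some 1), MoveR)]"
  let ?\<sigma> = "\<lambda>i j. [(int (length u), \<lambda>_. None), (int i, cells (int i) (unary j)), (0, cells 0 u), (0, cells 0 u), (0, cells 0 u),
     (0, cells 0 u), (int i, cells 0 (unary i)), (int i, cells 0 (unary i))]"
  have 3: "(cells 0 (unary i))(int i := Some (Suc 0)) = cells 0 (unary (Suc i))"
    using cells_append[of 0 "unary i" 1] by (simp add: unary_Suc(2))
  have 4: "(cells (int i) (unary (Suc j)))(int i := None) = cells (int (Suc i)) (unary j)"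
    using cells_erase[of "int i" 1 "unary j"] by (simp add: unary_Suc(1) add.commute)
  show ?case
  proof (rule wp_While_Do)
    have "do_acts ?P (?\<sigma> i (Suc j)) = ?\<sigma> (Suc i) j"
      by (simp add: do_acts_from 3 4[simplified])
    then show "wp (While 1 nonblank (Do ?P)) Q A (t + 2) (do_acts ?P (?\<sigma> i (Suc j)))"
      using Suc.IH[of "t + 2" "Suc i"] Suc.prems by simp
  qed (simp add: read_tape_def cells_unary)
qed

text \<open>Copying leaves the head of tape 1 in cell \<open>k\<close>. The
  \<open>3 * k + 10\<close> marks end there, hence begin in cell
  \<open>k - (3 * k + 10) + 1 = - (2 * k + 9)\<close>.\<close>

lemma wp_param:
  assumes "Q (t + 8 * k + 15) (param_st u k (- int (2 * k + 9), cells (- int (2 * k + 9)) (unary (3 * k + 10))) 0)"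
  shows "wp param_prog Q A t [(int (length u), \<lambda>_. None), (0, cells 0 (unary k)), (0, cells 0 u), (0, cells 0 u), (0, cells 0 u),
     (0, cells 0 u), (0, \<lambda>_. None), (0, \<lambda>_. None)]"
proof -
  let ?W = "While 7 nonblank (left_prog 3 ;; Do [(6, None, MoveL), (7, None, MoveL)])"
  let ?R = "wp (left_prog 10 ;; Do [(1, None, MoveR), (6, None, MoveR), (7, None, MoveR)]) Q A"
  have loop: "wp ?W R A t (param_st u k (left_tape k n) (int j - 1))"
    if "j \<le> k" "R (t + 6 * j + 1) (param_st u k (left_tape k (n + 3 * j)) (-1))" for R j t n
    using that
  proof (induction j arbitrary: n t)
    case 0
    then show ?case by (intro wp_While_end) (simp_all add: read_tape_def param_st_def)
  next
    case (Suc j)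
    have "wp ?W R A (t + 1 + 3 + 1 + 1) (param_st u k (left_tape k (n + 3)) (int j - 1))"
      using Suc.prems(1) by (intro Suc.IH post_cong[of R, OF Suc.prems(2)]) (simp_all add: add.assoc)
    then have "wp (left_prog 3 ;; Do [(6, None, MoveL), (7, None, MoveL)]) (wp ?W R A) A (t + 1)
        (param_st u k (left_tape k n) (int (Suc j) - 1))"
      by - (rule wp_Then, rule wp_left, rule wp_Do, simp add: param_st_acts)
    then show ?case using Suc.prems(1)
      by - (rule wp_While, simp_all add: read_tape_def param_st_def)
  qed
  have 1: "wp (Do [(1, None, MoveR), (6, None, MoveR), (7, None, MoveR)]) Q A (t + 2 * k + 1 + 1 + 6 * k + 1 + 10 + 1)
     (param_st u k (left_tape k (0 + 3 * k + 10)) (-1))"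
    by (rule wp_Do, rule post_cong[of Q, OF assms]) (simp_all add: param_st_acts algebra_simps)
  have 2: "?R (t + 2 * k + 1 + 1 + 6 * k + 1) (param_st u k (left_tape k (0 + 3 * k)) (-1))"
    by (rule wp_Then, rule wp_left, rule 1)
  have "wp ?W ?R A (t + 2 * k + 1 + 1) (param_st u k (left_tape k 0) (int k - 1))"
    by (rule loop[of k ?R, OF order.refl 2])
  then have "wp (Do [(6, None, MoveL), (7, None, MoveL)]) (wp ?W ?R A) A (t + 2 * k + 1) (param_st u (0 + k) (left_tape (0 + k) 0) (int (0 + k)))"
    by - (rule wp_Do, simp add: param_st_acts)
  then have "wp param_prog Q A t [(int (length u), \<lambda>_. None), (int 0, cells (int 0) (unary k)), (0, cells 0 u), (0, cells 0 u), (0, cells 0 u),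
     (0, cells 0 u), (int 0, cells 0 (unary 0)), (int 0, cells 0 (unary 0))]"
    unfolding param_prog_def by - (rule wp_Then, rule wp_param_copy, rule wp_Then, rule wp_mono, assumption, rule wp_Then, assumption)
  then show ?thesis by simp
qed

definition new_param_tape :: "nat \<Rightarrow> tape" where
  "new_param_tape k = (- int (2 * k + 9), cells (- int (2 * k + 9)) (unary (3 * k + 10)))"

definition init_time :: "nat \<Rightarrow> nat \<Rightarrow> nat" where
  "init_time N k = 13 * N + 8 * k + 28"

lemma wp_init:
  assumes "set u \<subseteq> {0, 1, 2, 3}" "Q (t + init_time (length u) k) (param_st u k (new_param_tape k) 0)"
  shows "wp init_prog Q A t (map (\<lambda>i. input_tape (if i < length [u, unary k] then [u, unary k] ! i else [])) [0..<8])"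
proof -
  let ?N = "length u" and ?z = "(0, \<lambda>_. None) :: tape"
  let ?\<sigma> = "\<lambda>p2 p3 p4 p5. [(int ?N, \<lambda>_. None), (0, cells 0 (unary k)), (p2, cells 0 u), (p3, cells 0 u), (p4, cells 0 u),
     (p5, cells 0 u), ?z, ?z]"
  let ?t = "t + 5 * ?N + 1 + 4 * (2 * ?N + 3)"
  have "wp param_prog Q A ?t (?\<sigma> 0 0 0 0)"
    using assms(2) by (intro wp_param post_cong[of Q, OF assms(2)]) (simp_all add: init_time_def new_param_tape_def)
  then have "wp (rewind 5) (wp param_prog Q A) A (t + 5 * ?N + 1 + 3 * (2 * ?N + 3)) (?\<sigma> 0 0 0 (int ?N))"
    by (intro wp_rewind[where a=0 and q = ?N and w=u]) (simp_all add: algebra_simps)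
  then have "wp (rewind 4 ;; rewind 5 ;; param_prog) Q A (t + 5 * ?N + 1 + 2 * (2 * ?N + 3)) (?\<sigma> 0 0 (int ?N) (int ?N))"
    by (intro wp_Then wp_rewind[where i=4 and a=0 and q = ?N and w=u]) (simp_all add: algebra_simps)
  then have "wp (rewind 3 ;; rewind 4 ;; rewind 5 ;; param_prog) Q A (t + 5 * ?N + 1 + (2 * ?N + 3)) (?\<sigma> 0 (int ?N) (int ?N) (int ?N))"
    by - (rule wp_Then, rule wp_rewind[where i=3 and a=0 and q = ?N and w=u]; simp add: algebra_simps)
  then have "wp (rewind 2 ;; rewind 3 ;; rewind 4 ;; rewind 5 ;; param_prog) Q A (t + 5 * ?N + 1) (?\<sigma> (int ?N) (int ?N) (int ?N) (int ?N))"
    by - (rule wp_Then, rule wp_rewind[where i=2 and a=0 and q = ?N and w=u]; simp add: algebra_simps)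
  then have "wp init_prog Q A t [(0, cells 0 u), (0, cells 0 (unary k)), ?z, ?z, ?z, ?z, ?z, ?z]"
    unfolding init_prog_def using assms(1)
    by - (rule wp_Then, rule wp_copy[of u "[]" u, simplified], simp_all)
  moreover have "[0..<8] = [0, 1, 2, 3, 4, 5, 6, 7 :: nat]" by (simp add: upt_rec)
  ultimately show ?thesis by (simp add: input_tape_cells)
qed

section \<open>Complete runs and their running time\<close>

definition total_time :: "nat list \<Rightarrow> nat \<Rightarrow> nat" where
  "total_time u k = init_time (length u) k + run.body_time u k"

lemma exec_main:
  assumes u: "set u \<subseteq> {0, 1, 2, 3}"
  obtains s b \<sigma> where
    "exec main_prog (map (\<lambda>i. input_tape (if i < length [u, unary k] then [u, unary k] ! i else [])) [0..<8]) s b \<sigma>"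
    "s \<le> 3 * total_time u k + 3" "output_tape (\<sigma> ! 1) (unary (3 * k + 10))"
    "\<And>n vs vss. is_instance u n vs vss \<Longrightarrow> \<exists>n vs vss. is_instance u n vs vss \<and>
       output_tape (\<sigma> ! 0) (output_word k (length u) vs vss)"
    "\<nexists>n vs vss. is_instance u n vs vss \<Longrightarrow> output_tape (\<sigma> ! 0) []"
proof -
  define T where "T = total_time u k"
  \<comment> \<open>With this choice an abort certifies that \<open>u\<close> is malformed, so that
    the empty output is right.\<close>
  define V where "V \<longleftrightarrow> (\<nexists>n vs vss. is_instance u n vs vss)"
  interpret run u k "new_param_tape k" T V .
  let ?\<sigma>0 = "map (\<lambda>i. input_tape (if i < length [u, unary k] then [u, unary k] ! i else [])) [0..<8]"
  define Q where "Q = (\<lambda>t \<sigma>. t \<le> T \<and> (\<exists>n vs vss pre. is_instance u n vs vss \<and>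
    \<sigma> = st (output_word k N vs vss) pre 0 1 (int N) 0 0))"
  have st: "param_st u k (new_param_tape k) 0 = st [] [] 0 0 0 0 0"
    by (simp add: param_st_def st_def)
  have out1: "output_tape (st x pre p3 p4 p5 p6 p7 ! 1) (unary (3 * k + 10))" for x pre p3 p4 p5 p6 p7
  proof -
    have "output_tape (new_param_tape k) (unary (3 * k + 10))"
      unfolding new_param_tape_def by (rule output_tape_cells)
    then show ?thesis by (simp add: st_def)
  qed
  have "wp body_prog Q A (0 + init_time N k) (st [] [] 0 0 0 0 0)"
  proof (rule wp_body)
    fix t' n vs vss pre assume "t' \<le> 0 + init_time N k + body_time" "is_instance u n vs vss"
    then show "Q t' (st ([] @ output_word k N vs vss) pre 0 1 (int N) 0 0)"
      unfolding Q_def T_def total_time_def by auto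
  next
    assume "\<nexists>n vs vss. is_instance u n vs vss"
    then show V unfolding V_def .
  next
    show "0 + init_time N k + body_time \<le> T" unfolding T_def total_time_def by simp
  qed
  then have "wp (init_prog ;; body_prog) Q A 0 ?\<sigma>0"
    by (intro wp_Then wp_init[OF u]) (simp add: st)
  then obtain s b \<sigma> t where e: "exec (init_prog ;; body_prog) ?\<sigma>0 s b \<sigma>" and s: "0 + s \<le> t"
    and post: "if b then A t \<sigma> else Q t \<sigma>" by (rule wpE)
  show ?thesis
  proof (cases b)
    case True
    then obtain x pre p3 p4 p5 p6 p7 where *: "t \<le> T" V "\<sigma> = st x pre p3 p4 p5 p6 p7"
      using post by (auto simp: A_def)
    have "exec main_prog ?\<sigma>0 s True \<sigma>"
      unfolding main_prog_def using e True by - (rule exec_Then_abort, simp)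
    moreover have "output_tape (\<sigma> ! 0) []"
      unfolding *(3) by (simp add: st_def output_tape_def cells_def)
    ultimately show ?thesis using * s out1 by (intro that) (auto simp: T_def V_def)
  next
    case False
    then obtain n vs vss pre where i: "is_instance u n vs vss" and t: "t \<le> T"
      and \<sigma>: "\<sigma> = st (output_word k N vs vss) pre 0 1 (int N) 0 0"
      using post by (auto simp: Q_def)
    let ?x = "output_word k N vs vss"
    have len: "length ?\<sigma>0 = 8" by simp
    \<comment> \<open>The head of tape 0 started in cell 0 and stands behind the output, so the
      output has at most \<open>s\<close> letters and rewinding takes at most
      \<open>2 * s + 3\<close> steps. This is the origin of the factor 3.\<close>
    have "\<bar>fst (\<sigma> ! 0) - fst (?\<sigma>0 ! 0)\<bar> \<le> int s"
      using exec_head[OF e, of 0] by simp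
    moreover have "fst (?\<sigma>0 ! 0) = 0" by (simp add: input_tape_def)
    ultimately have x: "length ?x \<le> s" by (simp add: \<sigma> st_def)
    have "wp (rewind 0) (\<lambda>t \<sigma>'. t \<le> 2 * length ?x + 3 \<and> \<sigma>' = \<sigma>[0 := (int N, cells (int N) ?x)]) (\<lambda>_ _. False) 0 \<sigma>"
      by (rule wp_rewind[where a = "int N" and q = "length ?x" and w = ?x]) (simp_all add: \<sigma> st_def)
    then obtain s' where e': "exec (rewind 0) \<sigma> s' False (\<sigma>[0 := (int N, cells (int N) ?x)])" "s' \<le> 2 * length ?x + 3"
      by (auto elim!: wpE split: if_splits)
    have "exec main_prog ?\<sigma>0 (s + s') False (\<sigma>[0 := (int N, cells (int N) ?x)])"
      unfolding main_prog_def using e False e' by - (rule exec_Then, simp_all)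
    moreover have "s + s' \<le> 3 * T + 3" using s t x e'(2) by linarith
    moreover have "output_tape (\<sigma>[0 := (int N, cells (int N) ?x)] ! 1) (unary (3 * k + 10))"
      using out1 by (simp add: \<sigma>)
    moreover have "output_tape (\<sigma>[0 := (int N, cells (int N) ?x)] ! 0) ?x"
      using output_tape_cells by (simp add: \<sigma>)
    ultimately show ?thesis using i
      by (intro that[of "s + s'" False "\<sigma>[0 := (int N, cells (int N) ?x)]"]) (auto simp: T_def)
  qed
qed

lemma wf_main_prog: "wf_prog 8 {0, 1, 2, 3} main_prog"
proof -
  have w: "wf_prog 8 {0, 1, 2, 3} (write_prog w)" if "set w \<subseteq> {0, 1, 2, 3}" for w
    using that by (induction w) auto
  have l: "wf_prog 8 {0, 1, 2, 3} (left_prog n)" for n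
    by (induction n) (simp_all add: left_prog_simps)
  show ?thesis using l[simplified] w[simplified]
    by (simp add: main_prog_def init_prog_def body_prog_def copy_prog_def rewind_def param_prog_def head_prog_def
        expect_def text_prog_def each_prog_def index_prog_def rep_prog_def pad_prog_def row_prog_def rows_prog_def
        fill_prog_def entry_prog_def value_prog_def text1_def text2_def text3_def text4_def unary_def)
qed

text \<open>The time is cubic in the length of \<open>u\<close>, from up to \<open>N\<close> rows of
  \<open>N\<close> entries of cost linear in \<open>N\<close>, plus a term quadratic in
  \<open>k\<close> from the variable names. The sum becomes a product because \<open>P\<close>, the
  expanded cube of \<open>1 + N\<close>, and \<open>quad k\<close> are positive; the constants are
  generous.\<close>

lemma total_time_bound: "3 * total_time u k + 3 \<le> poly ([:10000:] * [:1, 1:] ^ 3) (length u) * quad k"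
proof -
  define N where "N = length u"
  have l: "length text1 \<le> 60" "length text2 \<le> 30" "length text3 \<le> 20" "length text4 \<le> 10"
    by (simp_all add: text1_def text2_def text3_def text4_def unary_def)
  define P where "P = 1 + 3 * N + 3 * (N * N) + N * N * N"
  have "total_time u k \<le> 8 * (k * k) + 48 * k + 5 * (N * N * N) + 30 * (N * N) + 60 * N + 250"
    using l unfolding total_time_def init_time_def run.body_time_def run.text_time_def run.row_time_def run.entry_time_def
      N_def[symmetric]
    by (simp add: algebra_simps)
  then have "3 * total_time u k + 3 \<le> 1000 * P + 1000 * quad k"
    unfolding P_def quad_def by simp
  also have "\<dots> \<le> 1000 * (P * quad k) + 1000 * (P * quad k)"
    by (intro add_mono mult_left_mono) (simp_all add: P_def quad_def)
  also have "\<dots> \<le> 10000 * (P * quad k)" by simp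
  also have "\<dots> = poly ([:10000:] * [:1, 1:] ^ 3) (length u) * quad k"
    unfolding N_def[symmetric] P_def by (simp add: power3_eq_cube algebra_simps)
  finally show ?thesis .
qed

section \<open>The formula and the structure\<close>

fun product_term :: "nat \<Rightarrow> fo_term" where
  "product_term 0 = Var 0"
| "product_term (Suc j) = Fun 2 [product_term j, Var (Suc j)]"

definition matrix :: "nat \<Rightarrow> form" where
  "matrix k = Disj (Eq (Fun 1 [Var 0]) (Fun 0 [])) (Eq (Fun 1 [Var 0]) (product_term k))"

definition fact_form :: "nat \<Rightarrow> form" where
  "fact_form k = foldr Exi [1..<k + 1] (All 0 (matrix k))"

definition fact_sig :: fo_sig where
  "fact_sig = \<lparr>fun_syms = {0, 1, 2}, rel_syms = {}, fun_ar = (\<lambda>f. f), rel_ar = (\<lambda>_. 1)\<rparr>"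

text \<open>Mappings are extended by \<open>0\<close>, which no valid argument is mapped to.\<close>

definition app :: "nat list \<Rightarrow> nat \<Rightarrow> nat" where
  "app vs x = (if 1 \<le> x \<and> x \<le> length vs then vs ! (x - 1) else 0)"

definition app_nth :: "nat list list \<Rightarrow> nat \<Rightarrow> nat \<Rightarrow> nat" where
  "app_nth vss x i = (if i < length vss then app (vss ! i) x else 0)"

text \<open>In \<open>fact_sig\<close> the name of a symbol is its arity, so the number of arguments
  tells which function is meant.\<close>

definition fact_struct :: "nat \<Rightarrow> nat list \<Rightarrow> nat list list \<Rightarrow> nat fo_struct" where
  "fact_struct N vs vss = \<lparr>universe = {..<N},
     fun_int = (\<lambda>_ xs. case xs of [x] \<Rightarrow> app vs x | [x, i] \<Rightarrow> app_nth vss x i | _ \<Rightarrow> 0),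
     rel_int = (\<lambda>_. {})\<rparr>"

text \<open>The meaning of the sentence in the structure: the witnesses are arbitrary elements of
  the universe, not yet known to be indices of maps.\<close>

definition factorizable :: "nat \<Rightarrow> nat list \<Rightarrow> nat list list \<Rightarrow> nat \<Rightarrow> bool" where
  "factorizable N vs vss k \<longleftrightarrow> (\<exists>is. length is = k \<and> set is \<subseteq> {..<N} \<and>
     (\<forall>x < N. app vs x = 0 \<or> app vs x = foldl (app_nth vss) x is))"

subsection \<open>Encodings\<close>

lemma unary_numerals [simp]: "unary 1 = [1]" "unary 2 = [1, 1]" "unary 5 = [1, 1, 1, 1, 1]" "unary (Suc 0) = [1]"
  by (simp_all add: unary_def numeral_eq_Suc)

lemma concat_map_each: "concat (map (\<lambda>x. w1 @ unary x @ w2) [1..<k + 1]) = each_word k w1 w2 0"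
  unfolding each_word_def by (simp add: map_Suc_upt[symmetric] comp_def del: upt_Suc)

lemma each_word_Suc: "each_word (Suc k) w1 w2 0 = each_word k w1 w2 0 @ w1 @ unary (Suc k) @ w2"
  by (simp add: each_word_def)

lemma encode_product_term:
  "encode (term_data (product_term k)) =
     concat (replicate k [2, 1, 0, 1, 1, 0]) @ [2, 0, 0, 3] @ each_word k [2, 0] [0, 3, 3] 0"
  by (induction k) (simp_all add: each_word_Suc, simp add: each_word_def)

lemma encode_foldr_Exi:
  "encode (form_data (foldr Exi xs F)) =
     concat (map (\<lambda>x. [2, 1, 1, 1, 1, 1, 0] @ unary x @ [0]) xs) @ encode (form_data F) @ replicate (length xs) 3"
  by (induction xs) (simp_all add: replicate_append_same)

lemma concat_map_concat: "concat (concat (map f xs)) = concat (map (\<lambda>x. concat (f x)) xs)"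
  by (induction xs) simp_all

lemma concat_replicate_single: "concat (replicate k [s]) = replicate k s"
  by (induction k) simp_all

lemma encode_fact_form:
  "[2] @ encode (form_data (fact_form k)) @ [2] @ unary N @ text2 = text_word k N"
  unfolding fact_form_def encode_foldr_Exi concat_map_each
  by (simp add: matrix_def text_word_def text1_def encode_product_term concat_replicate_single unary_def[of N] del: upt_Suc)

text \<open>The arguments split into \<open>0\<close>, the points, and the padding above the degree,
  which are the three pieces of \<open>table\<close>.\<close>

lemma concat_app_table:
  assumes "length vs < N"
  shows "concat (map (\<lambda>x. unary (app vs x) @ [0]) [0..<N]) = table N vs"
proof -
  have "[0..<N] = 0 # map Suc [0..<length vs] @ [Suc (length vs)..<N]"
    using assms upt_add_eq_append[of 0 "Suc (length vs)" "N - Suc (length vs)"]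
    by (simp add: map_Suc_upt upt_conv_Cons del: upt_Suc)
  moreover have "map (\<lambda>x. unary (app vs x) @ [0]) (map Suc [0..<length vs]) = map (\<lambda>v. unary v @ [0]) vs"
    by (rule nth_equalityI) (simp_all add: app_def)
  moreover have "map (\<lambda>x. unary (app vs x) @ [0]) [Suc (length vs)..<N] = replicate (N - length vs - 1) [0]"
    by (rule nth_equalityI) (simp_all add: app_def)
  ultimately have "concat (map (\<lambda>x. unary (app vs x) @ [0]) [0..<N]) =
      (unary (app vs 0) @ [0]) @ concat (map (\<lambda>v. unary v @ [0]) vs) @ concat (replicate (N - length vs - 1) [0])"
    by (simp only: map_append list.map concat_append concat.simps append_assoc)
  then show ?thesis by (simp add: table_def row_word_def concat_replicate_single app_def)
qed

lemma concat_app_nth_tables: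
  assumes "\<forall>vs \<in> set vss. length vs < N" "length vss \<le> N"
  shows "concat (map (\<lambda>i. concat (map (\<lambda>x. unary (app_nth vss x i) @ [0]) [0..<N])) [0..<N]) =
    concat (map (table N) vss) @ replicate ((N - length vss) * N) 0"
proof -
  let ?g = "\<lambda>i. concat (map (\<lambda>x. unary (app_nth vss x i) @ [0]) [0..<N])"
  have "[0..<N] = [0..<length vss] @ [length vss..<N]"
    using assms(2) upt_add_eq_append[of 0 "length vss" "N - length vss"] by simp
  moreover have "map ?g [0..<length vss] = map (table N) vss"
    by (rule nth_equalityI) (use assms(1) in \<open>simp_all add: app_nth_def concat_app_table\<close>)
  moreover have "map ?g [length vss..<N] = replicate (N - length vss) (replicate N 0)"
    by (rule nth_equalityI) (simp_all add: app_nth_def map_replicate_const concat_replicate_single)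
  moreover have "concat (replicate m (replicate N 0)) = replicate (m * N) (0::nat)" for m
    by (induction m) (simp_all add: replicate_add)
  ultimately show ?thesis by simp
qed

lemma encode_fact_instance:
  assumes "length vs < N" "\<forall>vs \<in> set vss. length vs < N" "length vss \<le> N"
  shows "encode (Seq [form_data (fact_form k), struct_data fact_sig N (fact_struct N vs vss)]) =
    output_word k N vs vss"
proof -
  have s: "sorted_list_of_set {0, 1, 2 :: nat} = [0, 1, 2]"
    by (simp add: sorted_list_of_set_insert_remove)
  have n1: "List.n_lists 1 xs = map (\<lambda>x. [x]) xs" for xs :: "nat list"
    by (simp add: n_lists.simps)
  have n2: "List.n_lists 2 xs = concat (map (\<lambda>i. map (\<lambda>x. [x, i]) xs) xs)" for xs :: "nat list"
    by (simp add: numeral_2_eq_2 comp_def)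
  have t1: "concat (map encode (map (\<lambda>xs. Num (fun_int (fact_struct N vs vss) 1 xs)) (List.n_lists 1 [0..<N]))) = table N vs"
    unfolding n1 concat_app_table[OF assms(1), symmetric] by (simp add: comp_def fact_struct_def)
  have t2: "concat (map encode (map (\<lambda>xs. Num (fun_int (fact_struct N vs vss) 2 xs)) (List.n_lists 2 [0..<N]))) =
      concat (map (table N) vss) @ replicate ((N - length vss) * N) 0"
    unfolding n2 concat_app_nth_tables[OF assms(2,3), symmetric]
    by (simp add: comp_def fact_struct_def map_concat concat_map_concat)
  have "encode (struct_data fact_sig N (fact_struct N vs vss)) =
    2 # unary N @ text2 @ table N vs @ text3 @ concat (map (table N) vss) @ replicate ((N - length vss) * N) 0 @ [3, 3, 3, 2, 3, 3]"
    using t1 t2 by (simp add: struct_data_def fact_sig_def s text2_def text3_def fact_struct_def)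
  then show ?thesis
    unfolding output_word_def encode_fact_form[symmetric] by (simp add: text4_def)
qed

lemma inj_term_data: "inj term_data"
proof (rule injI)
  show "term_data t = term_data t' \<Longrightarrow> t = t'" for t t'
  proof (induction t arbitrary: t')
    case (Var x)
    then show ?case by (cases t') auto
  next
    case (Fun f ts)
    then obtain ts' where t': "t' = Fun f ts'" and "map term_data ts = map term_data ts'"
      by (cases t') auto
    then have "ts = ts'" using Fun.IH
      by (metis (no_types, lifting) list.inj_map_strong)
    then show ?case using t' by simp
  qed
qed

text \<open>Membership in \<open>pMC D\<close> only says that some sentence and some structure have
  the given encoding; injectivity recovers the sentence.\<close>

lemma inj_form_data: "inj form_data"
proof (rule injI)
  note inj = inj_eq[OF inj_term_data] inj_map_eq_map[OF inj_term_data]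
  show "form_data F = form_data F' \<Longrightarrow> F = F'" for F F'
  proof (induction F arbitrary: F')
    case (Eq s t) then show ?case by (cases F') (auto simp: inj)
  next
    case (Rel r ts) then show ?case by (cases F') (auto simp: inj)
  next
    case (Neg F) then show ?case by (cases F') auto
  next
    case (Conj F G) then show ?case by (cases F') auto
  next
    case (Disj F G) then show ?case by (cases F') auto
  next
    case (Exi x F) then show ?case by (cases F') auto
  next
    case (All x F) then show ?case by (cases F') auto
  qed
qed

subsection \<open>Meaning of the formula\<close>

text \<open>What the encoding of \<open>fact_struct\<close> reveals about a structure: values at
  arguments outside the universe stay open, and the sentence never looks at them.\<close>

definition interprets :: "nat fo_struct \<Rightarrow> nat \<Rightarrow> nat list \<Rightarrow> nat list list \<Rightarrow> bool" where
  "interprets A N vs vss \<longleftrightarrow> universe A = {..<N} \<and> fun_int A 0 [] = 0 \<and>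
     (\<forall>x < N. fun_int A 1 [x] = app vs x) \<and> (\<forall>x < N. \<forall>i < N. fun_int A 2 [x, i] = app_nth vss x i)"

text \<open>One valuation describes all choices together. If a variable is repeated in
  \<open>xs\<close>, the inner choice overrides the outer one.\<close>

lemma sat_foldr_Exi:
  "sat A e (foldr Exi xs F) \<longleftrightarrow>
     (\<exists>e'. (\<forall>v \<in> set xs. e' v \<in> universe A) \<and> (\<forall>v. v \<notin> set xs \<longrightarrow> e' v = e v) \<and> sat A e' F)"
proof (induction xs arbitrary: e)
  case Nil
  have "(\<forall>v. e' v = e v) \<longleftrightarrow> e' = e" for e' :: "nat \<Rightarrow> 'a" by auto
  then show ?case by simp
next
  case (Cons x xs)
  show ?case
  proof
    assume "sat A e (foldr Exi (x # xs) F)"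
    then obtain d e' where "d \<in> universe A" "\<forall>v \<in> set xs. e' v \<in> universe A"
      "\<forall>v. v \<notin> set xs \<longrightarrow> e' v = (e(x := d)) v" "sat A e' F"
      using Cons.IH by auto
    moreover from this have "e' x \<in> universe A" by (cases "x \<in> set xs") auto
    ultimately show "\<exists>e'. (\<forall>v \<in> set (x # xs). e' v \<in> universe A) \<and> (\<forall>v. v \<notin> set (x # xs) \<longrightarrow> e' v = e v) \<and> sat A e' F"
      by (intro exI[of _ e']) auto
  next
    assume "\<exists>e'. (\<forall>v \<in> set (x # xs). e' v \<in> universe A) \<and> (\<forall>v. v \<notin> set (x # xs) \<longrightarrow> e' v = e v) \<and> sat A e' F"
    then obtain e' where e': "\<forall>v \<in> set (x # xs). e' v \<in> universe A" "\<forall>v. v \<notin> set (x # xs) \<longrightarrow> e' v = e v" "sat A e' F"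
      by blast
    then have "sat A (e(x := e' x)) (foldr Exi xs F)"
      unfolding Cons.IH by (intro exI[of _ e']) auto
    then show "sat A e (foldr Exi (x # xs) F)" using e' by auto
  qed
qed

lemma app_less: "set vs \<subseteq> {..<N} \<Longrightarrow> 0 < N \<Longrightarrow> app vs x < N"
  using nth_mem[of "x - 1" vs] by (auto simp: app_def subset_eq)

lemma app_nth_less: "\<forall>vs \<in> set vss. set vs \<subseteq> {..<N} \<Longrightarrow> 0 < N \<Longrightarrow> app_nth vss x i < N"
  by (simp add: app_nth_def app_less)

text \<open>The bound is proved along with the value because \<open>interprets\<close> describes
  \<open>f\<close> on arguments below \<open>N\<close> only.\<close>

lemma eval_product_term:
  assumes "interprets A N vs vss" "\<forall>vs \<in> set vss. set vs \<subseteq> {..<N}" "0 < N" "\<forall>j \<le> k. e j < N"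
  shows "eval_term A e (product_term k) = foldl (app_nth vss) (e 0) (map e [1..<k + 1]) \<and>
    eval_term A e (product_term k) < N"
  using assms(4)
proof (induction k)
  case (Suc k)
  then show ?case
    using assms(1) app_nth_less[OF assms(2,3)] by (simp add: interprets_def)
qed simp

lemma models_fact_form:
  assumes A: "interprets A N vs vss" and vss: "\<forall>vs \<in> set vss. set vs \<subseteq> {..<N}" and N: "0 < N"
  shows "models A (fact_form k) \<longleftrightarrow> factorizable N vs vss k"
proof -
  have U: "universe A = {..<N}" using A by (simp add: interprets_def)
  have matrix: "sat A (e(0 := x)) (matrix k) \<longleftrightarrow>
      app vs x = 0 \<or> app vs x = foldl (app_nth vss) x (map e [1..<k + 1])"
    if "x < N" "\<forall>j \<in> set [1..<k + 1]. e j < N" for x e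
  proof -
    have "\<forall>j \<le> k. (e(0 := x)) j < N" using that by (auto simp del: upt_Suc)
    then have "eval_term A (e(0 := x)) (product_term k) = foldl (app_nth vss) x (map (e(0 := x)) [1..<k + 1])"
      using eval_product_term[OF A vss N, of k "e(0 := x)"] by simp
    moreover have "map (e(0 := x)) [1..<k + 1] = map e [1..<k + 1]" by (intro map_cong) auto
    ultimately show ?thesis using A that(1) by (simp add: matrix_def interprets_def)
  qed
  have "sat A e (fact_form k) \<longleftrightarrow> factorizable N vs vss k" for e
  proof
    assume "sat A e (fact_form k)"
    then obtain e' where e': "\<forall>v \<in> set [1..<k + 1]. e' v \<in> universe A" "sat A e' (All 0 (matrix k))"
      unfolding fact_form_def sat_foldr_Exi by blast
    then show "factorizable N vs vss k"
      unfolding factorizable_def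
      by (intro exI[of _ "map e' [1..<k + 1]"]) (auto simp: U matrix simp del: upt_Suc)
  next
    assume "factorizable N vs vss k"
    then obtain "is" where i: "length is = k" "set is \<subseteq> {..<N}"
      "\<forall>x < N. app vs x = 0 \<or> app vs x = foldl (app_nth vss) x is"
      unfolding factorizable_def by blast
    \<comment> \<open>Position \<open>v - 1\<close>, as the existential variables are numbered from
      1 and variable 0 is the universal one.\<close>
    define e' where "e' = (\<lambda>v. if v \<in> set [1..<k + 1] then is ! (v - 1) else e v)"
    have m: "map e' [1..<k + 1] = is"
      by (rule nth_equalityI) (auto simp: e'_def i(1) simp del: upt_Suc)
    have e': "\<forall>v \<in> set [1..<k + 1]. e' v < N"
      using i(1,2) by (auto simp: e'_def subset_eq)
    have "sat A e' (All 0 (matrix k))"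
      unfolding sat.simps U
    proof
      fix x assume "x \<in> {..<N}"
      then show "sat A (e'(0 := x)) (matrix k)" using matrix[OF _ e', of x] i(3) unfolding m by blast
    qed
    moreover have "\<forall>v. v \<notin> set [1..<k + 1] \<longrightarrow> e' v = e v" unfolding e'_def by presburger
    ultimately have "(\<forall>v \<in> set [1..<k + 1]. e' v \<in> universe A) \<and>
        (\<forall>v. v \<notin> set [1..<k + 1] \<longrightarrow> e' v = e v) \<and> sat A e' (All 0 (matrix k))"
      using e' unfolding U lessThan_iff by (intro conjI)
    then show "sat A e (fact_form k)"
      unfolding fact_form_def sat_foldr_Exi by - (rule exI[of _ e'], assumption)
  qed
  \<comment> \<open>\<open>models\<close> quantifies over the valuations into the universe; a
    constant one shows that this is not vacuous.\<close>
  moreover have "range (\<lambda>_. 0) \<subseteq> universe A" using U N by auto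
  ultimately show ?thesis unfolding models_def by blast
qed

subsection \<open>Factorizations\<close>

definition map_list :: "nat \<Rightarrow> (nat \<Rightarrow> nat) \<Rightarrow> nat list" where
  "map_list n f = map f [1..<n + 1]"

lemma app_map_list: "app (map_list n f) x = (if 1 \<le> x \<and> x \<le> n then f x else 0)"
  by (auto simp: app_def map_list_def simp del: upt_Suc)

lemma trans_monoid_apply: "f \<in> carrier (trans_monoid n) \<Longrightarrow> x \<in> {1..n} \<Longrightarrow> f x \<in> {1..n}"
  unfolding trans_monoid_def partial_object.simps monoid.simps by (rule PiE_mem)

lemma trans_monoid_undefined: "f \<in> carrier (trans_monoid n) \<Longrightarrow> x \<notin> {1..n} \<Longrightarrow> f x = undefined"
  unfolding trans_monoid_def partial_object.simps monoid.simps by (rule PiE_arb)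

lemma is_row_map_list: "f \<in> carrier (trans_monoid n) \<Longrightarrow> is_row n (map_list n f)"
  using trans_monoid_apply[of f n] unfolding is_row_def map_list_def by force

lemma map_list_surj: "is_row n vs \<Longrightarrow> \<exists>f \<in> carrier (trans_monoid n). vs = map_list n f"
  by (rule bexI[of _ "\<lambda>x \<in> {1..n}. vs ! (x - 1)"])
    (auto simp: is_row_def map_list_def trans_monoid_def subset_eq intro!: nth_equalityI simp del: upt_Suc)

lemma encode_map_data: "encode (map_data n f) = map_word (map_list n f)"
  by (simp add: map_data_def map_list_def row_word_def comp_def)

text \<open>As products are evaluated from left to right, the first factor acts first, so a point
  runs through the list from its head. The restriction to \<open>{1..n}\<close> also yields the unit
  for the empty list.\<close>

lemma foldr_trans_monoid:
  "set gs \<subseteq> carrier (trans_monoid n) \<Longrightarrow>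
   foldr (\<lambda>x y. x \<otimes>\<^bsub>trans_monoid n\<^esub> y) gs \<one>\<^bsub>trans_monoid n\<^esub> = (\<lambda>x \<in> {1..n}. foldl (\<lambda>x g. g x) x gs)"
proof (induction gs)
  case (Cons g gs)
  then have "g x \<in> {1..n}" if "x \<in> {1..n}" for x using trans_monoid_apply[OF _ that] by simp
  then show ?case using Cons
    by (auto simp: trans_monoid_def compose_def restrict_def fun_eq_iff)
qed (simp add: trans_monoid_def)

lemma foldl_apply_closed:
  "set gs \<subseteq> carrier (trans_monoid n) \<Longrightarrow> x \<in> {1..n} \<Longrightarrow> foldl (\<lambda>x g. g x) x gs \<in> {1..n}"
proof (induction gs arbitrary: x)
  case (Cons g gs)
  then show ?case using trans_monoid_apply[of g n x] by simp
qed simp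

lemma foldl_app_nth_0: "foldl (app_nth vss) 0 is = 0"
  by (induction "is") (simp_all add: app_nth_def app_def)

text \<open>The first index without a map produces \<open>0\<close>, and by
  \<open>foldl_app_nth_0\<close> the result stays there.\<close>

lemma foldl_app_nth_index: "foldl (app_nth vss) x is \<noteq> 0 \<Longrightarrow> set is \<subseteq> {..<length vss}"
proof (induction "is" arbitrary: x)
  case (Cons i "is")
  have "app_nth vss x i = 0" if "\<not> i < length vss" using that by (simp add: app_nth_def)
  then show ?case using Cons by (cases "i < length vss") (auto simp: foldl_app_nth_0)
qed simp

lemma foldl_app_nth:
  "set as \<subseteq> carrier (trans_monoid n) \<Longrightarrow> set is \<subseteq> {..<length as} \<Longrightarrow> x \<in> {1..n} \<Longrightarrow>
   foldl (app_nth (map (map_list n) as)) x is = foldl (\<lambda>x g. g x) x (map ((!) as) is)"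
proof (induction "is" arbitrary: x)
  case (Cons i "is")
  then have "(as ! i) x \<in> {1..n}"
    using foldl_apply_closed[of "[as ! i]" n x] by (simp add: subset_eq)
  then show ?case using Cons by (simp add: app_nth_def app_map_list)
qed simp

lemma factorizable_iff:
  assumes a: "a \<in> carrier (trans_monoid n)" and as: "set as \<subseteq> carrier (trans_monoid n)"
    and n: "1 \<le> n" "n < N" "length as \<le> N"
  shows "factorizable N (map_list n a) (map (map_list n) as) k \<longleftrightarrow> a \<in> set_power (trans_monoid n) (set as) k"
proof
  assume "factorizable N (map_list n a) (map (map_list n) as) k"
  then obtain "is" where i: "length is = k" and eq: "\<And>x. x < N \<Longrightarrow> app (map_list n a) x = 0 \<or>
      app (map_list n a) x = foldl (app_nth (map (map_list n) as)) x is"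
    unfolding factorizable_def by blast
  have pos: "a x \<in> {1..n}" if "x \<in> {1..n}" for x
    using trans_monoid_apply[OF a that] .
  have eq': "a x = foldl (app_nth (map (map_list n) as)) x is" if "x \<in> {1..n}" for x
    using eq[of x] that pos[OF that] n by (auto simp: app_map_list)
  have "set is \<subseteq> {..<length as}"
    \<comment> \<open>All points share the same indices, so the single point \<open>1\<close>,
      available by \<open>1 \<le> n\<close>, shows that every index is valid.\<close>
    using eq'[of 1] pos[of 1] n foldl_app_nth_index[of "map (map_list n) as" 1 "is"] by auto
  then have gs: "set (map ((!) as) is) \<subseteq> set as" and
    eq'': "\<And>x. x \<in> {1..n} \<Longrightarrow> a x = foldl (\<lambda>x g. g x) x (map ((!) as) is)"
    using eq' foldl_app_nth[OF as] by auto
  have "a = (\<lambda>x \<in> {1..n}. foldl (\<lambda>x g. g x) x (map ((!) as) is))"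
  proof
    fix x
    show "a x = (\<lambda>x \<in> {1..n}. foldl (\<lambda>x g. g x) x (map ((!) as) is)) x"
      using eq''[of x] trans_monoid_undefined[OF a, of x] by (cases "x \<in> {1..n}") (simp_all del: atLeastAtMost_iff)
  qed
  also have "\<dots> = foldr (\<lambda>x y. x \<otimes>\<^bsub>trans_monoid n\<^esub> y) (map ((!) as) is) \<one>\<^bsub>trans_monoid n\<^esub>"
    using gs as by (intro foldr_trans_monoid[symmetric]) blast
  finally show "a \<in> set_power (trans_monoid n) (set as) k"
    unfolding set_power_def using gs i by (intro CollectI exI[of _ "map ((!) as) is"]) simp
next
  assume "a \<in> set_power (trans_monoid n) (set as) k"
  then obtain gs where gs: "length gs = k" "set gs \<subseteq> set as"
    and a': "a = foldr (\<lambda>x y. x \<otimes>\<^bsub>trans_monoid n\<^esub> y) gs \<one>\<^bsub>trans_monoid n\<^esub>"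
    unfolding set_power_def by blast
  have "\<forall>g \<in> set gs. \<exists>i < length as. as ! i = g" using gs(2) by (metis in_set_conv_nth subsetD)
  \<comment> \<open>A choice of one index per factor; \<open>as\<close> may list the same map
    several times.\<close>
  then obtain ix where ix: "\<And>g. g \<in> set gs \<Longrightarrow> ix g < length as \<and> as ! ix g = g" by metis
  let ?is = "map ix gs"
  have ix': "set ?is \<subseteq> {..<length as}" "map ((!) as) ?is = gs" using ix by (auto intro: map_idI)
  have "a x = foldl (app_nth (map (map_list n) as)) x ?is" if "x \<in> {1..n}" for x
    unfolding foldl_app_nth[OF as ix'(1) that] ix'(2) a' using foldr_trans_monoid[of gs n] gs(2) as that by auto
  then show "factorizable N (map_list n a) (map (map_list n) as) k"
    unfolding factorizable_def using gs(1) ix'(1) n(3)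
    by (intro exI[of _ ?is]) (auto simp: app_map_list)
qed

section \<open>The reduction\<close>

lemma encode_alphabet: "set (encode d) \<subseteq> code_alphabet"
  by (induction d) (auto simp: code_alphabet_def unary_def)

lemma encode_lists: "encode d \<in> lists code_alphabet"
  using encode_alphabet by (simp add: in_lists_conv_set subset_eq)

lemma finite_code_alphabet: "finite code_alphabet"
  by (simp add: code_alphabet_def)

lemma is_param_problem_pF_T: "is_param_problem pF_T"
  using encode_lists finite_code_alphabet by (auto simp: is_param_problem_def pF_T_def simp del: encode.simps)

lemma is_param_problem_pMC: "is_param_problem (pMC D)"
  using encode_lists finite_code_alphabet by (auto simp: is_param_problem_def pMC_def simp del: encode.simps)

lemma encode_pF_T_instance:
  "encode (Seq [Num n, map_data n a, Seq (map (map_data n) as)]) =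
     2 # unary n @ 0 # map_word (map_list n a) @ 2 # concat (map map_word (map (map_list n) as)) @ [3, 3]"
  using encode_map_data by (simp add: comp_def)

lemma is_instance_iff:
  "is_instance u n vs vss \<longleftrightarrow> (\<exists>a as. 1 \<le> n \<and> a \<in> carrier (trans_monoid n) \<and> set as \<subseteq> carrier (trans_monoid n) \<and>
     vs = map_list n a \<and> vss = map (map_list n) as \<and>
     u = encode (Seq [Num n, map_data n a, Seq (map (map_data n) as)]))"
proof
  assume i: "is_instance u n vs vss"
  then obtain a where a: "a \<in> carrier (trans_monoid n)" "vs = map_list n a"
    using map_list_surj unfolding is_instance_def by blast
  have "\<forall>vs \<in> set vss. is_row n vs" using i by (simp add: is_instance_def)
  then have "\<exists>as. set as \<subseteq> carrier (trans_monoid n) \<and> vss = map (map_list n) as"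
  proof (induction vss)
    case (Cons vs vss)
    then obtain f as where "f \<in> carrier (trans_monoid n)" "vs = map_list n f"
      "set as \<subseteq> carrier (trans_monoid n)" "vss = map (map_list n) as"
      using map_list_surj by force
    then show ?case by (intro exI[of _ "f # as"]) simp
  qed simp
  then show "\<exists>a as. 1 \<le> n \<and> a \<in> carrier (trans_monoid n) \<and> set as \<subseteq> carrier (trans_monoid n) \<and>
     vs = map_list n a \<and> vss = map (map_list n) as \<and>
     u = encode (Seq [Num n, map_data n a, Seq (map (map_data n) as)])"
    using i a unfolding encode_pF_T_instance is_instance_def by blast
next
  assume "\<exists>a as. 1 \<le> n \<and> a \<in> carrier (trans_monoid n) \<and> set as \<subseteq> carrier (trans_monoid n) \<and>
     vs = map_list n a \<and> vss = map (map_list n) as \<and>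
     u = encode (Seq [Num n, map_data n a, Seq (map (map_data n) as)])"
  then show "is_instance u n vs vss"
    unfolding encode_pF_T_instance is_instance_def using is_row_map_list by (auto simp: subset_eq)
qed

text \<open>This justifies the definite description in \<open>reduction\<close> and later identifies
  the maps parsed from \<open>u\<close> with those given by membership in
  \<open>pF_T\<close>.\<close>

lemma is_instance_unique:
  assumes "is_instance u n vs vss" "is_instance u n' vs' vss'"
  shows "n = n' \<and> vs = vs' \<and> vss = vss'"
proof -
  have 1: "n = n' \<and> map_word vs @ 2 # concat (map map_word vss) @ [3, 3] = map_word vs' @ 2 # concat (map map_word vss') @ [3, 3]"
    using assms by (intro unary_append_eqD) (simp add: is_instance_def)
  have 2: "vs = vs' \<and> 3 # 2 # concat (map map_word vss) @ [3, 3] = 3 # 2 # concat (map map_word vss') @ [3, 3]"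
    using 1 assms by (intro row_word_append_eqD) (simp_all add: is_instance_def is_row_def)
  have "vss = vss' \<and> [3, 3 :: nat] = [3, 3]"
    using 1 2 assms by (intro map_words_append_eqD[of _ _ _ _ n]) (auto simp: is_instance_def)
  then show ?thesis using 1 2 by simp
qed

lemma is_instance_bounds:
  assumes "is_instance u n vs vss"
  shows "n < length u" "length vss \<le> length u" "length vs = n" "set vs \<subseteq> {..<length u}"
    "\<forall>vs \<in> set vss. length vs = n \<and> set vs \<subseteq> {..<length u}"
proof -
  have u: "u = 2 # unary n @ 0 # map_word vs @ 2 # concat (map map_word vss) @ [3, 3]"
    and r: "is_row n vs" "\<forall>vs \<in> set vss. is_row n vs" using assms by (simp_all add: is_instance_def)
  have l: "length u = n + 7 + length (row_word vs) + length (concat (map map_word vss))"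
    using arg_cong[OF u, of length] by simp
  then show n: "n < length u" by simp
  have "length vss \<le> length (concat (map map_word vss))" by (induction vss) auto
  then show "length vss \<le> length u" using l by simp
  show "length vs = n" "set vs \<subseteq> {..<length u}" "\<forall>vs \<in> set vss. length vs = n \<and> set vs \<subseteq> {..<length u}"
    using r n by (fastforce simp: is_row_def)+
qed

text \<open>The new parameter stands outside the conditional: it must depend on \<open>k\<close>
  alone, also for malformed words.\<close>

definition reduction :: "nat list \<times> nat \<Rightarrow> nat list \<times> nat" where
  "reduction = (\<lambda>(u, k).
     (if \<exists>n vs vss. is_instance u n vs vss
      then THE w. \<exists>n vs vss. is_instance u n vs vss \<and> w = output_word k (length u) vs vss else [],
      3 * k + 10))"

lemma reduction_instance:
  assumes "is_instance u n vs vss"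
  shows "reduction (u, k) = (output_word k (length u) vs vss, 3 * k + 10)"
proof -
  have "(THE w. \<exists>n vs vss. is_instance u n vs vss \<and> w = output_word k (length u) vs vss) = output_word k (length u) vs vss"
    using assms is_instance_unique by (intro the_equality) blast+
  then show ?thesis using assms by (auto simp: reduction_def)
qed

lemma reduction_no_instance:
  "\<nexists>n vs vss. is_instance u n vs vss \<Longrightarrow> reduction (u, k) = ([], 3 * k + 10)"
  by (simp only: reduction_def prod.case if_False)

lemma encode_instance:
  assumes "is_instance u n vs vss"
  shows "encode (Seq [form_data (fact_form k), struct_data fact_sig (length u) (fact_struct (length u) vs vss)]) =
    output_word k (length u) vs vss"
  using is_instance_bounds[OF assms] by (intro encode_fact_instance) auto

lemma reduction_alphabet: "set (fst (reduction (u, k))) \<subseteq> code_alphabet"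
proof (cases "\<exists>n vs vss. is_instance u n vs vss")
  case True
  then obtain n vs vss where i: "is_instance u n vs vss" by blast
  show ?thesis unfolding reduction_instance[OF i] encode_instance[OF i, symmetric] fst_conv by (rule encode_alphabet)
next
  case False
  then show ?thesis by (simp add: reduction_no_instance)
qed

lemma computable_reduction: "computable_in_fpt_time code_alphabet reduction"
  unfolding computable_in_fpt_time_def
proof (intro exI conjI ballI allI)
  show "turing_machine (prog_tm 8 {0, 1, 2, 3} main_prog)"
    by (rule turing_machine_prog_tm) (simp, rule wf_main_prog)
  show "computable quad" by (rule computable_quad)
  fix u k assume "u \<in> lists code_alphabet"
  then have u: "set u \<subseteq> {0, 1, 2, 3}" by (auto simp: code_alphabet_def)
  from exec_main[OF u, of k] obtain s b \<sigma> where
    e: "exec main_prog (map (\<lambda>i. input_tape (if i < length [u, unary k] then [u, unary k] ! i else [])) [0..<8]) s b \<sigma>"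
      "s \<le> 3 * total_time u k + 3" and o1: "output_tape (\<sigma> ! 1) (unary (3 * k + 10))"
    and inst: "\<And>n vs vss. is_instance u n vs vss \<Longrightarrow> \<exists>n vs vss. is_instance u n vs vss \<and>
       output_tape (\<sigma> ! 0) (output_word k (length u) vs vss)"
    and no: "\<nexists>n vs vss. is_instance u n vs vss \<Longrightarrow> output_tape (\<sigma> ! 0) []"
    by blast
  have o0: "output_tape (\<sigma> ! 0) (fst (reduction (u, k)))"
  proof (cases "\<exists>n vs vss. is_instance u n vs vss")
    case True
    then obtain n vs vss where "is_instance u n vs vss" "output_tape (\<sigma> ! 0) (output_word k (length u) vs vss)"
      using inst by blast
    then show ?thesis by (simp add: reduction_instance)
  next
    case False
    then show ?thesis using no by (simp add: reduction_no_instance)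
  qed
  have snd: "snd (reduction (u, k)) = 3 * k + 10" by (simp add: reduction_def)
  show "tm_computes (prog_tm 8 {0, 1, 2, 3} main_prog) [u, unary k]
     [fst (reduction (u, k)), unary (snd (reduction (u, k)))]
     (poly ([:10000:] * [:1, 1:] ^ 3) (length u) * quad k)"
  proof (rule tm_computes_exec[OF e(1)])
    show "s \<le> poly ([:10000:] * [:1, 1:] ^ 3) (length u) * quad k"
      using e(2) total_time_bound[of u k] by (rule order.trans)
    show "wf_prog 8 {0, 1, 2, 3} main_prog" by (rule wf_main_prog)
    show "\<forall>w \<in> set [u, unary k]. set w \<subseteq> {0, 1, 2, 3}" using u by (auto simp: unary_def)
    fix i assume "i < length [fst (reduction (u, k)), unary (snd (reduction (u, k)))]"
    then have "i = 0 \<or> i = 1" by auto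
    then show "output_tape (\<sigma> ! i) ([fst (reduction (u, k)), unary (snd (reduction (u, k)))] ! i)"
      using o0 o1 unfolding snd by auto
  qed simp_all
qed

section \<open>Syntactic properties of the sentence\<close>

lemma term_vars_product_term: "term_vars (product_term k) = {0..k}"
  by (induction k) auto

lemma free_vars_foldr_Exi: "free_vars (foldr Exi xs F) = free_vars F - set xs"
  by (induction xs) auto

lemma sentence_fact_form: "sentence (fact_form k)"
  unfolding sentence_def fact_form_def free_vars_foldr_Exi
  by (auto simp: matrix_def term_vars_product_term simp del: upt_Suc)

lemma fact_form_Sigma: "fact_form k \<in> Sigma_func 2 1"
  unfolding Sigma_func_def
proof (intro CollectI conjI exI)
  show "fact_form k = quantify True [[1..<k + 1], [0]] (matrix k)" by (simp add: fact_form_def)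
qed (auto simp: sentence_fact_form matrix_def nth_Cons split: nat.splits)

text \<open>Each factor adds a quantifier, a symbol \<open>f\<close> and a variable. The other ten
  are the universal quantifier, the disjunction, four for \<open>a(x\<^sub>0) = c\<close>, and four
  for the second equation with \<open>x\<^sub>0\<close> as its right side.\<close>

lemma form_length_fact_form: "form_length (fact_form k) = 3 * k + 10"
proof -
  have "term_size (product_term k) = 2 * k + 1" by (induction k) auto
  moreover have "form_length (foldr Exi xs F) = length xs + form_length F" for xs F
    by (induction xs) auto
  ultimately show ?thesis by (simp add: fact_form_def matrix_def del: upt_Suc)
qed

lemma form_over_fact_form: "form_over fact_sig (fact_form k)"
proof -
  have "term_over fact_sig (product_term k)" by (induction k) (auto simp: fact_sig_def)
  moreover have "form_over S (foldr Exi xs F) = form_over S F" for S xs F by (induction xs) auto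
  ultimately show ?thesis by (simp add: fact_form_def matrix_def fact_sig_def del: upt_Suc)
qed

section \<open>The structure and what its encoding determines\<close>

lemma interprets_fact_struct: "interprets (fact_struct N vs vss) N vs vss"
  by (simp add: interprets_def fact_struct_def)

lemma structure_over_fact_struct:
  assumes "set vs \<subseteq> {..<N}" "\<forall>vs \<in> set vss. set vs \<subseteq> {..<N}" "0 < N"
  shows "structure_over fact_sig (fact_struct N vs vss)"
  using assms app_less[OF assms(1,3)] app_nth_less[OF assms(2,3)]
  by (auto simp: structure_over_def fact_struct_def fact_sig_def split: list.splits)

lemma struct_data_interprets:
  assumes "struct_data S n A = struct_data fact_sig N (fact_struct N vs vss)" "universe A = {..<n}"
  shows "interprets A N vs vss"
proof -
  have s: "sorted_list_of_set (fun_syms fact_sig) = [0, 1, 2]"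
    by (simp add: fact_sig_def sorted_list_of_set_insert_remove)
  \<comment> \<open>The entry of a symbol carries its name and arity besides its table. Equal
    entries therefore belong to the same name with the same arity, and the unknown signature
    \<open>S\<close> need not be compared with \<open>fact_sig\<close> any further.\<close>
  define E where "E S N A = (\<lambda>f. Seq [Num f, Num (fun_ar S f),
      Seq (map (\<lambda>xs. Num (fun_int A f xs)) (List.n_lists (fun_ar S f) [0..<N]))])"
    for S :: fo_sig and N and A :: "nat fo_struct"
  have "n = N \<and> map (E S n A) (sorted_list_of_set (fun_syms S)) =
      map (E fact_sig N (fact_struct N vs vss)) (sorted_list_of_set (fun_syms fact_sig))"
    using assms(1) unfolding struct_data_def E_def data.inject list.inject by (elim conjE) (intro conjI)
  then have n: "n = N" and "map (E S n A) (sorted_list_of_set (fun_syms S)) =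
      map (E fact_sig N (fact_struct N vs vss)) [0, 1, 2]"
    unfolding s by blast+
  then obtain f0 f1 f2 where f: "E S n A f0 = E fact_sig N (fact_struct N vs vss) 0"
    "E S n A f1 = E fact_sig N (fact_struct N vs vss) 1" "E S n A f2 = E fact_sig N (fact_struct N vs vss) 2"
    by (auto simp: map_eq_Cons_conv)
  have tab: "fun_int A f xs = fun_int (fact_struct N vs vss) f xs"
    if "E S n A f' = E fact_sig N (fact_struct N vs vss) f" "length xs = f" "set xs \<subseteq> {..<N}" for f f' xs
  proof -
    have "\<forall>xs \<in> set (List.n_lists f [0..<N]). fun_int A f xs = fun_int (fact_struct N vs vss) f xs"
      using that(1) n by (auto simp: E_def fact_sig_def)
    moreover have "xs \<in> set (List.n_lists f [0..<N])"
      using that(2,3) by (auto simp: set_n_lists)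
    ultimately show ?thesis by blast
  qed
  show ?thesis
    using tab[OF f(1), of "[]"] tab[OF f(2)] tab[OF f(3)] interprets_fact_struct[of N vs vss] assms(2) n
    by (auto simp: interprets_def)
qed

lemma reduction_correct: "(u, k) \<in> instances pF_T \<longleftrightarrow> reduction (u, k) \<in> instances (pMC (Sigma_func 2 1))"
proof (cases "\<exists>n vs vss. is_instance u n vs vss")
  case False
  then have "(u, k) \<notin> instances pF_T"
    unfolding pF_T_def using is_instance_iff by fastforce
  moreover have "reduction (u, k) \<notin> instances (pMC (Sigma_func 2 1))"
    unfolding reduction_no_instance[OF False] by (auto simp: pMC_def)
  ultimately show ?thesis by simp
next
  case True
  then obtain n vs vss where i: "is_instance u n vs vss" by blast
  then obtain a as where n: "1 \<le> n" and a: "a \<in> carrier (trans_monoid n)" and as: "set as \<subseteq> carrier (trans_monoid n)"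
    and vs: "vs = map_list n a" "vss = map (map_list n) as"
    and u: "u = encode (Seq [Num n, map_data n a, Seq (map (map_data n) as)])"
    unfolding is_instance_iff by blast
  let ?N = "length u"
  note b = is_instance_bounds[OF i]
  have b': "\<forall>vs \<in> set vss. set vs \<subseteq> {..<?N}" "0 < ?N" using b by auto
  have fac: "factorizable ?N vs vss k \<longleftrightarrow> a \<in> set_power (trans_monoid n) (set as) k"
    using factorizable_iff[OF a as n b(1)] b(2) vs by simp
  \<comment> \<open>Membership supplies a degree and maps of its own; unique parsing identifies
    their value lists with those fixed above.\<close>
  have pF: "(u, k) \<in> instances pF_T \<longleftrightarrow> factorizable ?N vs vss k"
  proof
    assume "(u, k) \<in> instances pF_T"
    then obtain n' a' as' where *: "u = encode (Seq [Num n', map_data n' a', Seq (map (map_data n') as')])"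
      "n' \<ge> 1" "a' \<in> carrier (trans_monoid n')" "set as' \<subseteq> carrier (trans_monoid n')"
      "a' \<in> set_power (trans_monoid n') (set as') k"
      by (auto simp: pF_T_def)
    then have i': "is_instance u n' (map_list n' a') (map (map_list n') as')"
      unfolding is_instance_iff by blast
    then show "factorizable ?N vs vss k"
      using is_instance_unique[OF i i'] is_instance_bounds[OF i'] factorizable_iff[OF *(3,4,2)] *(5) by simp
  next
    assume "factorizable ?N vs vss k"
    then show "(u, k) \<in> instances pF_T" using fac n a as u by (auto simp: pF_T_def)
  qed
  have pMC: "reduction (u, k) \<in> instances (pMC (Sigma_func 2 1)) \<longleftrightarrow> factorizable ?N vs vss k"
    unfolding reduction_instance[OF i] encode_instance[OF i, symmetric]
  proof
    assume "(encode (Seq [form_data (fact_form k), struct_data fact_sig ?N (fact_struct ?N vs vss)]), 3 * k + 10)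
      \<in> instances (pMC (Sigma_func 2 1))"
    then obtain F S n' A where *:
      "encode (Seq [form_data F, struct_data S n' A]) =
        encode (Seq [form_data (fact_form k), struct_data fact_sig ?N (fact_struct ?N vs vss)])"
      "universe A = {..<n'}" "models A F"
      unfolding pMC_def param_problem.simps by (smt (verit) mem_Collect_eq prod.inject)
    have "Seq [form_data F, struct_data S n' A] = Seq [form_data (fact_form k), struct_data fact_sig ?N (fact_struct ?N vs vss)]"
      using *(1) by (rule injD[OF inj_encode])
    then have "F = fact_form k" "struct_data S n' A = struct_data fact_sig ?N (fact_struct ?N vs vss)"
      using injD[OF inj_form_data] by auto
    then show "factorizable ?N vs vss k"
      using models_fact_form[OF struct_data_interprets b'] *(2,3) by blast
  next
    assume "factorizable ?N vs vss k"
    then have "models (fact_struct ?N vs vss) (fact_form k)"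
      using models_fact_form[OF interprets_fact_struct b'] by blast
    then show "(encode (Seq [form_data (fact_form k), struct_data fact_sig ?N (fact_struct ?N vs vss)]), 3 * k + 10)
      \<in> instances (pMC (Sigma_func 2 1))"
      unfolding pMC_def param_problem.simps mem_Collect_eq
      using fact_form_Sigma sentence_fact_form form_over_fact_form structure_over_fact_struct[OF b(4) b']
      by (intro exI[of _ "fact_form k"] exI[of _ fact_sig] exI[of _ ?N] exI[of _ "fact_struct ?N vs vss"])
        (simp add: form_length_fact_form signature_def fact_struct_def fact_sig_def)
  qed
  show ?thesis unfolding pF pMC ..
qed

theorem theorem4p9: "pF_T \<in> W_func 2"
proof -
  have alph: "alphabet pF_T = code_alphabet" "alphabet (pMC (Sigma_func 2 1)) = code_alphabet"
    by (simp_all add: pF_T_def pMC_def)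
  have "fpt_reduction reduction pF_T (pMC (Sigma_func 2 1))"
    unfolding fpt_reduction_def alph
  proof (intro conjI)
    show "reduction \<in> lists code_alphabet \<times> UNIV \<rightarrow> lists code_alphabet \<times> UNIV"
      by (auto simp: mem_Times_iff in_lists_conv_set dest: subsetD[OF reduction_alphabet])
    show "\<exists>g h. \<forall>u \<in> lists code_alphabet. \<forall>k. reduction (u, k) = (g (u, k), h k)"
      by (intro exI[of _ "\<lambda>x. fst (reduction x)"] exI[of _ "\<lambda>k. 3 * k + 10"]) (simp add: reduction_def)
  qed (use computable_reduction reduction_correct in blast)+
  then show ?thesis
    unfolding W_func_def fpt_class_def fpt_le_def using is_param_problem_pF_T is_param_problem_pMC by blast
qed

end
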